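(* Let $B_1,\dots,B_m$ be $n\times n$ complex skew-symmetric matrices ($B_r^t=-B_r$), $m\ge 3$. For $1\le r\le m$ let $A_r^1=\frac12(B_r+\overline{B_r})$ and $A_r^2=\frac1{2\mathbf{i}}(B_r-\overline{B_r})$. (1) If $n=3$, then $$\sum_{r,s=1}^m\|[B_r,B_s]\|^2\le\frac13\left(\sum_{r=1}^m\|B_r\|^2\right)^2 .$$ Equality holds if and only if $\sum_{r=1}^m[B_r,\overline{B_r}]=0$ and there exists $(P,R)\in K(n,2m)$ with $P\in O(n)$ such that $$(P,R)\cdot(A_1^1,\dots,A_m^1,A_1^2,\dots,A_m^2)=(\mathrm{diag}(C_1,0),\mathrm{diag}(C_2,0),\mathrm{diag}(C_3,0),0,\dots,0),$$ where for some real $\lambda\ge 0$, $$C_1=\begin{pmatrix}0&\lambda&0\\-\lambda&0&0\\0&0&0\end{pmatrix},\quad C_2=\begin{pmatrix}0&0&\lambda\\0&0&0\\-\lambda&0&0\end{pmatrix},\quad C_3=\begin{pmatrix}0&0&0\\0&0&\lambda\\0&-\lambda&0\end{pmatrix}.$$ (2) If $n\ge 4$, then $$\sum_{r,s=1}^m\|[B_r,B_s]\|^2\le\frac23\left(\sum_{r=1}^m\|B_r\|^2\right)^2 .$$ Equality holds if and only if $\sum_{r=1}^m[B_r,\overline{B_r}]=0$ and there exists $(P,R)\in K(n,2m)$ with $P\in O(n)$ such that $$(P,R)\cdot(A_1^1,\dots,A_m^1,A_1^2,\dots,A_m^2)=(\mathrm{diag}(D_1,0),\mathrm{diag}(D_2,0),\mathrm{diag}(D_3,0),0,\dots,0),$$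 where for some real $\lambda\ge 0$, $$D_1=\begin{pmatrix}0&\lambda&0&0\\-\lambda&0&0&0\\0&0&0&\lambda\\0&0&-\lambda&0\end{pmatrix},\quad D_2=\begin{pmatrix}0&0&\lambda&0\\0&0&0&-\lambda\\-\lambda&0&0&0\\0&\lambda&0&0\end{pmatrix},\quad D_3=\begin{pmatrix}0&0&0&\lambda\\0&0&\lambda&0\\0&-\lambda&0&0\\-\lambda&0&0&0\end{pmatrix}.$$
   Context: $[A,B]=AB-BA$; $\overline{A}$ is the entrywise complex conjugate; $A^*=\overline{A}^t$; $\|B\|^2=\mathrm{tr}(BB^* )$ is the squared Frobenius norm; $\mathbf{i}$ is the imaginary unit. $\mathrm{diag}(C,0)$ denotes the $n\times n$ block diagonal matrix with upper-left block $C$ and all other entries zero; the zero block may be empty (so $\mathrm{diag}(C_i,0)=C_i$ when $n=3$ and $\mathrm{diag}(D_i,0)=D_i$ when $n=4$). For positive integers $n,k$, $K(n,k):=U(n)\times O(k)$ (unitary group times real orthogonal group), acting on $k$-tuples of $n\times n$ matrices by $$(P,R)\cdot(A_1,\dots,A_k):=\left(\sum_{j=1}^kR_{j1}P^*A_jP,\dots,\sum_{j=1}^kR_{jk}P^*A_jP\right),\qquad R=(R_{jl})\in O(k).$$ $O(n)$ is the group of real orthogonal $n\times n$ matrices, regarded as a subgroup of $U(n)$. *)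

theory Defs
  imports Complex_Main "Jordan_Normal_Form.Matrix" "Jordan_Normal_Form.Schur_Decomposition"
begin

definition commutator :: "complex mat \<Rightarrow> complex mat \<Rightarrow> complex mat" where
  "commutator A B = A * B - B * A"

definition mat_cnj :: "complex mat \<Rightarrow> complex mat" where
  "mat_cnj A = map_mat cnj A"

definition mat_trace :: "complex mat \<Rightarrow> complex" where
  "mat_trace A = (\<Sum>i<dim_row A. A $$ (i, i))"

(* tr(B B^* ) is a nonnegative real number (see the lemma below), so the real part only
   changes its type. *)
definition frob_sq :: "complex mat \<Rightarrow> real" where
  "frob_sq B = Re (mat_trace (B * mat_adjoint B))"

lemma mat_adjoint_eq: "mat_adjoint A = transpose_mat (mat_cnj A)"
  by (rule eq_matI) (auto simp: mat_adjoint_def mat_cnj_def mat_of_rows_def)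

lemma mat_trace_times_adjoint:
  "mat_trace (B * mat_adjoint B) =
     complex_of_real (\<Sum>i<dim_row B. \<Sum>j<dim_col B. (cmod (B $$ (i, j)))\<^sup>2)"
  by (auto simp: mat_trace_def mat_adjoint_eq mat_cnj_def scalar_prod_def complex_norm_square[symmetric]
      atLeast0LessThan intro!: sum.cong)

(* The type of matrices has no zero element (dimensions vary), so finite sums of n x n matrices are
   taken entrywise. *)
definition mat_sum :: "nat \<Rightarrow> ('i \<Rightarrow> complex mat) \<Rightarrow> 'i set \<Rightarrow> complex mat" where
  "mat_sum n f I = mat n n (\<lambda>ij. \<Sum>i\<in>I. f i $$ ij)"

definition unitary_group :: "nat \<Rightarrow> complex mat set" where
  "unitary_group n = {P \<in> carrier_mat n n. mat_adjoint P * P = 1\<^sub>m n}"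

definition orthogonal_group :: "nat \<Rightarrow> real mat set" where
  "orthogonal_group n = {R \<in> carrier_mat n n. transpose_mat R * R = 1\<^sub>m n}"

(* O(n) regarded as a subgroup of U(n). *)
definition orthogonal_in_unitary :: "nat \<Rightarrow> complex mat set" where
  "orthogonal_in_unitary n = map_mat complex_of_real ` orthogonal_group n"

definition K_group :: "nat \<Rightarrow> nat \<Rightarrow> (complex mat \<times> real mat) set" where
  "K_group n k = unitary_group n \<times> orthogonal_group k"

(* A k-tuple of matrices is a list of length k, indexed from 0; entry l of the result is
   the sum over j of R_{jl} P^* A_j P. *)
definition K_act :: "complex mat \<times> real mat \<Rightarrow> complex mat list \<Rightarrow> complex mat list" where
  "K_act PR As = (case PR of (P, R) \<Rightarrow>
     map (\<lambda>l. mat_sum (dim_row P)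
            (\<lambda>j. complex_of_real (R $$ (j, l)) \<cdot>\<^sub>m (mat_adjoint P * (As ! j) * P))
            {..<length As})
       [0..<length As])"

definition re_part :: "complex mat \<Rightarrow> complex mat" where
  "re_part B = (1 / 2) \<cdot>\<^sub>m (B + mat_cnj B)"

definition im_part :: "complex mat \<Rightarrow> complex mat" where
  "im_part B = (1 / (2 * \<i>)) \<cdot>\<^sub>m (B - mat_cnj B)"

definition diag_zero :: "nat \<Rightarrow> complex mat \<Rightarrow> complex mat" where
  "diag_zero n C = diag_block_mat [C, 0\<^sub>m (n - dim_row C) (n - dim_col C)]"

definition C1 :: "complex \<Rightarrow> complex mat" where
  "C1 x = mat_of_rows_list 3
     [[ 0, x, 0],
      [-x, 0, 0],
      [ 0, 0, 0]]"

definition C2 :: "complex \<Rightarrow> complex mat" where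
  "C2 x = mat_of_rows_list 3
     [[ 0, 0, x],
      [ 0, 0, 0],
      [-x, 0, 0]]"

definition C3 :: "complex \<Rightarrow> complex mat" where
  "C3 x = mat_of_rows_list 3
     [[0,  0, 0],
      [0,  0, x],
      [0, -x, 0]]"

definition D1 :: "complex \<Rightarrow> complex mat" where
  "D1 x = mat_of_rows_list 4
     [[ 0, x,  0, 0],
      [-x, 0,  0, 0],
      [ 0, 0,  0, x],
      [ 0, 0, -x, 0]]"

definition D2 :: "complex \<Rightarrow> complex mat" where
  "D2 x = mat_of_rows_list 4
     [[ 0, 0, x,  0],
      [ 0, 0, 0, -x],
      [-x, 0, 0,  0],
      [ 0, x, 0,  0]]"

definition D3 :: "complex \<Rightarrow> complex mat" where
  "D3 x = mat_of_rows_list 4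
     [[ 0,  0, 0, x],
      [ 0,  0, x, 0],
      [ 0, -x, 0, 0],
      [-x,  0, 0, 0]]"

end

theory Submission
  imports Defs
begin

text \<open>
  Writing \<open>B r = X r + \<i> Y r\<close>, the Jacobi identity turns the sum over the \<open>B r\<close> into the sum over the
  \<open>2 m\<close> real skew-symmetric matrices \<open>X r, Y r\<close> minus \<open>2 \<parallel>\<Sum>r. [X r, Y r]\<parallel>\<^sup>2\<close>, so everything is about
  a real tuple \<open>A\<close>. An orthogonal change of the tuple makes it orthogonal, say with
  \<open>x i = \<parallel>A i\<parallel>\<^sup>2\<close>, \<open>p = \<Sum>i. x i\<close> and \<open>q = \<Sum>i. (x i)\<^sup>2\<close>.

  For a real skew-symmetric \<open>A\<close> with eigenvalues \<open>\<i> \<theta> j\<close> the operator \<open>[A, _]\<close> has eigenvalues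
  \<open>\<i> (\<theta> j + \<theta> k)\<close>. As the spectrum is symmetric, \<open>(\<theta> j + \<theta> k)\<^sup>2 \<le> \<parallel>A\<parallel>\<^sup>2\<close>, which gives
  \<open>\<parallel>[A, B]\<parallel> \<le> \<parallel>A\<parallel> \<parallel>B\<parallel>\<close>; and the bound on the signless Laplacian of a graph by the number of edges
  plus one gives \<open>\<Sum>i\<in>S. \<parallel>[A, B i]\<parallel>\<^sup>2 \<le> (|S| / 2 + 1) \<parallel>A\<parallel>\<^sup>2\<close> for orthonormal \<open>B i\<close>.
  The first estimate bounds the total by \<open>p\<^sup>2 - q\<close>, the second by \<open>(p\<^sup>2 + q) / 2\<close>, and hence it is at most
  \<open>2/3 p\<^sup>2\<close>. Equality leaves exactly three nonzero matrices, of equal norm, which anticommute and satisfy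
  \<open>A i * A i * A j = - \<lambda>\<^sup>2 A j\<close>; a unit vector in their common range generates the quaternionic basis
  in which they take the form \<open>D1, D2, D3\<close>. For \<open>n = 3\<close> the commutator is the cross product, and
  the inequality compares the diagonal entries of a \<open>3 \<times> 3\<close> Gram matrix.
\<close>


text \<open>The pairwise estimate alone cannot give 2/3: \<open>k\<close> matrices of equal norm,
  all pairs extremal, would reach \<open>(1 - 1 / k) * p^2\<close>. What excludes this for
  \<open>k > 3\<close> is the collective estimate, whose additive 1 admits at most two partners at
  ratio 1, as \<open>2 / 2 + 1 = 2\<close>. Sums rather than differences of the \<theta> occur
  because matrices are read in the coordinates \<open>mat_adjoint U * X * mat_cnj U\<close>. This is
  a congruence, so skew symmetry survives and the diagonal vanishes. The squared moduli of the
  entries of an orthonormal family then form a symmetric weight, at most 1/2 per entry. The edge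
  bound is applied separately to the nonnegative and the negative \<theta>; each half carries
  \<open>frob_sq A / 2\<close>, so the extra 1 is paid twice at half price, and pairs of opposite
  sign cost nothing extra. The Jacobi identity turns the cross term of \<open>B r\<close> and
  \<open>B s\<close> into the inner product of \<open>[X r, Y r]\<close> and
  \<open>[X s, Y s]\<close>; only in this form is the double sum a squared norm. Since
  \<open>[B r, cnj (B r)] = - 2 i [X r, Y r]\<close>, the extra condition in the equality case says
  that this norm vanishes.\<close>

subsection \<open>Orthonormal families and the spectral theorem\<close>

definition hdot :: "nat \<Rightarrow> (nat \<Rightarrow> complex) \<Rightarrow> (nat \<Rightarrow> complex) \<Rightarrow> complex" where
  "hdot N u v = (\<Sum>t<N. u t * cnj (v t))"

text \<open>Vectors are functions of which only the values below \<open>N\<close> count, so that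
  families can be updated and summed pointwise.\<close>

definition orthonormal :: "nat \<Rightarrow> nat \<Rightarrow> (nat \<Rightarrow> nat \<Rightarrow> complex) \<Rightarrow> bool" where
  "orthonormal N q f \<longleftrightarrow> (\<forall>i<q. \<forall>j<q. hdot N (f i) (f j) = (if i = j then 1 else 0))"

lemma orthonormalD:
  "orthonormal N q f \<Longrightarrow> i < q \<Longrightarrow> j < q \<Longrightarrow> hdot N (f i) (f j) = (if i = j then 1 else 0)"
  by (auto simp: orthonormal_def)

lemma hdot_commute: "hdot N u v = cnj (hdot N v u)"
  by (simp add: hdot_def mult.commute)

lemma hdot_cong:
  "(\<And>t. t < N \<Longrightarrow> u t = u' t) \<Longrightarrow> (\<And>t. t < N \<Longrightarrow> v t = v' t) \<Longrightarrow> hdot N u v = hdot N u' v'"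
  by (simp add: hdot_def)

lemma hdot_sum_left: "hdot N (\<lambda>t. \<Sum>i\<in>I. c i * f i t) v = (\<Sum>i\<in>I. c i * hdot N (f i) v)"
  by (simp add: hdot_def sum_distrib_left sum_distrib_right mult.assoc) (rule sum.swap)

lemma hdot_self: "hdot N u u = complex_of_real (\<Sum>t<N. (cmod (u t))\<^sup>2)"
  by (simp only: hdot_def of_real_sum complex_norm_square)

text \<open>The \<open>q < N\<close> equations are padded with zero rows to a square system; row
  \<open>q\<close> being zero, its determinant vanishes.\<close>

lemma null_vector:
  assumes "q < N"
  obtains v :: "nat \<Rightarrow> complex" where "\<exists>t<N. v t \<noteq> 0" "\<forall>i<q. (\<Sum>t<N. M i t * v t) = 0"
proof -
  define A where "A = mat N N (\<lambda>(i, t). if i < q then M i t else 0)"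
  have A: "A \<in> carrier_mat N N" by (simp add: A_def)
  have "A = mat\<^sub>r N N (\<lambda>i. if i = q then 0\<^sub>v N else row A i)"
    using assms A by (intro eq_matI) (auto simp: A_def)
  moreover have "det \<dots> = 0"
    using A by (intro det_row_0[OF assms]) auto
  ultimately have "det A = 0" by simp
  then obtain x where x: "x \<in> carrier_vec N" "x \<noteq> 0\<^sub>v N" "A *\<^sub>v x = 0\<^sub>v N"
    using det_0_iff_vec_prod_zero_field[OF A] by auto
  show ?thesis
  proof
    show "\<exists>t<N. x $ t \<noteq> 0"
      using x(1,2) by (auto simp: vec_eq_iff)
    show "\<forall>i<q. (\<Sum>t<N. M i t * x $ t) = 0"
    proof (intro allI impI)
      fix i assume that: "i < q"
      have "(A *\<^sub>v x) $ i = (\<Sum>t<N. M i t * x $ t)"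
        using that assms x(1) by (auto simp: A_def scalar_prod_def atLeast0LessThan intro!: sum.cong)
      then show "(\<Sum>t<N. M i t * x $ t) = 0" using x(3) that assms by simp
    qed
  qed
qed

text \<open>A linear equation with real coefficients holds separately for the real and the imaginary
  part of a solution, and one of the two parts is nonzero. This turns complex solutions into
  solutions over \<open>K\<close>.\<close>

lemma real_part_or_imaginary_part:
  fixes v :: "nat \<Rightarrow> complex"
  assumes "\<exists>t<N. v t \<noteq> 0" and K: "K = UNIV \<or> K = \<real>"
  obtains w where "\<exists>t<N. w t \<noteq> 0" "\<forall>t. w t \<in> K"
    "\<forall>c :: nat \<Rightarrow> complex. (\<forall>t<N. c t \<in> K) \<longrightarrow> (\<Sum>t<N. c t * v t) = 0 \<longrightarrow> (\<Sum>t<N. c t * w t) = 0"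
proof (cases "K = UNIV")
  case True
  then show ?thesis using assms(1) by (intro that[of v]) auto
next
  case False
  then have K: "K = \<real>" using K by simp
  have re: "(\<Sum>t<N. c t * complex_of_real (Re (v t))) = 0"
    and im: "(\<Sum>t<N. c t * complex_of_real (Im (v t))) = 0"
    if c: "\<And>t. t < N \<Longrightarrow> c t \<in> K" and z: "(\<Sum>t<N. c t * v t) = 0" for c :: "nat \<Rightarrow> complex"
  proof -
    have c': "Im (c t) = 0" if "t < N" for t
      using c[OF that] K by (simp add: complex_is_Real_iff)
    have "(\<Sum>t<N. Re (c t) * Re (v t)) = 0"
      using arg_cong[OF z, of Re] c' by simp
    then show "(\<Sum>t<N. c t * complex_of_real (Re (v t))) = 0"
      using c' by (simp add: complex_eq_iff)
    have "(\<Sum>t<N. Re (c t) * Im (v t)) = 0"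
      using arg_cong[OF z, of Im] c' by simp
    then show "(\<Sum>t<N. c t * complex_of_real (Im (v t))) = 0"
      using c' by (simp add: complex_eq_iff)
  qed
  show ?thesis
  proof (cases "\<exists>t<N. Re (v t) \<noteq> 0")
    case True
    then show ?thesis using re by (intro that[of "\<lambda>t. complex_of_real (Re (v t))"]) (auto simp: K)
  next
    case False
    then have "\<exists>t<N. Im (v t) \<noteq> 0" using assms(1) by (auto simp: complex_eq_iff)
    then show ?thesis using im by (intro that[of "\<lambda>t. complex_of_real (Im (v t))"]) (auto simp: K)
  qed
qed

lemma normalize_vector:
  fixes v :: "nat \<Rightarrow> complex"
  assumes "\<exists>t<N. v t \<noteq> 0"
  obtains c :: real where "c > 0" "hdot N (\<lambda>t. complex_of_real c * v t) (\<lambda>t. complex_of_real c * v t) = 1"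
proof
  let ?s = "\<Sum>t<N. (cmod (v t))\<^sup>2"
  have "?s > 0"
    using assms by (metis (no_types, lifting) finite_lessThan lessThan_iff norm_eq_zero sum_nonneg_0 sum_nonneg zero_eq_power2 less_eq_real_def zero_le_power2)
  then show "1 / sqrt ?s > 0" by simp
  have "hdot N (\<lambda>t. complex_of_real c * v t) (\<lambda>t. complex_of_real c * v t)
    = complex_of_real (c\<^sup>2) * hdot N v v" for c
    by (simp add: hdot_def sum_distrib_left power2_eq_square mult_ac)
  then have "hdot N (\<lambda>t. complex_of_real (1 / sqrt ?s) * v t) (\<lambda>t. complex_of_real (1 / sqrt ?s) * v t)
    = complex_of_real ((1 / sqrt ?s)\<^sup>2) * hdot N v v" .
  also have "\<dots> = 1"
    using \<open>?s > 0\<close> unfolding hdot_self of_real_mult[symmetric] by (simp add: power_divide)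
  finally show "hdot N (\<lambda>t. complex_of_real (1 / sqrt ?s) * v t) (\<lambda>t. complex_of_real (1 / sqrt ?s) * v t) = 1" .
qed

lemma scale_in_K: "K = UNIV \<or> K = \<real> \<Longrightarrow> x \<in> K \<Longrightarrow> complex_of_real c * x \<in> K"
  by (auto simp: Reals_mult)

lemma sum_in_K: "K = UNIV \<or> K = \<real> \<Longrightarrow> (\<And>i. i \<in> I \<Longrightarrow> f i \<in> K) \<Longrightarrow> sum f I \<in> (K :: complex set)"
  by (auto simp: sum_in_Reals)

lemma mult_in_K: "K = UNIV \<or> K = \<real> \<Longrightarrow> x \<in> K \<Longrightarrow> y \<in> K \<Longrightarrow> x * y \<in> (K :: complex set)"
  by (auto simp: Reals_mult)

lemma cnj_in_K: "K = UNIV \<or> K = \<real> \<Longrightarrow> x \<in> K \<Longrightarrow> cnj x \<in> (K :: complex set)"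
  by (auto simp: Reals_cnj_iff complex_is_Real_iff)

lemma orthonormal_snoc:
  assumes f: "orthonormal N q f" and v: "hdot N v v = 1" "\<And>i. i < q \<Longrightarrow> hdot N v (f i) = 0"
  shows "orthonormal N (Suc q) (f(q := v))"
proof -
  have "hdot N (f i) v = 0" if "i < q" for i
    using v(2)[OF that] by (subst hdot_commute) simp
  then show ?thesis
    using f v by (auto simp: orthonormal_def less_Suc_eq)
qed

text \<open>Orthogonality to the vectors found so far is a linear system with fewer equations than
  unknowns and with coefficients in \<open>K\<close>, so it has a nonzero solution over
  \<open>K\<close>, which is then normalised.\<close>

lemma orthonormal_extend:
  assumes K: "K = UNIV \<or> K = \<real>"
    and f: "orthonormal N q f" "\<And>i t. i < q \<Longrightarrow> f i t \<in> K" and "q \<le> N"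
  obtains g where "orthonormal N N g" "\<forall>i<q. g i = f i" "\<forall>i<N. \<forall>t. g i t \<in> K"
proof -
  have "\<exists>g. orthonormal N (q + d) g \<and> (\<forall>i<q. g i = f i) \<and> (\<forall>i<q+d. \<forall>t. g i t \<in> K)"
    if "q + d \<le> N" for d
    using that
  proof (induction d)
    case 0
    then show ?case using f by auto
  next
    case (Suc d)
    then obtain g where g: "orthonormal N (q + d) g" "\<forall>i<q. g i = f i" "\<forall>i<q+d. \<forall>t. g i t \<in> K" by auto
    obtain v where v: "\<exists>t<N. v t \<noteq> 0" "\<forall>i<q + d. (\<Sum>t<N. cnj (g i t) * v t) = 0"
      using Suc.prems by - (rule null_vector[of "q + d" N "\<lambda>i t. cnj (g i t)"], auto)
    obtain w where w: "\<exists>t<N. w t \<noteq> 0" "\<forall>t. w t \<in> K"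
      "\<forall>c. (\<forall>t<N. c t \<in> K) \<longrightarrow> (\<Sum>t<N. c t * v t) = 0 \<longrightarrow> (\<Sum>t<N. c t * w t) = 0"
      by (rule real_part_or_imaginary_part[OF v(1) K])
    obtain c where c: "c > 0" "hdot N (\<lambda>t. complex_of_real c * w t) (\<lambda>t. complex_of_real c * w t) = 1"
      by (rule normalize_vector[OF w(1)])
    let ?w = "\<lambda>t. complex_of_real c * w t"
    have "hdot N ?w (g i) = 0" if "i < q + d" for i
    proof -
      have "(\<Sum>t<N. cnj (g i t) * w t) = 0"
        using g(3) that v(2) by (intro w(3)[rule_format]) (auto intro: cnj_in_K[OF K])
      then have "complex_of_real c * (\<Sum>t<N. cnj (g i t) * w t) = 0" by simp
      then show ?thesis by (simp add: hdot_def sum_distrib_left mult_ac del: mult_eq_0_iff)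
    qed
    then have "orthonormal N (Suc (q + d)) (g(q + d := ?w))"
      using g(1) c(2) by (intro orthonormal_snoc) auto
    moreover have "\<forall>i<q. (g(q + d := ?w)) i = f i" using g(2) by auto
    moreover have "\<forall>i<Suc (q + d). \<forall>t. (g(q + d := ?w)) i t \<in> K"
      using g(3) w(2) by (auto simp: less_Suc_eq scale_in_K[OF K])
    ultimately show ?case by auto
  qed
  from this[of "N - q"] \<open>q \<le> N\<close> show ?thesis using that by auto
qed

text \<open>Orthonormal rows give orthonormal columns, because a one-sided inverse of a square
  matrix is two-sided.\<close>

lemma orthonormal_complete:
  assumes "orthonormal N N f" "s < N" "t < N"
  shows "(\<Sum>i<N. f i s * cnj (f i t)) = (if s = t then 1 else 0)"
proof -
  define F where "F = mat N N (\<lambda>(i, t). f i t)"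
  define G where "G = mat N N (\<lambda>(t, i). cnj (f i t))"
  have "F * G = 1\<^sub>m N"
    using assms(1) by (intro eq_matI)
      (auto simp: F_def G_def scalar_prod_def atLeast0LessThan orthonormal_def hdot_def)
  moreover have "F \<in> carrier_mat N N" "G \<in> carrier_mat N N"
    by (simp_all add: F_def G_def)
  ultimately have "G * F = 1\<^sub>m N"
    by (metis mat_mult_left_right_inverse)
  then have "(G * F) $$ (t, s) = (if s = t then 1 else 0)" using assms by simp
  then show ?thesis
    using assms by (simp add: F_def G_def scalar_prod_def atLeast0LessThan mult.commute)
qed

lemma orthonormal_expand:
  assumes "orthonormal N N f" "t < N"
  shows "u t = (\<Sum>i<N. hdot N u (f i) * f i t)"
proof -
  have "(\<Sum>i<N. hdot N u (f i) * f i t) = (\<Sum>s<N. u s * (\<Sum>i<N. f i t * cnj (f i s)))"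
    by (simp add: hdot_def sum_distrib_left sum_distrib_right mult_ac) (rule sum.swap)
  also have "\<dots> = (\<Sum>s<N. if t = s then u s else 0)"
    using assms by (intro sum.cong) (auto simp: orthonormal_complete)
  finally show ?thesis using assms(2) by simp
qed

text \<open>The characteristic polynomial has a complex root, which is real by Hermitian symmetry.
  Over the reals the eigenvector equation is then a real linear system, so the real or the imaginary
  part of a complex eigenvector solves it.\<close>

lemma hermitian_eigenvector:
  fixes H :: "nat \<Rightarrow> nat \<Rightarrow> complex"
  assumes K: "K = UNIV \<or> K = \<real>" and "N > 0"
    and herm: "\<And>a b. a < N \<Longrightarrow> b < N \<Longrightarrow> H b a = cnj (H a b)"
    and HK: "\<And>a b. a < N \<Longrightarrow> b < N \<Longrightarrow> H a b \<in> K"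
  obtains \<theta> :: real and z where "hdot N z z = 1" "\<forall>t. z t \<in> K"
    "\<forall>a<N. (\<Sum>b<N. H a b * z b) = complex_of_real \<theta> * z a"
proof -
  have herm': "cnj (H a b) = H b a" if "a < N" "b < N" for a b
    using herm[OF that] by simp
  define A where "A = mat N N (\<lambda>(i, t). H i t)"
  have A: "A \<in> carrier_mat N N" by (simp add: A_def)
  obtain as where as: "char_poly A = (\<Prod>a\<leftarrow>as. [:- a, 1:])" "length as = N"
    using char_poly_factorized[OF A] by blast
  with \<open>N > 0\<close> obtain k as' where "as = k # as'" by (cases as) auto
  with as have "poly (char_poly A) k = 0" by simp
  then have "eigenvalue A k" using eigenvalue_root_char_poly[OF A] by simp
  then obtain x where x: "x \<in> carrier_vec N" "x \<noteq> 0\<^sub>v N" "A *\<^sub>v x = k \<cdot>\<^sub>v x"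
    using A by (auto simp: eigenvalue_def eigenvector_def)
  define v where "v = (\<lambda>t. x $ t)"
  have v0: "\<exists>t<N. v t \<noteq> 0"
    using x(1,2) by (auto simp: vec_eq_iff v_def)
  have ev: "(\<Sum>b<N. H a b * v b) = k * v a" if "a < N" for a
  proof -
    have "(A *\<^sub>v x) $ a = (\<Sum>b<N. H a b * v b)"
      using that x(1) by (auto simp: A_def v_def scalar_prod_def atLeast0LessThan intro!: sum.cong)
    then show ?thesis using x that by (simp add: v_def)
  qed
  \<comment> \<open>Evaluating the Hermitian form at \<open>v\<close> through either argument shows
    \<open>k = cnj k\<close>.\<close>
  have "k * hdot N v v = (\<Sum>a<N. (\<Sum>b<N. H a b * v b) * cnj (v a))"
    by (simp add: hdot_def sum_distrib_left mult.assoc ev)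
  also have "\<dots> = (\<Sum>b<N. \<Sum>a<N. H a b * v b * cnj (v a))"
    by (subst sum.swap) (simp add: sum_distrib_right)
  also have "\<dots> = (\<Sum>b<N. v b * cnj (\<Sum>a<N. H b a * v a))"
    by (intro sum.cong) (auto simp: sum_distrib_left herm' intro!: sum.cong)
  also have "\<dots> = cnj k * hdot N v v"
    unfolding hdot_def sum_distrib_left by (intro sum.cong) (auto simp: ev simp del: cnj_sum)
  finally have "k * hdot N v v = cnj k * hdot N v v" .
  moreover have "hdot N v v \<noteq> 0"
  proof -
    obtain c where "c > 0" "hdot N (\<lambda>t. complex_of_real c * v t) (\<lambda>t. complex_of_real c * v t) = 1"
      by (rule normalize_vector[OF v0])
    moreover have "hdot N (\<lambda>t. complex_of_real c * v t) (\<lambda>t. complex_of_real c * v t)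
        = complex_of_real c * complex_of_real c * hdot N v v"
      by (simp add: hdot_def sum_distrib_left mult_ac)
    ultimately show ?thesis by auto
  qed
  ultimately have "k = cnj k" by simp
  then have k: "k = complex_of_real (Re k)" by (simp add: complex_eq_iff)
  obtain w where w: "\<exists>t<N. w t \<noteq> 0" "\<forall>t. w t \<in> K"
    "\<forall>c. (\<forall>t<N. c t \<in> K) \<longrightarrow> (\<Sum>t<N. c t * v t) = 0 \<longrightarrow> (\<Sum>t<N. c t * w t) = 0"
    by (rule real_part_or_imaginary_part[OF v0 K])
  have evw: "(\<Sum>b<N. H a b * w b) = k * w a" if a: "a < N" for a
  proof -
    \<comment> \<open>The eigenvector equation becomes a homogeneous equation with coefficients in
      \<open>K\<close>, which is the shape that passes from \<open>v\<close> to
      \<open>w\<close>.\<close>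
    have e: "(\<Sum>b<N. (H a b - (if b = a then k else 0)) * u b) = (\<Sum>b<N. H a b * u b) - k * u a"
      for u :: "nat \<Rightarrow> complex"
      using a by (simp add: left_diff_distrib sum_subtractf if_distrib[of "\<lambda>x. x * _"] cong: if_cong)
    have "H a b - (if b = a then k else 0) \<in> K" if "b < N" for b
      using HK[OF a that] K by (subst k) (auto intro!: Reals_diff)
    then have "(\<Sum>b<N. (H a b - (if b = a then k else 0)) * w b) = 0"
      using ev[OF a] by (intro w(3)[rule_format]) (auto simp: e)
    then show ?thesis by (simp add: e)
  qed
  obtain c where c: "c > 0" "hdot N (\<lambda>t. complex_of_real c * w t) (\<lambda>t. complex_of_real c * w t) = 1"
    by (rule normalize_vector[OF w(1)])
  show ?thesis
  proof (rule that)
    show "hdot N (\<lambda>t. complex_of_real c * w t) (\<lambda>t. complex_of_real c * w t) = 1" by fact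
    show "\<forall>t. complex_of_real c * w t \<in> K" using w(2) by (auto intro: scale_in_K[OF K])
    show "\<forall>a<N. (\<Sum>b<N. H a b * (complex_of_real c * w b)) = complex_of_real (Re k) * (complex_of_real c * w a)"
    proof (intro allI impI)
      fix a assume that: "a < N"
      have "(\<Sum>b<N. H a b * (complex_of_real c * w b)) = complex_of_real c * (\<Sum>b<N. H a b * w b)"
        by (simp add: sum_distrib_left mult_ac)
      then show "(\<Sum>b<N. H a b * (complex_of_real c * w b)) = complex_of_real (Re k) * (complex_of_real c * w a)"
        using evw[OF that] k by simp
    qed
  qed
qed

text \<open>The scalars \<open>K\<close> are either all complex numbers or the reals, so that the Hermitian and the real
  symmetric spectral theorem are the same induction: compress to the orthogonal complement of the
  eigenvectors found so far.\<close>

lemma hermitian_spectral: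
  fixes H :: "nat \<Rightarrow> nat \<Rightarrow> complex"
  assumes K: "K = UNIV \<or> K = \<real>"
    and herm: "\<And>a b. a < N \<Longrightarrow> b < N \<Longrightarrow> H b a = cnj (H a b)"
    and HK: "\<And>a b. a < N \<Longrightarrow> b < N \<Longrightarrow> H a b \<in> K"
  obtains z and \<theta> :: "nat \<Rightarrow> real" where "orthonormal N N z" "\<forall>i<N. \<forall>t. z i t \<in> K"
    "\<forall>i<N. \<forall>a<N. (\<Sum>b<N. H a b * z i b) = complex_of_real (\<theta> i) * z i a"
proof -
  have herm': "cnj (H a b) = H b a" if "a < N" "b < N" for a b
    using herm[OF that] by simp
  define L where "L v a = (\<Sum>b<N. H a b * v b)" for v a
  have sa: "hdot N (L u) v = hdot N u (L v)" for u v
  proof -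
    have "hdot N (L u) v = (\<Sum>a<N. \<Sum>b<N. H a b * u b * cnj (v a))"
      by (simp add: hdot_def L_def sum_distrib_right)
    also have "\<dots> = (\<Sum>b<N. \<Sum>a<N. H a b * u b * cnj (v a))"
      by (rule sum.swap)
    also have "\<dots> = hdot N u (L v)"
      unfolding hdot_def L_def by (intro sum.cong) (auto simp: sum_distrib_left herm' intro!: sum.cong)
    finally show ?thesis .
  qed
  have "\<exists>z \<theta>. orthonormal N q z \<and> (\<forall>i<q. \<forall>t. z i t \<in> K) \<and>
      (\<forall>i<q. \<forall>a<N. L (z i) a = complex_of_real (\<theta> i) * z i a)" if "q \<le> N" for q
    using that
  proof (induction q)
    case 0
    then show ?case by (auto simp: orthonormal_def)
  next
    case (Suc q)
    then obtain z and \<theta> :: "nat \<Rightarrow> real" where z: "orthonormal N q z" "\<forall>i<q. \<forall>t. z i t \<in> K"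
      "\<forall>i<q. \<forall>a<N. L (z i) a = complex_of_real (\<theta> i) * z i a" by auto
    obtain g where g: "orthonormal N N g" "\<forall>i<q. g i = z i" "\<forall>i<N. \<forall>t. g i t \<in> K"
      using z(2) Suc.prems by - (rule orthonormal_extend[OF K z(1)], auto)
    define C where "C a b = hdot N (L (g (q + b))) (g (q + a))" for a b
    have Ch: "C b a = cnj (C a b)" for a b
      unfolding C_def by (subst sa, subst hdot_commute) simp
    have CK: "C a b \<in> K" if "a < N - q" "b < N - q" for a b
      unfolding C_def hdot_def L_def using that
      by (intro sum_in_K[OF K] mult_in_K[OF K] HK cnj_in_K[OF K] g(3)[rule_format]) auto
    have pos: "N - q > 0" using Suc.prems by simp
    obtain \<mu> :: real and w where w: "hdot (N - q) w w = 1" "\<forall>t. w t \<in> K"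
      "\<forall>a<N - q. (\<Sum>b<N - q. C a b * w b) = complex_of_real \<mu> * w a"
      by (rule hermitian_eigenvector[OF K pos, of C, OF Ch CK])
    define v where "v t = (\<Sum>b<N - q. w b * g (q + b) t)" for t
    have vdot: "hdot N v u = (\<Sum>b<N - q. w b * hdot N (g (q + b)) u)" for u
      by (simp only: v_def[abs_def] hdot_sum_left)
    have vK: "v t \<in> K" for t
      unfolding v_def by (intro sum_in_K[OF K] mult_in_K[OF K] w(2)[rule_format] g(3)[rule_format]) auto
    have vg: "hdot N v (g (q + a)) = w a" if "a < N - q" for a
    proof -
      have "hdot N v (g (q + a)) = (\<Sum>b<N - q. if b = a then w b else 0)"
        unfolding vdot using that
        by (intro sum.cong) (auto simp: orthonormalD[OF g(1)])
      then show ?thesis using that by simp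
    qed
    have vz: "hdot N v (g i) = 0" if "i < q" for i
      unfolding vdot using that Suc.prems
      by (intro sum.neutral) (auto simp: orthonormalD[OF g(1)])
    have "hdot N v v = (\<Sum>a<N - q. w a * cnj (hdot N v (g (q + a))))"
      by (subst vdot) (simp add: hdot_commute[of N "g _" v])
    also have "\<dots> = hdot (N - q) w w" by (simp add: vg hdot_def[of "N - q"])
    also have "\<dots> = 1" by (rule w(1))
    finally have vv: "hdot N v v = 1" .
    have Lv: "L v a = complex_of_real \<mu> * v a" if a: "a < N" for a
    proof -
      \<comment> \<open>The residual of the eigenvalue equation is orthogonal to every basis vector:
        for \<open>i < q\<close> because \<open>z i\<close> is an eigenvector orthogonal to
        \<open>v\<close>, for the others because \<open>w\<close> is an eigenvector of the
        compression.\<close>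
      let ?d = "\<lambda>a. L v a - complex_of_real \<mu> * v a"
      have dsplit: "hdot N ?d u = hdot N (L v) u - complex_of_real \<mu> * hdot N v u" for u
        by (simp add: hdot_def left_diff_distrib sum_subtractf sum_distrib_left mult.assoc)
      have "hdot N ?d (g i) = 0" if i: "i < N" for i
      proof (cases "i < q")
        case True
        have "hdot N (L v) (g i) = hdot N v (\<lambda>t. complex_of_real (\<theta> i) * z i t)"
          unfolding sa using z(3) True g(2)[rule_format, OF True] by (auto intro!: hdot_cong)
        also have "\<dots> = complex_of_real (\<theta> i) * hdot N v (g i)"
          using g(2)[rule_format, OF True] by (simp add: hdot_def sum_distrib_left mult_ac)
        finally show ?thesis unfolding dsplit by (simp add: vz[OF True])
      next
        case False
        then obtain a where ia: "i = q + a" "a < N - q"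
          using i by (metis add_diff_inverse_nat diff_less_mono linorder_not_less)
        have "L v t = (\<Sum>b<N - q. w b * L (g (q + b)) t)" for t
        proof -
          have "L v t = (\<Sum>c<N. \<Sum>b<N - q. w b * (H t c * g (q + b) c))"
            by (simp add: L_def v_def sum_distrib_left mult.left_commute)
          also have "\<dots> = (\<Sum>b<N - q. \<Sum>c<N. w b * (H t c * g (q + b) c))"
            by (rule sum.swap)
          finally show ?thesis by (simp add: L_def sum_distrib_left)
        qed
        then have "L v = (\<lambda>t. \<Sum>b<N - q. w b * L (g (q + b)) t)" ..
        then have "hdot N (L v) (g i) = (\<Sum>b<N - q. C a b * w b)"
          by (simp only: hdot_sum_left) (simp add: C_def ia(1) mult.commute)
        then show ?thesis unfolding dsplit using w(3) ia by (simp add: vg)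
      qed
      then have "?d a = 0"
        using orthonormal_expand[OF g(1) a, of ?d] by simp
      then show ?thesis by simp
    qed
    have "orthonormal N (Suc q) (z(q := v))"
      using vz g(2) by (intro orthonormal_snoc z vv) auto
    moreover have "\<forall>i<Suc q. \<forall>t. (z(q := v)) i t \<in> K" using z(2) vK by (auto simp: less_Suc_eq)
    moreover have "\<forall>i<Suc q. \<forall>a<N. L ((z(q := v)) i) a = complex_of_real ((\<theta>(q := \<mu>)) i) * (z(q := v)) i a"
      using z(3) Lv by (auto simp: less_Suc_eq)
    ultimately show ?case by blast
  qed
  from this[of N] show ?thesis using that unfolding L_def by auto
qed

subsection \<open>Two inequalities for weighted graphs\<close>

text \<open>Cauchy-Schwarz, from \<open>2 a b <= a^2 + b^2\<close> with \<open>a = f i * g j\<close>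
  and \<open>b = f j * g i\<close>, summed over all pairs.\<close>

lemma square_sum_mult_le:
  fixes f g :: "'i \<Rightarrow> real"
  shows "(\<Sum>i\<in>I. f i * g i)\<^sup>2 \<le> (\<Sum>i\<in>I. (f i)\<^sup>2) * (\<Sum>i\<in>I. (g i)\<^sup>2)"
proof -
  have "2 * (\<Sum>i\<in>I. f i * g i)\<^sup>2 = (\<Sum>i\<in>I. \<Sum>j\<in>I. 2 * ((f i * g j) * (f j * g i)))"
    by (simp add: power2_eq_square sum_product sum_distrib_left mult_ac)
  also have "\<dots> \<le> (\<Sum>i\<in>I. \<Sum>j\<in>I. (f i)\<^sup>2 * (g j)\<^sup>2 + (f j)\<^sup>2 * (g i)\<^sup>2)"
  proof (intro sum_mono)
    fix i j
    show "2 * ((f i * g j) * (f j * g i)) \<le> (f i)\<^sup>2 * (g j)\<^sup>2 + (f j)\<^sup>2 * (g i)\<^sup>2"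
      using sum_squares_bound[of "f i * g j" "f j * g i"] by (simp add: power_mult_distrib)
  qed
  also have "\<dots> = 2 * ((\<Sum>i\<in>I. (f i)\<^sup>2) * (\<Sum>i\<in>I. (g i)\<^sup>2))"
    by (simp add: sum.distrib sum_product mult_ac) (rule sum.swap)
  finally show ?thesis by simp
qed

text \<open>With unit weights, the left-hand side is the quadratic form of the signless Laplacian of a graph,
  whose largest eigenvalue is at most the number of edges plus one.\<close>

lemma weighted_edge_bound:
  fixes w :: "'i \<Rightarrow> 'i \<Rightarrow> real" and a :: "'i \<Rightarrow> real"
  assumes fin: "finite I" and sym: "\<And>i j. w i j = w j i" and loop: "\<And>i. w i i = 0"
    and w0: "\<And>i j. 0 \<le> w i j" and w1: "\<And>i j. w i j \<le> 1/2"
  shows "(\<Sum>i\<in>I. \<Sum>j\<in>I. w i j * (a i + a j)\<^sup>2) \<le> ((\<Sum>i\<in>I. \<Sum>j\<in>I. w i j) + 1) * (\<Sum>i\<in>I. (a i)\<^sup>2)"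
proof -
  define T where "T = (\<Sum>i\<in>I. \<Sum>j\<in>I. w i j * (a i + a j)\<^sup>2)"
  define d where "d i = (\<Sum>j\<in>I. w i j)" for i
  define p where "p = (\<Sum>i\<in>I. d i)"
  \<comment> \<open>\<open>y\<close> is the image of \<open>a\<close> under the signless Laplacian.
    \<open>T\<close> is twice the inner product of \<open>a\<close> and \<open>y\<close>, so the
    claim follows by Cauchy-Schwarz once \<open>4 * |y|^2 <= (p + 1) * T\<close> is known.\<close>
  define y where "y i = (\<Sum>j\<in>I. w i j * (a i + a j))" for i
  have T0: "T \<ge> 0"
    unfolding T_def by (intro sum_nonneg mult_nonneg_nonneg w0) auto
  have d0: "d i \<ge> 0" for i unfolding d_def by (intro sum_nonneg w0)
  have p0: "p \<ge> 0" unfolding p_def by (intro sum_nonneg d0)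
  have "T = (\<Sum>i\<in>I. \<Sum>j\<in>I. a i * (w i j * (a i + a j))) + (\<Sum>i\<in>I. \<Sum>j\<in>I. a j * (w i j * (a i + a j)))"
    unfolding T_def sum.distrib[symmetric] by (intro sum.cong refl) (simp add: power2_eq_square algebra_simps)
  also have "(\<Sum>i\<in>I. \<Sum>j\<in>I. a j * (w i j * (a i + a j))) = (\<Sum>j\<in>I. \<Sum>i\<in>I. a j * (w i j * (a i + a j)))"
    by (rule sum.swap)
  also have "\<dots> = (\<Sum>i\<in>I. \<Sum>j\<in>I. a i * (w i j * (a i + a j)))"
    by (intro sum.cong refl) (metis sym add.commute)
  finally have T: "T = 2 * (\<Sum>i\<in>I. a i * y i)"
    by (simp add: y_def sum_distrib_left)
  \<comment> \<open>Every pair is counted in \<open>p\<close> in both orders, so an edge of full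
    weight has \<open>w = 1/2\<close> in each. An edge other than the one joining \<open>i\<close>
    and \<open>j\<close> is counted at most once in \<open>d i + d j\<close>, whence
    \<open>d i + d j <= p / 2 + w i j\<close>.\<close>
  have deg: "d i + d j \<le> (p + 1) / 2" if ij: "i \<in> I" "j \<in> I" "i \<noteq> j" for i j
  proof -
    have split: "sum f I = f i + f j + sum f (I - {i, j})" for f :: "'i \<Rightarrow> real"
      using fin ij by (simp add: sum.remove[of I i] sum.remove[of "I - {i}" j] Diff_insert2[symmetric] insert_commute)
    have "p = d i + d j + (\<Sum>k\<in>I - {i, j}. d k)"
      unfolding p_def by (rule split)
    also have "(\<Sum>k\<in>I - {i, j}. d k) \<ge> (\<Sum>k\<in>I - {i, j}. w i k + w j k)"
    proof (intro sum_mono)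
      fix k
      have "d k = w k i + w k j + (\<Sum>l\<in>I - {i, j}. w k l)" unfolding d_def by (rule split)
      moreover have "(\<Sum>l\<in>I - {i, j}. w k l) \<ge> 0" by (intro sum_nonneg w0)
      ultimately show "w i k + w j k \<le> d k" using sym[of k i] sym[of k j] by simp
    qed
    moreover have "(\<Sum>k\<in>I - {i, j}. w i k + w j k) = d i + d j - 2 * w i j"
    proof -
      have "d i = w i i + w i j + (\<Sum>k\<in>I - {i, j}. w i k)" "d j = w j i + w j j + (\<Sum>k\<in>I - {i, j}. w j k)"
        unfolding d_def by (rule split)+
      then show ?thesis using sym[of i j] by (simp add: sum.distrib loop)
    qed
    ultimately show ?thesis using w1[of i j] by argo
  qed
  \<comment> \<open>Cauchy-Schwarz at each vertex with weights \<open>w i j\<close>; the sum is then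
    symmetrised so that \<open>d i + d j\<close> appears on every edge.\<close>
  have "(\<Sum>i\<in>I. (y i)\<^sup>2) \<le> (\<Sum>i\<in>I. \<Sum>j\<in>I. d i * (w i j * (a i + a j)\<^sup>2))"
  proof (intro sum_mono)
    fix i
    have "(y i)\<^sup>2 = (\<Sum>j\<in>I. sqrt (w i j) * (sqrt (w i j) * (a i + a j)))\<^sup>2"
      unfolding y_def using w0 by (simp add: mult.assoc[symmetric])
    also have "\<dots> \<le> (\<Sum>j\<in>I. (sqrt (w i j))\<^sup>2) * (\<Sum>j\<in>I. (sqrt (w i j) * (a i + a j))\<^sup>2)"
      by (rule square_sum_mult_le)
    also have "\<dots> = (\<Sum>j\<in>I. d i * (w i j * (a i + a j)\<^sup>2))"
      using w0 by (simp add: power_mult_distrib d_def sum_distrib_left)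
    finally show "(y i)\<^sup>2 \<le> (\<Sum>j\<in>I. d i * (w i j * (a i + a j)\<^sup>2))" .
  qed
  moreover have "(\<Sum>i\<in>I. \<Sum>j\<in>I. d i * (w i j * (a i + a j)\<^sup>2)) = (\<Sum>i\<in>I. \<Sum>j\<in>I. d j * (w i j * (a i + a j)\<^sup>2))"
    by (subst sum.swap) (intro sum.cong refl, metis sym add.commute)
  ultimately have "2 * (\<Sum>i\<in>I. (y i)\<^sup>2) \<le> (\<Sum>i\<in>I. \<Sum>j\<in>I. (d i + d j) * (w i j * (a i + a j)\<^sup>2))"
    by (simp add: distrib_right sum.distrib)
  also have "\<dots> \<le> (\<Sum>i\<in>I. \<Sum>j\<in>I. (p + 1) / 2 * (w i j * (a i + a j)\<^sup>2))"
  proof (intro sum_mono)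
    fix i j assume ij: "i \<in> I" "j \<in> I"
    show "(d i + d j) * (w i j * (a i + a j)\<^sup>2) \<le> (p + 1) / 2 * (w i j * (a i + a j)\<^sup>2)"
    proof (cases "i = j")
      case False
      then show ?thesis
        using w0 by (intro mult_right_mono deg ij mult_nonneg_nonneg) auto
    qed (simp add: loop)
  qed
  also have "\<dots> = (p + 1) / 2 * T"
    by (simp add: T_def sum_distrib_left)
  finally have y: "4 * (\<Sum>i\<in>I. (y i)\<^sup>2) \<le> (p + 1) * T" by simp
  have "T\<^sup>2 = 4 * (\<Sum>i\<in>I. a i * y i)\<^sup>2" by (simp add: T power_mult_distrib)
  also have "\<dots> \<le> 4 * ((\<Sum>i\<in>I. (a i)\<^sup>2) * (\<Sum>i\<in>I. (y i)\<^sup>2))"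
    using square_sum_mult_le[of a y I] by simp
  also have "\<dots> = (\<Sum>i\<in>I. (a i)\<^sup>2) * (4 * (\<Sum>i\<in>I. (y i)\<^sup>2))" by simp
  also have "\<dots> \<le> (\<Sum>i\<in>I. (a i)\<^sup>2) * ((p + 1) * T)"
    by (intro mult_left_mono y sum_nonneg) auto
  finally have "T * T \<le> ((p + 1) * (\<Sum>i\<in>I. (a i)\<^sup>2)) * T"
    by (simp add: power2_eq_square mult_ac)
  then have "T \<le> (p + 1) * (\<Sum>i\<in>I. (a i)\<^sup>2)"
    using T0 p0 by (cases "T = 0") (auto intro!: mult_nonneg_nonneg sum_nonneg)
  then show ?thesis by (simp add: T_def p_def d_def)
qed

text \<open>In the application \<open>x i\<close> is the squared norm of a matrix and
  \<open>c i j\<close> a squared commutator norm divided by \<open>x i * x j\<close>;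
  \<open>c1\<close> and \<open>row\<close> are the pairwise and the collective estimate.\<close>

context
  fixes S :: "'i set" and x :: "'i \<Rightarrow> real" and c :: "'i \<Rightarrow> 'i \<Rightarrow> real"
  assumes fin: "finite S" and x: "\<And>i. i \<in> S \<Longrightarrow> x i > 0"
    and sym: "\<And>i j. c i j = c j i"
    and diag: "\<And>i. i \<in> S \<Longrightarrow> c i i = 0"
    and c1: "\<And>i j. i \<in> S \<Longrightarrow> j \<in> S \<Longrightarrow> c i j \<le> 1"
    and row: "\<And>i T. i \<in> S \<Longrightarrow> T \<subseteq> S \<Longrightarrow> (\<Sum>j\<in>T. c i j) \<le> card T / 2 + 1"
begin

text \<open>The error term of the first bound is kept exactly, because the equality case reads off
  \<open>c i j = 1\<close> from its vanishing.\<close>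

lemma quadratic_form_deficit:
  "(\<Sum>i\<in>S. \<Sum>j\<in>S. c i j * (x i * x j)) =
    (\<Sum>i\<in>S. x i)\<^sup>2 - (\<Sum>i\<in>S. (x i)\<^sup>2) - (\<Sum>i\<in>S. \<Sum>j\<in>S. if i = j then 0 else (1 - c i j) * (x i * x j))"
proof -
  have "(\<Sum>i\<in>S. (x i)\<^sup>2) = (\<Sum>i\<in>S. \<Sum>j\<in>S. if i = j then x i * x j else 0)"
    using fin by (simp add: power2_eq_square)
  then have "(\<Sum>i\<in>S. x i)\<^sup>2 - (\<Sum>i\<in>S. (x i)\<^sup>2) - (\<Sum>i\<in>S. \<Sum>j\<in>S. if i = j then 0 else (1 - c i j) * (x i * x j))
    = (\<Sum>i\<in>S. \<Sum>j\<in>S. x i * x j - (if i = j then x i * x j else 0) - (if i = j then 0 else (1 - c i j) * (x i * x j)))"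
    by (simp add: power2_eq_square sum_product sum_subtractf)
  also have "\<dots> = (\<Sum>i\<in>S. \<Sum>j\<in>S. c i j * (x i * x j))"
    by (intro sum.cong refl) (auto simp: diag algebra_simps)
  finally show ?thesis by simp
qed

text \<open>Off the diagonal \<open>c <= 1/2 + d\<close>, with \<open>d\<close> the excess over 1/2.
  Applied to those \<open>j\<close> where the excess is positive, \<open>row\<close> bounds each row
  sum of \<open>d\<close> by 1, and \<open>2 * x i * x j <= (x i)^2 + (x j)^2\<close> then bounds
  the quadratic form of \<open>d\<close> by the sum of squares.\<close>

lemma quadratic_form_upper:
  "(\<Sum>i\<in>S. \<Sum>j\<in>S. c i j * (x i * x j)) \<le> ((\<Sum>i\<in>S. x i)\<^sup>2 + (\<Sum>i\<in>S. (x i)\<^sup>2)) / 2"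
proof -
  define d where "d i j = max 0 (c i j - 1/2)" for i j
  have d0: "d i j \<ge> 0" for i j by (simp add: d_def)
  have half: "(\<Sum>i\<in>S. \<Sum>j\<in>S. d i j * (x i)\<^sup>2) \<le> (\<Sum>i\<in>S. (x i)\<^sup>2)"
  proof (intro sum_mono)
    fix i assume i: "i \<in> S"
    let ?T = "{j\<in>S. c i j > 1/2}"
    have "(\<Sum>j\<in>S. d i j) = (\<Sum>j\<in>?T. d i j)"
      using fin by (intro sum.mono_neutral_right) (auto simp: d_def)
    also have "\<dots> = (\<Sum>j\<in>?T. c i j - 1/2)"
      by (intro sum.cong) (auto simp: d_def)
    also have "\<dots> \<le> 1" using row[OF i, of ?T] by (simp add: sum_subtractf)
    finally have "(\<Sum>j\<in>S. d i j) * (x i)\<^sup>2 \<le> 1 * (x i)\<^sup>2"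
      by (intro mult_right_mono) auto
    then show "(\<Sum>j\<in>S. d i j * (x i)\<^sup>2) \<le> (x i)\<^sup>2" by (simp add: sum_distrib_right)
  qed
  have "(\<Sum>i\<in>S. \<Sum>j\<in>S. d i j * (x j)\<^sup>2) = (\<Sum>j\<in>S. \<Sum>i\<in>S. d i j * (x j)\<^sup>2)"
    by (rule sum.swap)
  also have "\<dots> = (\<Sum>i\<in>S. \<Sum>j\<in>S. d i j * (x i)\<^sup>2)"
    by (intro sum.cong refl) (simp add: d_def sym)
  finally have "(\<Sum>i\<in>S. \<Sum>j\<in>S. d i j * ((x i)\<^sup>2 + (x j)\<^sup>2)) \<le> 2 * (\<Sum>i\<in>S. (x i)\<^sup>2)"
    using half by (simp add: distrib_left sum.distrib)
  moreover have "(\<Sum>i\<in>S. \<Sum>j\<in>S. d i j * (2 * (x i * x j))) \<le> (\<Sum>i\<in>S. \<Sum>j\<in>S. d i j * ((x i)\<^sup>2 + (x j)\<^sup>2))"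
    using sum_squares_bound by (intro sum_mono mult_left_mono d0) (simp add: mult.assoc)
  ultimately have d: "(\<Sum>i\<in>S. \<Sum>j\<in>S. d i j * (x i * x j)) \<le> (\<Sum>i\<in>S. (x i)\<^sup>2)"
    by (simp add: mult.left_commute[of _ 2] sum_distrib_left[symmetric])
  have "(\<Sum>i\<in>S. \<Sum>j\<in>S. c i j * (x i * x j))
    \<le> (\<Sum>i\<in>S. \<Sum>j\<in>S. (x i * x j) / 2 - (if i = j then x i * x j else 0) / 2 + d i j * (x i * x j))"
  proof (intro sum_mono)
    fix i j assume ij: "i \<in> S" "j \<in> S"
    then have "c i j \<le> 1/2 - (if i = j then 1/2 else 0) + d i j"
      by (auto simp: d_def diag)
    then have "c i j * (x i * x j) \<le> (1/2 - (if i = j then 1/2 else 0) + d i j) * (x i * x j)"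
      using x ij by (intro mult_right_mono) (auto intro: less_imp_le)
    then show "c i j * (x i * x j) \<le> (x i * x j) / 2 - (if i = j then x i * x j else 0) / 2 + d i j * (x i * x j)"
      by (auto simp: algebra_simps)
  qed
  also have "\<dots> = (\<Sum>i\<in>S. x i)\<^sup>2 / 2 - (\<Sum>i\<in>S. (x i)\<^sup>2) / 2 + (\<Sum>i\<in>S. \<Sum>j\<in>S. d i j * (x i * x j))"
    using fin by (simp add: sum.distrib sum_subtractf sum_divide_distrib[symmetric] power2_eq_square sum_product)
  finally show ?thesis using d by argo
qed

text \<open>The first bound decreases and the second increases in \<open>q = \<Sum>i\<in>S. (x i)\<^sup>2\<close>; they meet at
  \<open>q = (\<Sum>i\<in>S. x i)\<^sup>2 / 3\<close>.\<close>

lemma quadratic_form_bound: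
  "(\<Sum>i\<in>S. \<Sum>j\<in>S. c i j * (x i * x j)) \<le> 2/3 * (\<Sum>i\<in>S. x i)\<^sup>2"
proof -
  have "(\<Sum>i\<in>S. \<Sum>j\<in>S. if i = j then 0 else (1 - c i j) * (x i * x j)) \<ge> 0"
    using c1 x by (intro sum_nonneg) (auto intro!: mult_nonneg_nonneg less_imp_le[OF x])
  then show ?thesis using quadratic_form_deficit quadratic_form_upper by argo
qed

text \<open>Both bounds must be attained, so the ratios off the diagonal are 1 and the sum of
  squares is a third of the squared sum. The row bound \<open>|S| - 1 <= (|S| - 1) / 2 + 1\<close>
  gives \<open>|S| <= 3\<close>, Cauchy-Schwarz gives \<open>|S| >= 3\<close>, and the variance of
  \<open>x\<close> is then 0.\<close>

lemma quadratic_form_equality: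
  assumes eq: "(\<Sum>i\<in>S. \<Sum>j\<in>S. c i j * (x i * x j)) = 2/3 * (\<Sum>i\<in>S. x i)\<^sup>2" and ne: "S \<noteq> {}"
  shows "card S = 3" "\<And>i. i \<in> S \<Longrightarrow> x i = (\<Sum>i\<in>S. x i) / 3"
    "\<And>i j. i \<in> S \<Longrightarrow> j \<in> S \<Longrightarrow> i \<noteq> j \<Longrightarrow> c i j = 1"
proof -
  let ?X = "\<Sum>i\<in>S. x i" and ?q = "\<Sum>i\<in>S. (x i)\<^sup>2"
  let ?e = "\<lambda>i j. if i = j then 0 else (1 - c i j) * (x i * x j)"
  have e0: "?e i j \<ge> 0" if "i \<in> S" "j \<in> S" for i j
    using c1 x that by (auto intro!: mult_nonneg_nonneg less_imp_le[OF x])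
  then have "(\<Sum>i\<in>S. \<Sum>j\<in>S. ?e i j) \<ge> 0" by (intro sum_nonneg) auto
  then have sum0: "(\<Sum>i\<in>S. \<Sum>j\<in>S. ?e i j) = 0" and q: "?q = ?X\<^sup>2 / 3"
    using quadratic_form_deficit quadratic_form_upper eq by argo+
  have "?e i j = 0" if "i \<in> S" "j \<in> S" for i j
  proof -
    have "(\<Sum>j\<in>S. ?e i j) = 0"
      using sum0 sum_nonneg_eq_0_iff[OF fin, of "\<lambda>i. \<Sum>j\<in>S. ?e i j"] e0 that
      by (simp add: sum_nonneg)
    then show ?thesis
      using sum_nonneg_eq_0_iff[OF fin, of "?e i"] e0 that by blast
  qed
  then show c: "c i j = 1" if "i \<in> S" "j \<in> S" "i \<noteq> j" for i j
    using that x[of i] x[of j] by fastforce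
  obtain i where i: "i \<in> S" using ne by auto
  have "(\<Sum>j\<in>S - {i}. c i j) = (\<Sum>j\<in>S - {i}. 1)"
    using c i by (intro sum.cong) auto
  then have "card (S - {i}) \<le> 2"
    using row[OF i, of "S - {i}"] by simp
  then have card: "card S \<le> 3" using fin i by simp
  have "?X\<^sup>2 \<le> card S * ?q"
    using square_sum_mult_le[of "\<lambda>_. 1" x S] by simp
  moreover have "?X > 0" using fin ne x by (intro sum_pos) auto
  then have X2: "?X\<^sup>2 > 0" by simp
  ultimately have "3 \<le> real (card S)" unfolding q by (simp add: field_simps)
  then show card3: "card S = 3" using card by simp
  have "(\<Sum>i\<in>S. (x i - ?X / 3)\<^sup>2) = ?q - 2 * (?X / 3) * ?X + card S * (?X / 3)\<^sup>2"
    by (simp add: power2_diff sum.distrib sum_subtractf sum_distrib_left[symmetric] sum_distrib_right[symmetric] sum_divide_distrib[symmetric])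
  also have "\<dots> = 0" unfolding q card3 by (simp add: power2_eq_square)
  finally show "x i = ?X / 3" if "i \<in> S" for i
    using sum_nonneg_eq_0_iff[OF fin, of "\<lambda>i. (x i - ?X / 3)\<^sup>2"] that by simp
qed

end

subsection \<open>The Frobenius inner product\<close>

definition fip :: "complex mat \<Rightarrow> complex mat \<Rightarrow> complex" where
  "fip X Y = mat_trace (X * mat_adjoint Y)"

lemma mat_cnj_carrier [simp]: "A \<in> carrier_mat n m \<Longrightarrow> mat_cnj A \<in> carrier_mat n m"
  by (simp add: mat_cnj_def)

lemma mat_adjoint_carrier [simp]:
  fixes A :: "complex mat"
  shows "A \<in> carrier_mat n m \<Longrightarrow> mat_adjoint A \<in> carrier_mat m n"
  by (simp add: mat_adjoint_eq)

lemma mat_adjoint_dim [simp]: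
  fixes A :: "complex mat"
  shows "dim_row (mat_adjoint A) = dim_col A" "dim_col (mat_adjoint A) = dim_row A"
  by (simp_all add: mat_adjoint_eq mat_cnj_def)

lemma mat_cnj_dim [simp]: "dim_row (mat_cnj A) = dim_row A" "dim_col (mat_cnj A) = dim_col A"
  by (simp_all add: mat_cnj_def)

lemma square_mult_carrier [simp]:
  "A \<in> carrier_mat n n \<Longrightarrow> B \<in> carrier_mat n n \<Longrightarrow> A * B \<in> carrier_mat n n"
  by (rule mult_carrier_mat)

lemma square_mult_one [simp]:
  fixes A :: "'a :: semiring_1 mat"
  assumes "A \<in> carrier_mat n n"
  shows "A * 1\<^sub>m n = A" "1\<^sub>m n * A = A"
  by (rule right_mult_one_mat[OF assms] left_mult_one_mat[OF assms])+

lemmas square_mult_assoc = assoc_mult_mat[of _ n n _ n _ n for n]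

lemma commutator_carrier [simp]:
  "A \<in> carrier_mat n n \<Longrightarrow> B \<in> carrier_mat n n \<Longrightarrow> commutator A B \<in> carrier_mat n n"
  by (simp add: commutator_def minus_carrier_mat)

lemma mat_mult_entry:
  fixes A :: "'a :: semiring_0 mat"
  shows "A \<in> carrier_mat n m \<Longrightarrow> B \<in> carrier_mat m k \<Longrightarrow> i < n \<Longrightarrow> j < k \<Longrightarrow>
    (A * B) $$ (i, j) = (\<Sum>t<m. A $$ (i, t) * B $$ (t, j))"
  by (auto simp: scalar_prod_def atLeast0LessThan intro!: sum.cong)

lemma mat_cnj_entry [simp]: "i < dim_row A \<Longrightarrow> j < dim_col A \<Longrightarrow> mat_cnj A $$ (i, j) = cnj (A $$ (i, j))"
  by (simp add: mat_cnj_def)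

lemma mat_adjoint_entry:
  fixes A :: "complex mat"
  shows "i < dim_col A \<Longrightarrow> j < dim_row A \<Longrightarrow> mat_adjoint A $$ (i, j) = cnj (A $$ (j, i))"
  by (simp add: mat_adjoint_eq mat_cnj_def)

lemma fip_entries:
  assumes "X \<in> carrier_mat n m" "Y \<in> carrier_mat n m"
  shows "fip X Y = (\<Sum>i<n. \<Sum>j<m. X $$ (i, j) * cnj (Y $$ (i, j)))"
  using assms by (auto simp: fip_def mat_trace_def mat_adjoint_eq mat_cnj_def scalar_prod_def
      atLeast0LessThan intro!: sum.cong)

lemma frob_sq_entries: "A \<in> carrier_mat n m \<Longrightarrow> frob_sq A = (\<Sum>i<n. \<Sum>j<m. (cmod (A $$ (i, j)))\<^sup>2)"
  unfolding frob_sq_def mat_trace_times_adjoint by auto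

lemma fip_self: "fip A A = complex_of_real (frob_sq A)"
  unfolding fip_def frob_sq_def mat_trace_times_adjoint by simp

lemma frob_sq_nonneg: "frob_sq A \<ge> 0"
  unfolding frob_sq_def mat_trace_times_adjoint by (simp add: sum_nonneg)

lemma frob_sq_eq_0_iff:
  assumes "A \<in> carrier_mat n m"
  shows "frob_sq A = 0 \<longleftrightarrow> A = 0\<^sub>m n m"
proof
  assume "frob_sq A = 0"
  then have "A $$ (i, j) = 0" if "i < n" "j < m" for i j
    using that assms
    by (simp add: frob_sq_entries sum_nonneg_eq_0_iff sum_nonneg)
  then show "A = 0\<^sub>m n m" using assms by (intro eq_matI) auto
next
  assume "A = 0\<^sub>m n m"
  then show "frob_sq A = 0" by (simp add: frob_sq_entries[of _ n m])
qed

lemma mat_trace_mult_commute: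
  fixes A :: "complex mat"
  assumes "A \<in> carrier_mat n m" "B \<in> carrier_mat m n"
  shows "mat_trace (A * B) = mat_trace (B * A)"
proof -
  have "mat_trace (A * B) = (\<Sum>i<n. \<Sum>t<m. A $$ (i, t) * B $$ (t, i))"
    using assms by (simp add: mat_trace_def mat_mult_entry[OF assms] del: index_mult_mat(1))
  also have "\<dots> = (\<Sum>t<m. \<Sum>i<n. B $$ (t, i) * A $$ (i, t))"
    by (subst sum.swap) (simp add: mult.commute)
  also have "\<dots> = mat_trace (B * A)"
    using assms by (simp add: mat_trace_def mat_mult_entry[OF assms(2,1)] del: index_mult_mat(1))
  finally show ?thesis .
qed

lemma mat_adjoint_mult:
  fixes A :: "complex mat"
  assumes "A \<in> carrier_mat n m" "B \<in> carrier_mat m k"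
  shows "mat_adjoint (A * B) = mat_adjoint B * mat_adjoint A"
proof (intro eq_matI)
  have d: "dim_row A = n" "dim_col A = m" "dim_row B = m" "dim_col B = k" using assms by auto
  fix i j assume "i < dim_row (mat_adjoint B * mat_adjoint A)" "j < dim_col (mat_adjoint B * mat_adjoint A)"
  then have ij: "i < k" "j < n" by (simp_all add: d)
  have "mat_adjoint (A * B) $$ (i, j) = cnj ((A * B) $$ (j, i))"
    using ij d by (simp add: mat_adjoint_entry del: index_mult_mat(1))
  also have "\<dots> = (\<Sum>t<m. mat_adjoint B $$ (i, t) * mat_adjoint A $$ (t, j))"
    using ij d by (simp add: mat_mult_entry[OF assms] mat_adjoint_entry mult.commute del: index_mult_mat(1))
  also have "\<dots> = (mat_adjoint B * mat_adjoint A) $$ (i, j)"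
    using ij assms by (simp add: mat_mult_entry[of _ k m _ n] del: index_mult_mat(1))
  finally show "mat_adjoint (A * B) $$ (i, j) = (mat_adjoint B * mat_adjoint A) $$ (i, j)" .
qed (use assms in auto)

lemma mat_adjoint_adjoint [simp]: "mat_adjoint (mat_adjoint A) = (A :: complex mat)"
  by (intro eq_matI) (auto simp: mat_adjoint_eq mat_cnj_def)

text \<open>Both products are required, so that cancellation is available on either side; by
  \<open>unitary_group_iff\<close> this is membership in \<open>unitary_group\<close>.\<close>

definition unitary :: "nat \<Rightarrow> complex mat \<Rightarrow> bool" where
  "unitary n U \<longleftrightarrow> U \<in> carrier_mat n n \<and> mat_adjoint U * U = 1\<^sub>m n \<and> U * mat_adjoint U = 1\<^sub>m n"

lemma unitary_adjoint: "unitary n U \<Longrightarrow> unitary n (mat_adjoint U)"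
  by (auto simp: unitary_def)

lemma unitary_cnj:
  assumes "unitary n U" shows "unitary n (mat_cnj U)"
proof -
  have U: "U \<in> carrier_mat n n" using assms by (simp add: unitary_def)
  have "mat_cnj (1\<^sub>m n) = 1\<^sub>m n" by (intro eq_matI) (auto simp: mat_cnj_def)
  moreover have "mat_cnj (A * B) = mat_cnj A * mat_cnj B" if "A \<in> carrier_mat n n" "B \<in> carrier_mat n n" for A B
    using that by (intro eq_matI)
      (auto simp: mat_mult_entry[OF mat_cnj_carrier mat_cnj_carrier] mat_mult_entry[OF that] simp del: index_mult_mat(1))
  moreover have "mat_cnj (mat_adjoint U) = mat_adjoint (mat_cnj U)"
    by (intro eq_matI) (auto simp: mat_adjoint_eq mat_cnj_def)
  ultimately show ?thesis
    using assms by (auto simp: unitary_def) (metis U mat_adjoint_carrier)+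
qed

lemma fip_unitary:
  assumes U: "unitary n U" and V: "unitary n V" and X: "X \<in> carrier_mat n n" and Y: "Y \<in> carrier_mat n n"
  shows "fip (U * X * V) (U * Y * V) = fip X Y"
proof -
  have c: "U \<in> carrier_mat n n" "V \<in> carrier_mat n n"
    "mat_adjoint U \<in> carrier_mat n n" "mat_adjoint V \<in> carrier_mat n n" "mat_adjoint Y \<in> carrier_mat n n"
    using U V Y by (auto simp: unitary_def)
  have "(U * X * V) * mat_adjoint (U * Y * V) = (U * X * V) * (mat_adjoint V * (mat_adjoint Y * mat_adjoint U))"
    using c X Y by (simp add: mat_adjoint_mult[of _ n n _ n] square_mult_assoc[of _ n])
  also have "\<dots> = (U * X) * (V * mat_adjoint V) * (mat_adjoint Y * mat_adjoint U)"
    using c X Y by (simp add: square_mult_assoc[of _ n])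
  also have "\<dots> = U * (X * mat_adjoint Y * mat_adjoint U)"
    using c X Y V by (simp add: unitary_def square_mult_assoc[of _ n])
  finally have "fip (U * X * V) (U * Y * V) = mat_trace (U * (X * mat_adjoint Y * mat_adjoint U))"
    by (simp add: fip_def)
  also have "\<dots> = mat_trace ((X * mat_adjoint Y * mat_adjoint U) * U)"
    using c X by (intro mat_trace_mult_commute[of _ n n]) auto
  also have "(X * mat_adjoint Y * mat_adjoint U) * U = X * mat_adjoint Y"
    using c X U by (simp add: unitary_def square_mult_assoc[of _ n])
  finally show ?thesis by (simp add: fip_def)
qed

lemma frob_sq_unitary:
  "unitary n U \<Longrightarrow> unitary n V \<Longrightarrow> X \<in> carrier_mat n n \<Longrightarrow> frob_sq (U * X * V) = frob_sq X"
  using fip_unitary[of n U V X X] by (simp add: fip_self)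

lemma unitary_orthonormal:
  assumes z: "orthonormal n n z"
  shows "unitary n (mat n n (\<lambda>(a, i). z i a))"
proof -
  define U where "U = mat n n (\<lambda>(a, i). z i a)"
  have Uc: "U \<in> carrier_mat n n" by (simp add: U_def)
  have "mat_adjoint U * U = 1\<^sub>m n"
  proof (intro eq_matI)
    fix i j assume "i < dim_row (1\<^sub>m n :: complex mat)" "j < dim_col (1\<^sub>m n :: complex mat)"
    then have ij: "i < n" "j < n" by auto
    have "(mat_adjoint U * U) $$ (i, j) = (\<Sum>t<n. cnj (z i t) * z j t)"
      using ij Uc by (subst mat_mult_entry[of _ n n _ n]) (auto simp: mat_adjoint_entry U_def)
    also have "\<dots> = hdot n (z j) (z i)" by (simp add: hdot_def mult.commute)
    finally show "(mat_adjoint U * U) $$ (i, j) = 1\<^sub>m n $$ (i, j)"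
      using orthonormalD[OF z ij(2,1)] ij by auto
  qed (use Uc in auto)
  then show ?thesis
    using mat_mult_left_right_inverse[of "mat_adjoint U" n U] Uc by (simp add: unitary_def U_def)
qed

text \<open>The difference of the two sides is the squared norm of \<open>F - s\<close>, where
  \<open>s\<close> is the projection of \<open>F\<close> to the span of the
  \<open>w \<beta>\<close>.\<close>

lemma bessel:
  fixes w :: "'b \<Rightarrow> 'k \<Rightarrow> complex"
  assumes S: "finite S"
    and on: "\<And>\<beta> \<gamma>. \<beta> \<in> S \<Longrightarrow> \<gamma> \<in> S \<Longrightarrow> (\<Sum>k\<in>K. w \<beta> k * cnj (w \<gamma> k)) = (if \<beta> = \<gamma> then 1 else 0)"
  shows "(\<Sum>\<beta>\<in>S. (cmod (\<Sum>k\<in>K. F k * cnj (w \<beta> k)))\<^sup>2) \<le> (\<Sum>k\<in>K. (cmod (F k))\<^sup>2)"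
proof -
  define c where "c \<beta> = (\<Sum>k\<in>K. F k * cnj (w \<beta> k))" for \<beta>
  define s where "s k = (\<Sum>\<beta>\<in>S. c \<beta> * w \<beta> k)" for k
  define N where "N = (\<Sum>\<beta>\<in>S. c \<beta> * cnj (c \<beta>))"
  have dot_s: "(\<Sum>k\<in>K. u k * cnj (s k)) = (\<Sum>\<beta>\<in>S. cnj (c \<beta>) * (\<Sum>k\<in>K. u k * cnj (w \<beta> k)))" for u
    by (simp add: s_def sum_distrib_left mult_ac) (rule sum.swap)
  have Fs: "(\<Sum>k\<in>K. F k * cnj (s k)) = N"
    by (simp add: dot_s N_def c_def[symmetric] mult.commute)
  have "(\<Sum>k\<in>K. s k * cnj (w \<gamma> k)) = c \<gamma>" if "\<gamma> \<in> S" for \<gamma>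
  proof -
    have "(\<Sum>k\<in>K. s k * cnj (w \<gamma> k)) = (\<Sum>\<beta>\<in>S. c \<beta> * (\<Sum>k\<in>K. w \<beta> k * cnj (w \<gamma> k)))"
      by (simp add: s_def sum_distrib_left sum_distrib_right mult_ac) (rule sum.swap)
    also have "\<dots> = (\<Sum>\<beta>\<in>S. if \<beta> = \<gamma> then c \<beta> else 0)"
      using that by (intro sum.cong) (auto simp: on)
    finally show ?thesis using S that by simp
  qed
  then have ss: "(\<Sum>k\<in>K. s k * cnj (s k)) = N"
    by (simp add: dot_s N_def mult.commute)
  have "cnj (\<Sum>k\<in>K. F k * cnj (s k)) = cnj N" by (simp only: Fs)
  then have sF: "(\<Sum>k\<in>K. s k * cnj (F k)) = N"
    by (simp add: N_def mult.commute)
  have "(\<Sum>k\<in>K. (F k - s k) * cnj (F k - s k)) = (\<Sum>k\<in>K. F k * cnj (F k)) - N"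
    using Fs ss sF by (simp add: algebra_simps sum.distrib sum_subtractf)
  then have "complex_of_real (\<Sum>k\<in>K. (cmod (F k - s k))\<^sup>2) =
      complex_of_real ((\<Sum>k\<in>K. (cmod (F k))\<^sup>2) - (\<Sum>\<beta>\<in>S. (cmod (c \<beta>))\<^sup>2))"
    by (simp only: of_real_sum of_real_diff complex_norm_square N_def)
  then have "(\<Sum>k\<in>K. (cmod (F k - s k))\<^sup>2) = (\<Sum>k\<in>K. (cmod (F k))\<^sup>2) - (\<Sum>\<beta>\<in>S. (cmod (c \<beta>))\<^sup>2)"
    by (simp only: of_real_eq_iff)
  moreover have "(\<Sum>k\<in>K. (cmod (F k - s k))\<^sup>2) \<ge> 0" by (simp add: sum_nonneg)
  ultimately show ?thesis by (simp add: c_def)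
qed

subsection \<open>Eigenbasis of a real skew-symmetric matrix\<close>

text \<open>Real matrices are kept inside the complex ones, so that unitary conjugation and the
  Hermitian spectral theorem apply without a change of type.\<close>

definition real_skew :: "nat \<Rightarrow> complex mat \<Rightarrow> bool" where
  "real_skew n A \<longleftrightarrow> A \<in> carrier_mat n n \<and> transpose_mat A = - A \<and> mat_cnj A = A"

lemma real_skewD:
  assumes "real_skew n A"
  shows "A \<in> carrier_mat n n" "\<And>i j. i < n \<Longrightarrow> j < n \<Longrightarrow> A $$ (j, i) = - A $$ (i, j)"
    "\<And>i j. i < n \<Longrightarrow> j < n \<Longrightarrow> cnj (A $$ (i, j)) = A $$ (i, j)" "mat_adjoint A = - A"
proof -
  show A: "A \<in> carrier_mat n n" using assms by (simp add: real_skew_def)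
  show "A $$ (j, i) = - A $$ (i, j)" if "i < n" "j < n" for i j
  proof -
    have "A $$ (j, i) = transpose_mat A $$ (i, j)" using that carrier_matD[OF A] by simp
    also have "\<dots> = (- A) $$ (i, j)" using assms by (simp add: real_skew_def)
    finally show ?thesis using that carrier_matD[OF A] by simp
  qed
  have "mat_cnj A $$ (i, j) = A $$ (i, j)" for i j
    using assms by (simp add: real_skew_def)
  from this show "cnj (A $$ (i, j)) = A $$ (i, j)" if "i < n" "j < n" for i j
    using that carrier_matD[OF A] by (metis mat_cnj_entry)
  show "mat_adjoint A = - A" using assms by (simp add: real_skew_def mat_adjoint_eq)
qed

lemma parseval:
  assumes "orthonormal N N f"
  shows "(\<Sum>j<N. hdot N u (f j) * cnj (hdot N u (f j))) = hdot N u u"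
proof -
  have "hdot N u u = hdot N (\<lambda>t. \<Sum>j<N. hdot N u (f j) * f j t) u"
    using orthonormal_expand[OF assms, of _ u] by (intro hdot_cong) auto
  also have "\<dots> = (\<Sum>j<N. hdot N u (f j) * hdot N (f j) u)"
    by (rule hdot_sum_left)
  also have "\<dots> = (\<Sum>j<N. hdot N u (f j) * cnj (hdot N u (f j)))"
    by (simp add: hdot_commute[of N "f _" u])
  finally show ?thesis by simp
qed

text \<open>The bilinear products \<open>V i j\<close> of the eigenvectors vanish unless \<open>\<theta> i = - \<theta> j\<close>, and
  \<open>|V i j|\<^sup>2\<close> is doubly stochastic; so the spectrum is symmetric about \<open>0\<close>.\<close>

lemma skew_spectrum_symmetric:
  fixes g :: "real \<Rightarrow> real" and A :: "nat \<Rightarrow> nat \<Rightarrow> complex"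
  assumes z: "orthonormal n n z"
    and skew: "\<And>a b. a < n \<Longrightarrow> b < n \<Longrightarrow> A b a = - A a b"
    and ev: "\<forall>i<n. \<forall>a<n. (\<Sum>b<n. A a b * z i b) = complex_of_real (\<theta> i) * z i a"
  shows "(\<Sum>i<n. g (\<theta> i)) = (\<Sum>i<n. g (- \<theta> i))"
proof -
  define V where "V i j = (\<Sum>t<n. z i t * z j t)" for i j
  have Vsym: "V i j = V j i" for i j by (simp add: V_def mult.commute)
  have "complex_of_real (\<theta> i) * V i j = - (complex_of_real (\<theta> j) * V i j)" if "i < n" "j < n" for i j
  proof -
    have "complex_of_real (\<theta> i) * V i j = (\<Sum>a<n. (\<Sum>b<n. A a b * z i b) * z j a)"
      using ev that by (simp add: V_def sum_distrib_left mult.assoc)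
    also have "\<dots> = (\<Sum>b<n. \<Sum>a<n. A a b * z i b * z j a)"
      by (subst sum.swap) (simp add: sum_distrib_right)
    also have "\<dots> = (\<Sum>b<n. z i b * - (\<Sum>a<n. A b a * z j a))"
      unfolding sum_negf[symmetric] sum_distrib_left
  proof (intro sum.cong refl)
      fix b a assume "b \<in> {..<n}" "a \<in> {..<n}"
      then show "A a b * z i b * z j a = z i b * - (A b a * z j a)"
        using skew[of b a] by simp
    qed
    also have "\<dots> = - (complex_of_real (\<theta> j) * V i j)"
      using ev that by (simp add: V_def sum_distrib_left mult_ac sum_negf)
    finally show ?thesis .
  qed
  then have "(complex_of_real (\<theta> i) + complex_of_real (\<theta> j)) * V i j = 0" if "i < n" "j < n" for i j
    using that by (simp add: distrib_right)
  then have "complex_of_real (\<theta> i + \<theta> j) * V i j = 0" if "i < n" "j < n" for i j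
    using that by simp
  then have V0: "V i j = 0 \<or> \<theta> i = - \<theta> j" if "i < n" "j < n" for i j
    using that by (metis add_eq_0_iff2 mult_eq_0_iff of_real_eq_0_iff)
  \<comment> \<open>\<open>V i j\<close> is the coefficient of \<open>z i\<close> along the
    conjugate of \<open>z j\<close>. The conjugated family is again an orthonormal basis, so by
    Parseval the squared moduli in every row sum to 1.\<close>
  have "orthonormal n n (\<lambda>i t. cnj (z i t))"
    using z by (auto simp: orthonormal_def hdot_def) (metis (mono_tags, lifting) complex_cnj_cnj complex_cnj_mult complex_cnj_one complex_cnj_zero cnj_sum sum.cong)+
  then have "(\<Sum>j<n. V i j * cnj (V i j)) = hdot n (z i) (z i)" for i
    using parseval[of n "\<lambda>i t. cnj (z i t)" "z i"] by (simp add: V_def hdot_def)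
  then have "complex_of_real (\<Sum>j<n. (cmod (V i j))\<^sup>2) = complex_of_real 1" if "i < n" for i
    using orthonormalD[OF z that that] by (simp only: of_real_sum complex_norm_square) simp
  then have row: "(\<Sum>j<n. (cmod (V i j))\<^sup>2) = 1" if "i < n" for i
    using that by (simp only: of_real_eq_iff)
  have "(\<Sum>i<n. g (\<theta> i)) = (\<Sum>i<n. \<Sum>j<n. (cmod (V i j))\<^sup>2 * g (\<theta> i))"
    by (simp add: sum_distrib_right[symmetric] row)
  \<comment> \<open>Where the weight is nonzero, \<open>\<theta> i = - \<theta> j\<close>; and
    \<open>V\<close> is symmetric.\<close>
  also have "\<dots> = (\<Sum>i<n. \<Sum>j<n. (cmod (V j i))\<^sup>2 * g (- \<theta> j))"
    using V0 Vsym by (intro sum.cong refl) fastforce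
  also have "\<dots> = (\<Sum>j<n. \<Sum>i<n. (cmod (V j i))\<^sup>2 * g (- \<theta> j))"
    by (rule sum.swap)
  also have "\<dots> = (\<Sum>j<n. g (- \<theta> j))"
    by (simp add: sum_distrib_right[symmetric] row)
  finally show ?thesis .
qed

lemma frob_sq_zero [simp]: "frob_sq (0\<^sub>m n m) = 0"
  using frob_sq_eq_0_iff[of "0\<^sub>m n m" n m] by simp

lemma double_sum_nonneg_0:
  fixes f :: "'i \<Rightarrow> 'j \<Rightarrow> real"
  assumes "finite I" "finite J" "\<And>i j. i \<in> I \<Longrightarrow> j \<in> J \<Longrightarrow> 0 \<le> f i j"
    and "(\<Sum>i\<in>I. \<Sum>j\<in>J. f i j) = 0" "i \<in> I" "j \<in> J"
  shows "f i j = 0"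
proof -
  have "(\<Sum>j\<in>J. f i j) = 0"
    by (rule sum_nonneg_0[OF assms(1) _ assms(4,5)]) (intro sum_nonneg assms(3))
  then show ?thesis
    by (rule sum_nonneg_0[OF assms(2) _ _ assms(6), rotated]) (intro assms(3,5))
qed

lemma add_smult_entry:
  "X \<in> carrier_mat n m \<Longrightarrow> Y \<in> carrier_mat n m \<Longrightarrow> i < n \<Longrightarrow> j < m \<Longrightarrow>
    (X + c \<cdot>\<^sub>m Y) $$ (i, j) = X $$ (i, j) + c * Y $$ (i, j)"
  by auto

text \<open>The coordinates are \<open>T X = mat_adjoint U * X * mat_cnj U\<close>, with
  eigenvectors of \<open>A\<close> as columns of \<open>U\<close>. The right factor is the transpose
  of the left one, so skew symmetry survives. As \<open>A\<close> is real, \<open>mat_cnj U\<close>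
  diagonalises it with the conjugate eigenvalues, and a commutator with \<open>A\<close> therefore
  multiplies entries by \<open>- \<i> * (\<theta> i + \<theta> j)\<close>.\<close>

lemma skew_eigenbasis:
  assumes A: "real_skew n A"
  obtains T :: "complex mat \<Rightarrow> complex mat" and \<theta> :: "nat \<Rightarrow> real" where
    "\<forall>X\<in>carrier_mat n n. T X \<in> carrier_mat n n"
    "\<forall>X\<in>carrier_mat n n. \<forall>Y\<in>carrier_mat n n. fip (T X) (T Y) = fip X Y"
    "\<forall>X\<in>carrier_mat n n. \<forall>Y\<in>carrier_mat n n. \<forall>c. T (X + c \<cdot>\<^sub>m Y) = T X + c \<cdot>\<^sub>m T Y"
    "\<forall>X\<in>carrier_mat n n. transpose_mat X = - X \<longrightarrow> (\<forall>i<n. \<forall>j<n. T X $$ (j, i) = - T X $$ (i, j))"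
    "\<forall>X\<in>carrier_mat n n. \<forall>i<n. \<forall>j<n. T (A * X) $$ (i, j) = - \<i> * complex_of_real (\<theta> i) * T X $$ (i, j)"
    "\<forall>X\<in>carrier_mat n n. \<forall>i<n. \<forall>j<n. T (X * A) $$ (i, j) = \<i> * complex_of_real (\<theta> j) * T X $$ (i, j)"
    "(\<Sum>i | i < n \<and> 0 \<le> \<theta> i. (\<theta> i)\<^sup>2) = frob_sq A / 2"
    "(\<Sum>i | i < n \<and> \<theta> i < 0. (\<theta> i)\<^sup>2) = frob_sq A / 2"
proof -
  have Ac: "A \<in> carrier_mat n n" using A by (rule real_skewD)
  \<comment> \<open>\<open>\<i> * A\<close> is Hermitian with spectrum \<theta>, so \<open>A\<close>
    has the eigenvalues \<open>- \<i> * \<theta> i\<close>.\<close>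
  define H where "H a b = \<i> * A $$ (a, b)" for a b
  have herm: "H b a = cnj (H a b)" if "a < n" "b < n" for a b
    using real_skewD(2,3)[OF A that] by (simp add: H_def)
  obtain z and \<theta> :: "nat \<Rightarrow> real" where z: "orthonormal n n z"
    and ev: "\<forall>i<n. \<forall>a<n. (\<Sum>b<n. H a b * z i b) = complex_of_real (\<theta> i) * z i a"
    by (rule hermitian_spectral[of UNIV n H, OF _ herm]) auto
  have ev': "(\<Sum>b<n. A $$ (a, b) * z i b) = - \<i> * complex_of_real (\<theta> i) * z i a" if "i < n" "a < n" for i a
  proof -
    have "\<i> * (\<Sum>b<n. A $$ (a, b) * z i b) = complex_of_real (\<theta> i) * z i a"
      using ev that by (simp add: H_def sum_distrib_left mult.assoc)
    then have "- \<i> * (\<i> * (\<Sum>b<n. A $$ (a, b) * z i b)) = - \<i> * (complex_of_real (\<theta> i) * z i a)" by (rule arg_cong)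
    then show ?thesis by simp
  qed
  define U where "U = mat n n (\<lambda>(a, i). z i a)"
  have Uc: "U \<in> carrier_mat n n" by (simp add: U_def)
  have U: "unitary n U" unfolding U_def by (rule unitary_orthonormal[OF z])
  let ?D = "mat_diag n (\<lambda>i. - \<i> * complex_of_real (\<theta> i))"
  let ?D' = "mat_diag n (\<lambda>i. \<i> * complex_of_real (\<theta> i))"
  let ?Ua = "mat_adjoint U" and ?Uc = "mat_cnj U"
  have c: "?Ua \<in> carrier_mat n n" "?Uc \<in> carrier_mat n n" "?D \<in> carrier_mat n n" "?D' \<in> carrier_mat n n"
    using Uc by simp_all
  have AU: "A * U = U * ?D"
  proof -
    have "(A * U) $$ (a, i) = U $$ (a, i) * (- \<i> * complex_of_real (\<theta> i))" if "a < n" "i < n" for a i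
    proof -
      have "(A * U) $$ (a, i) = (\<Sum>b<n. A $$ (a, b) * z i b)"
        using that by (subst mat_mult_entry[OF Ac Uc]) (auto simp: U_def)
      then show ?thesis using that ev' by (simp add: U_def mult.commute)
    qed
    then show ?thesis
      unfolding mat_diag_mult_right[OF Uc] using Ac Uc by (intro eq_matI) (auto simp del: index_mult_mat(1))
  qed
  have AUc: "A * ?Uc = ?Uc * ?D'"
  proof -
    have "(A * ?Uc) $$ (a, i) = ?Uc $$ (a, i) * (\<i> * complex_of_real (\<theta> i))" if "a < n" "i < n" for a i
    proof -
      have "(A * ?Uc) $$ (a, i) = (\<Sum>b<n. cnj (A $$ (a, b) * z i b))"
        using that Uc real_skewD(3)[OF A that(1)] by (subst mat_mult_entry[OF Ac c(2)]) (auto simp: U_def)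
      also have "\<dots> = cnj (- \<i> * complex_of_real (\<theta> i) * z i a)"
        unfolding cnj_sum[symmetric] using ev' that by simp
      finally show ?thesis using that Uc by (simp add: U_def mult.commute)
    qed
    then show ?thesis
      unfolding mat_diag_mult_right[OF c(2)] using Ac c(2) by (intro eq_matI) (auto simp del: index_mult_mat(1))
  qed
  have UA: "?Ua * A = ?D * ?Ua"
  proof -
    have "?Ua * A = ?Ua * A * (U * ?Ua)"
      using U Ac c by (simp add: unitary_def)
    also have "\<dots> = ?Ua * (A * U) * ?Ua"
      using Uc Ac c by (simp add: square_mult_assoc[of _ n])
    also have "\<dots> = (?Ua * U) * ?D * ?Ua"
      unfolding AU using Uc Ac c by (simp add: square_mult_assoc[of _ n])
    also have "\<dots> = ?D * ?Ua" using U c by (simp add: unitary_def)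
    finally show ?thesis .
  qed
  define T where "T X = ?Ua * X * ?Uc" for X :: "complex mat"
  have TX: "T X \<in> carrier_mat n n" if "X \<in> carrier_mat n n" for X :: "complex mat"
    using that c unfolding T_def by simp
  have frob: "frob_sq A = (\<Sum>i<n. (\<theta> i)\<^sup>2)"
  proof -
    have "?Ua * A * U = ?D"
      unfolding UA using U c Uc by (simp add: unitary_def square_mult_assoc[of _ n])
    then have "frob_sq A = frob_sq ?D"
      using frob_sq_unitary[OF unitary_adjoint[OF U] U Ac] by simp
    also have "\<dots> = (\<Sum>i<n. \<Sum>j<n. if i = j then (\<theta> i)\<^sup>2 else 0)"
      unfolding frob_sq_entries[OF c(3)] by (intro sum.cong refl) (auto simp: mat_diag_def norm_mult)
    finally show ?thesis by simp
  qed
  have pos_part: "(\<Sum>i | i < n \<and> P (\<theta> i). (\<theta> i)\<^sup>2) = (\<Sum>i<n. if P (\<theta> i) then (\<theta> i)\<^sup>2 else 0)" for P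
    by (simp add: sum.If_cases lessThan_def Collect_conj_eq)
  have "(\<Sum>i<n. if 0 \<le> \<theta> i then (\<theta> i)\<^sup>2 else 0) = (\<Sum>i<n. if 0 \<le> - \<theta> i then (- \<theta> i)\<^sup>2 else 0)"
  proof (rule skew_spectrum_symmetric[OF z _ ev])
    show "H b a = - H a b" if "a < n" "b < n" for a b
      using real_skewD(2)[OF A that] by (simp add: H_def)
  qed
  \<comment> \<open>At \<open>\<theta> i = 0\<close> the summand is 0, so moving this boundary case
    to the other half is harmless.\<close>
  also have "\<dots> = (\<Sum>i<n. if \<theta> i < 0 then (\<theta> i)\<^sup>2 else 0)"
    by (intro sum.cong refl) auto
  finally have e: "(\<Sum>i<n. if 0 \<le> \<theta> i then (\<theta> i)\<^sup>2 else 0) = (\<Sum>i<n. if \<theta> i < 0 then (\<theta> i)\<^sup>2 else 0)" .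
  have "(\<Sum>i<n. if 0 \<le> \<theta> i then (\<theta> i)\<^sup>2 else 0) + (\<Sum>i<n. if \<theta> i < 0 then (\<theta> i)\<^sup>2 else 0) = frob_sq A"
    unfolding frob sum.distrib[symmetric] by (intro sum.cong refl) auto
  with e have halves: "(\<Sum>i<n. if 0 \<le> \<theta> i then (\<theta> i)\<^sup>2 else 0) = frob_sq A / 2"
    "(\<Sum>i<n. if \<theta> i < 0 then (\<theta> i)\<^sup>2 else 0) = frob_sq A / 2" by argo+
  show ?thesis
  proof (rule that[of T \<theta>])
    show "\<forall>X\<in>carrier_mat n n. T X \<in> carrier_mat n n" using TX by simp
    show "\<forall>X\<in>carrier_mat n n. \<forall>Y\<in>carrier_mat n n. fip (T X) (T Y) = fip X Y"
      unfolding T_def using fip_unitary[OF unitary_adjoint[OF U] unitary_cnj[OF U]] by simp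
    show "\<forall>X\<in>carrier_mat n n. \<forall>Y\<in>carrier_mat n n. \<forall>k. T (X + k \<cdot>\<^sub>m Y) = T X + k \<cdot>\<^sub>m T Y"
      unfolding T_def using c
      by (auto simp: mult_add_distrib_mat[of _ n n] add_mult_distrib_mat[of _ n n]
          mult_smult_distrib[of _ n n] mult_smult_assoc_mat[of _ n n])
    show "\<forall>X\<in>carrier_mat n n. transpose_mat X = - X \<longrightarrow> (\<forall>i<n. \<forall>j<n. T X $$ (j, i) = - T X $$ (i, j))"
    proof (intro ballI impI allI)
      fix X :: "complex mat" and i j assume X: "X \<in> carrier_mat n n" and sk: "transpose_mat X = - X" and ij: "i < n" "j < n"
      have t: "transpose_mat ?Ua = ?Uc" "transpose_mat ?Uc = ?Ua"
        by (simp_all add: mat_adjoint_eq)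
      have "transpose_mat (T X) = ?Ua * (transpose_mat X * ?Uc)"
        unfolding T_def using c X by (simp add: transpose_mult[of _ n n _ n] t)
      also have "\<dots> = - T X"
        unfolding sk T_def using c X by (simp add: square_mult_assoc[of _ n] uminus_mult_left_mat uminus_mult_right_mat
            carrier_matD[OF Uc] carrier_matD[OF X])
      finally have "transpose_mat (T X) $$ (i, j) = (- T X) $$ (i, j)" by simp
      then show "T X $$ (j, i) = - T X $$ (i, j)" using ij TX[OF X] by simp
    qed
    show "\<forall>X\<in>carrier_mat n n. \<forall>i<n. \<forall>j<n. T (A * X) $$ (i, j) = - \<i> * complex_of_real (\<theta> i) * T X $$ (i, j)"
    proof (intro ballI allI impI)
      fix X :: "complex mat" and i j assume X: "X \<in> carrier_mat n n" and ij: "i < n" "j < n"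
      have "T (A * X) = ?Ua * A * X * ?Uc"
        unfolding T_def using c X Ac by (simp add: square_mult_assoc[of _ n])
      also have "\<dots> = ?D * T X"
        unfolding UA T_def using c X Ac by (simp add: square_mult_assoc[of _ n])
      finally show "T (A * X) $$ (i, j) = - \<i> * complex_of_real (\<theta> i) * T X $$ (i, j)"
        using ij by (simp add: mat_diag_mult_left[OF TX[OF X]])
    qed
    show "\<forall>X\<in>carrier_mat n n. \<forall>i<n. \<forall>j<n. T (X * A) $$ (i, j) = \<i> * complex_of_real (\<theta> j) * T X $$ (i, j)"
    proof (intro ballI allI impI)
      fix X :: "complex mat" and i j assume X: "X \<in> carrier_mat n n" and ij: "i < n" "j < n"
      have "T (X * A) = ?Ua * X * (A * ?Uc)"
        unfolding T_def using c X Ac by (simp add: square_mult_assoc[of _ n])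
      also have "\<dots> = T X * ?D'"
        unfolding AUc T_def using c X Ac by (simp add: square_mult_assoc[of _ n])
      finally show "T (X * A) $$ (i, j) = \<i> * complex_of_real (\<theta> j) * T X $$ (i, j)"
        using ij by (simp add: mat_diag_mult_right[OF TX[OF X]] mult.commute)
    qed
    show "(\<Sum>i | i < n \<and> 0 \<le> \<theta> i. (\<theta> i)\<^sup>2) = frob_sq A / 2"
      using pos_part[of "\<lambda>x. 0 \<le> x"] halves(1) by simp
    show "(\<Sum>i | i < n \<and> \<theta> i < 0. (\<theta> i)\<^sup>2) = frob_sq A / 2"
      using pos_part[of "\<lambda>x. x < 0"] halves(2) by simp
  qed
qed

section \<open>Commutator estimates in the eigenbasis\<close>

context
  fixes n :: nat and A :: "complex mat" and T :: "complex mat \<Rightarrow> complex mat" and \<theta> :: "nat \<Rightarrow> real"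
  assumes A: "real_skew n A"
    and TC: "\<forall>X\<in>carrier_mat n n. T X \<in> carrier_mat n n"
    and Tip: "\<forall>X\<in>carrier_mat n n. \<forall>Y\<in>carrier_mat n n. fip (T X) (T Y) = fip X Y"
    and Tlin: "\<forall>X\<in>carrier_mat n n. \<forall>Y\<in>carrier_mat n n. \<forall>c. T (X + c \<cdot>\<^sub>m Y) = T X + c \<cdot>\<^sub>m T Y"
    and Tskew: "\<forall>X\<in>carrier_mat n n. transpose_mat X = - X \<longrightarrow> (\<forall>i<n. \<forall>j<n. T X $$ (j, i) = - T X $$ (i, j))"
    and TA: "\<forall>X\<in>carrier_mat n n. \<forall>i<n. \<forall>j<n. T (A * X) $$ (i, j) = - \<i> * complex_of_real (\<theta> i) * T X $$ (i, j)"
    and TA': "\<forall>X\<in>carrier_mat n n. \<forall>i<n. \<forall>j<n. T (X * A) $$ (i, j) = \<i> * complex_of_real (\<theta> j) * T X $$ (i, j)"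
    and pos: "(\<Sum>i | i < n \<and> 0 \<le> \<theta> i. (\<theta> i)\<^sup>2) = frob_sq A / 2"
    and neg: "(\<Sum>i | i < n \<and> \<theta> i < 0. (\<theta> i)\<^sup>2) = frob_sq A / 2"
begin

private lemma Ac: "A \<in> carrier_mat n n" using A by (rule real_skewD)

private lemma T_frob: "X \<in> carrier_mat n n \<Longrightarrow> frob_sq (T X) = frob_sq X"
  using Tip by (metis fip_self of_real_eq_iff)

private lemma T_inj:
  assumes X: "X \<in> carrier_mat n n" and "\<And>i j. i < n \<Longrightarrow> j < n \<Longrightarrow> T X $$ (i, j) = 0"
  shows "X = 0\<^sub>m n n"
proof -
  have "T X = 0\<^sub>m n n" using assms TC by (intro eq_matI) auto
  then have "frob_sq X = 0" using T_frob[OF X] by simp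
  then show ?thesis using frob_sq_eq_0_iff[OF X] by simp
qed

private lemma T_commutator:
  assumes X: "X \<in> carrier_mat n n" and ij: "i < n" "j < n"
  shows "T (commutator A X) $$ (i, j) = - \<i> * complex_of_real (\<theta> i + \<theta> j) * T X $$ (i, j)"
proof -
  have m: "A * X \<in> carrier_mat n n" "X * A \<in> carrier_mat n n" using X Ac by auto
  have "commutator A X = A * X + (-1) \<cdot>\<^sub>m (X * A)"
    using X Ac by (intro eq_matI) (auto simp: commutator_def)
  then have "T (commutator A X) = T (A * X) + (-1) \<cdot>\<^sub>m T (X * A)"
    using Tlin m by simp
  moreover have "T (A * X) \<in> carrier_mat n n" "T (X * A) \<in> carrier_mat n n" using TC m by auto
  ultimately have "T (commutator A X) $$ (i, j) = T (A * X) $$ (i, j) + (-1) * T (X * A) $$ (i, j)"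
    using add_smult_entry ij by metis
  then show ?thesis using TA TA' X ij by (simp add: algebra_simps)
qed

private lemma frob_commutator:
  assumes X: "X \<in> carrier_mat n n"
  shows "frob_sq (commutator A X) = (\<Sum>i<n. \<Sum>j<n. (\<theta> i + \<theta> j)\<^sup>2 * (cmod (T X $$ (i, j)))\<^sup>2)"
proof -
  have C: "commutator A X \<in> carrier_mat n n" using X Ac by simp
  have "frob_sq (commutator A X) = frob_sq (T (commutator A X))" using T_frob[OF C] by simp
  also have "\<dots> = (\<Sum>i<n. \<Sum>j<n. (cmod (T (commutator A X) $$ (i, j)))\<^sup>2)"
    using TC C by (intro frob_sq_entries) auto
  also have "\<dots> = (\<Sum>i<n. \<Sum>j<n. (\<theta> i + \<theta> j)\<^sup>2 * (cmod (T X $$ (i, j)))\<^sup>2)"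
    by (intro sum.cong refl) (simp add: T_commutator[OF X] norm_mult power_mult_distrib del: of_real_add)
  finally show ?thesis .
qed

private lemma sq_le:
  assumes "i < n" shows "(\<theta> i)\<^sup>2 \<le> frob_sq A / 2"
proof (cases "0 \<le> \<theta> i")
  case True
  then show ?thesis unfolding pos[symmetric] using assms by (intro member_le_sum) auto
next
  case False
  then show ?thesis unfolding neg[symmetric] using assms by (intro member_le_sum) auto
qed

text \<open>With opposite signs, the modulus of the sum is at most the larger of the two
  moduli.\<close>

private lemma mixed_sign:
  assumes "i < n" "j < n" "0 \<le> \<theta> i" "\<theta> j < 0"
  shows "(\<theta> i + \<theta> j)\<^sup>2 \<le> frob_sq A / 2"
proof (cases "0 \<le> \<theta> i + \<theta> j")
  case True
  then have "(\<theta> i + \<theta> j)\<^sup>2 \<le> (\<theta> i)\<^sup>2" using assms by (intro power_mono) auto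
  then show ?thesis using sq_le[OF assms(1)] by simp
next
  case False
  then have "\<bar>\<theta> i + \<theta> j\<bar> \<le> \<bar>\<theta> j\<bar>" using assms by simp
  then have "(\<theta> i + \<theta> j)\<^sup>2 \<le> (\<theta> j)\<^sup>2" by (simp only: abs_le_square_iff)
  then show ?thesis using sq_le[OF assms(2)] by simp
qed

text \<open>Distinct indices of equal sign give two summands of the same half of the spectrum, whose
  squares sum to \<open>frob_sq A / 2\<close>.\<close>

private lemma same_sign:
  assumes "i < n" "j < n" "i \<noteq> j" "0 \<le> \<theta> i \<longleftrightarrow> 0 \<le> \<theta> j"
  shows "(\<theta> i)\<^sup>2 + (\<theta> j)\<^sup>2 \<le> frob_sq A / 2"
proof (cases "0 \<le> \<theta> i")
  case True
  have "(\<Sum>k\<in>{i, j}. (\<theta> k)\<^sup>2) \<le> (\<Sum>k | k < n \<and> 0 \<le> \<theta> k. (\<theta> k)\<^sup>2)"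
    using True assms by (intro sum_mono2) auto
  then show ?thesis using pos assms by simp
next
  case False
  have "(\<Sum>k\<in>{i, j}. (\<theta> k)\<^sup>2) \<le> (\<Sum>k | k < n \<and> \<theta> k < 0. (\<theta> k)\<^sup>2)"
    using False assms by (intro sum_mono2) auto
  then show ?thesis using neg assms by simp
qed

text \<open>For equal signs, \<open>(\<theta> i + \<theta> j)^2\<close> is
  \<open>2 * ((\<theta> i)^2 + (\<theta> j)^2)\<close> minus the squared difference, so equality
  forces \<open>\<theta> i = \<theta> j\<close>. For opposite signs the bound holds with a factor
  1/2 to spare, and equality is possible only when \<open>frob_sq A = 0\<close>.\<close>

private lemma pair_bound:
  assumes "i < n" "j < n" "i \<noteq> j"
  shows "(\<theta> i + \<theta> j)\<^sup>2 \<le> frob_sq A"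
    and "(\<theta> i + \<theta> j)\<^sup>2 = frob_sq A \<Longrightarrow> \<theta> i = \<theta> j \<and> (\<theta> i)\<^sup>2 = frob_sq A / 4"
proof -
  have "(\<theta> i + \<theta> j)\<^sup>2 \<le> frob_sq A \<and> ((\<theta> i + \<theta> j)\<^sup>2 = frob_sq A \<longrightarrow> \<theta> i = \<theta> j \<and> (\<theta> i)\<^sup>2 = frob_sq A / 4)"
  proof (cases "0 \<le> \<theta> i \<longleftrightarrow> 0 \<le> \<theta> j")
    case True
    have e: "(\<theta> i + \<theta> j)\<^sup>2 = 2 * ((\<theta> i)\<^sup>2 + (\<theta> j)\<^sup>2) - (\<theta> i - \<theta> j)\<^sup>2"
      by (simp add: power2_eq_square algebra_simps)
    have d: "(\<theta> i - \<theta> j)\<^sup>2 \<ge> 0" by simp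
    have "\<theta> i = \<theta> j \<and> (\<theta> i)\<^sup>2 = frob_sq A / 4" if F: "(\<theta> i + \<theta> j)\<^sup>2 = frob_sq A"
    proof -
      have "(\<theta> i - \<theta> j)\<^sup>2 \<le> 0" using e F same_sign[OF assms True] by argo
      then have ij: "\<theta> i = \<theta> j" by simp
      then show ?thesis using F by (simp add: power2_eq_square)
    qed
    moreover have "(\<theta> i + \<theta> j)\<^sup>2 \<le> frob_sq A" using e d same_sign[OF assms True] by argo
    ultimately show ?thesis by blast
  next
    case False
    then have m: "(\<theta> i + \<theta> j)\<^sup>2 \<le> frob_sq A / 2"
      using mixed_sign[of i j] mixed_sign[of j i] assms by (auto simp: add.commute)
    have "\<theta> i = 0 \<and> \<theta> j = 0" if "frob_sq A = 0"
      using sq_le[OF assms(1)] sq_le[OF assms(2)] that by simp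
    then show ?thesis using m frob_sq_nonneg[of A] by auto
  qed
  then show "(\<theta> i + \<theta> j)\<^sup>2 \<le> frob_sq A"
    and "(\<theta> i + \<theta> j)\<^sup>2 = frob_sq A \<Longrightarrow> \<theta> i = \<theta> j \<and> (\<theta> i)\<^sup>2 = frob_sq A / 4" by blast+
qed

text \<open>The diagonal has to be treated apart: there \<open>(2 * \<theta> i)^2\<close> may be as
  large as \<open>2 * frob_sq A\<close>, but the entry of \<open>T X\<close> is 0 by skew
  symmetry.\<close>

private lemma skew_term:
  assumes X: "real_skew n X" and ij: "i < n" "j < n"
  shows "(\<theta> i + \<theta> j)\<^sup>2 * (cmod (T X $$ (i, j)))\<^sup>2 \<le> frob_sq A * (cmod (T X $$ (i, j)))\<^sup>2"
proof (cases "i = j")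
  case True
  have "T X $$ (i, i) = - T X $$ (i, i)" using Tskew X ij unfolding real_skew_def by blast
  then show ?thesis using True by simp
next
  case False
  then show ?thesis using pair_bound(1)[OF ij] by (intro mult_right_mono) auto
qed

lemma frob_commutator_le_aux:
  assumes X: "real_skew n X"
  shows "frob_sq (commutator A X) \<le> frob_sq A * frob_sq X"
proof -
  have Xc: "X \<in> carrier_mat n n" using X by (rule real_skewD)
  have "frob_sq (commutator A X) \<le> (\<Sum>i<n. \<Sum>j<n. frob_sq A * (cmod (T X $$ (i, j)))\<^sup>2)"
    unfolding frob_commutator[OF Xc] by (intro sum_mono skew_term[OF X]) auto
  also have "\<dots> = frob_sq A * frob_sq (T X)"
    using TC Xc by (simp add: frob_sq_entries[of "T X" n n] sum_distrib_left)
  finally show ?thesis by (simp add: T_frob[OF Xc])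
qed

text \<open>Equality holds in every entry, so \<open>T X\<close> is supported where
  \<open>\<theta> i = \<theta> j\<close> and \<open>(\<theta> i)^2 = frob_sq A / 4\<close>. On such
  entries the anticommutator has the factor
  \<open>- \<i> * \<theta> i + \<i> * \<theta> j = 0\<close>, and applying \<open>A\<close> twice
  gives the factor \<open>- frob_sq A / 4\<close>.\<close>

lemma frob_commutator_equality_aux:
  assumes X: "real_skew n X" and eq: "frob_sq (commutator A X) = frob_sq A * frob_sq X"
  shows "A * X + X * A = 0\<^sub>m n n" "A * (A * X) + complex_of_real (frob_sq A / 4) \<cdot>\<^sub>m X = 0\<^sub>m n n"
proof -
  have Xc: "X \<in> carrier_mat n n" using X by (rule real_skewD)
  let ?d = "\<lambda>i j. frob_sq A * (cmod (T X $$ (i, j)))\<^sup>2 - (\<theta> i + \<theta> j)\<^sup>2 * (cmod (T X $$ (i, j)))\<^sup>2"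
  have d0: "?d i j \<ge> 0" if "i < n" "j < n" for i j using skew_term[OF X that] by simp
  have "frob_sq A * frob_sq (T X) = frob_sq (commutator A X)" by (simp add: T_frob[OF Xc] eq)
  then have "(\<Sum>i<n. \<Sum>j<n. ?d i j) = 0"
    unfolding frob_commutator[OF Xc]
    using TC Xc by (simp add: frob_sq_entries[of "T X" n n] sum_distrib_left sum_subtractf)
  then have d: "?d i j = 0" if "i < n" "j < n" for i j
    using that d0 by (intro double_sum_nonneg_0[of "{..<n}" "{..<n}" ?d]) auto
  have supp: "T X $$ (i, j) = 0 \<or> \<theta> i = \<theta> j \<and> (\<theta> i)\<^sup>2 = frob_sq A / 4" if ij: "i < n" "j < n" for i j
  proof (cases "i = j")
    case True
    have "T X $$ (i, i) = - T X $$ (i, i)" using Tskew X ij unfolding real_skew_def by blast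
    then show ?thesis using True by simp
  next
    case False
    have "(frob_sq A - (\<theta> i + \<theta> j)\<^sup>2) * (cmod (T X $$ (i, j)))\<^sup>2 = 0"
      using d[OF ij] by (simp add: left_diff_distrib)
    then show ?thesis using pair_bound(2)[OF ij False] by auto
  qed
  have m: "A * X \<in> carrier_mat n n" "X * A \<in> carrier_mat n n" "A * (A * X) \<in> carrier_mat n n" using Xc Ac by auto
  show "A * X + X * A = 0\<^sub>m n n"
  proof (rule T_inj)
    fix i j assume ij: "i < n" "j < n"
    have "T (A * X + 1 \<cdot>\<^sub>m (X * A)) = T (A * X) + 1 \<cdot>\<^sub>m T (X * A)" using Tlin m by blast
    moreover have "1 \<cdot>\<^sub>m (X * A) = X * A" by (intro eq_matI) auto
    moreover have "T (A * X) \<in> carrier_mat n n" "T (X * A) \<in> carrier_mat n n" using TC m by auto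
    ultimately have "T (A * X + X * A) $$ (i, j) = T (A * X) $$ (i, j) + 1 * T (X * A) $$ (i, j)"
      using add_smult_entry ij by metis
    then show "T (A * X + X * A) $$ (i, j) = 0"
      using TA TA' Xc ij supp[OF ij] by auto
  qed (use m in auto)
  show "A * (A * X) + complex_of_real (frob_sq A / 4) \<cdot>\<^sub>m X = 0\<^sub>m n n"
  proof (rule T_inj)
    fix i j assume ij: "i < n" "j < n"
    let ?c = "complex_of_real (frob_sq A / 4)"
    have "T (A * (A * X) + ?c \<cdot>\<^sub>m X) = T (A * (A * X)) + ?c \<cdot>\<^sub>m T X" using Tlin m Xc by blast
    moreover have "T (A * (A * X)) \<in> carrier_mat n n" "T X \<in> carrier_mat n n" using TC m Xc by auto
    ultimately have "T (A * (A * X) + ?c \<cdot>\<^sub>m X) $$ (i, j) = T (A * (A * X)) $$ (i, j) + ?c * T X $$ (i, j)"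
      using add_smult_entry ij by metis
    also have "\<dots> = complex_of_real (frob_sq A / 4 - (\<theta> i)\<^sup>2) * T X $$ (i, j)"
      using TA m Xc ij by (simp add: algebra_simps power2_eq_square)
    also have "\<dots> = 0"
      using supp[OF ij] by (metis diff_self mult_zero_left mult_zero_right of_real_0)
    finally show "T (A * (A * X) + ?c \<cdot>\<^sub>m X) $$ (i, j) = 0" .
  qed (use m Xc in auto)
qed

text \<open>The weight \<open>w i j\<close> collects the squared moduli of the entries at
  \<open>(i, j)\<close> of all \<open>T (B \<beta>)\<close>, so the left-hand side is the sum of
  \<open>w i j * (\<theta> i + \<theta> j)^2\<close>. This weight is symmetric, zero on the diagonal
  and at most 1/2, so \<open>weighted_edge_bound\<close> applies to the indices of either sign; its
  total is \<open>card S\<close>.\<close>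

lemma sum_frob_commutator_le_aux:
  assumes S: "finite S" and B: "\<And>\<beta>. \<beta> \<in> S \<Longrightarrow> real_skew n (B \<beta>)"
    and on: "\<And>\<beta> \<gamma>. \<beta> \<in> S \<Longrightarrow> \<gamma> \<in> S \<Longrightarrow> fip (B \<beta>) (B \<gamma>) = (if \<beta> = \<gamma> then 1 else 0)"
  shows "(\<Sum>\<beta>\<in>S. frob_sq (commutator A (B \<beta>))) \<le> (card S / 2 + 1) * frob_sq A"
proof -
  have Bc: "B \<beta> \<in> carrier_mat n n" if "\<beta> \<in> S" for \<beta> using B[OF that] by (rule real_skewD)
  define w where "w i j = (if i < n \<and> j < n then \<Sum>\<beta>\<in>S. (cmod (T (B \<beta>) $$ (i, j)))\<^sup>2 else 0)" for i j
  have TB: "T (B \<beta>) $$ (j, i) = - T (B \<beta>) $$ (i, j)" if "\<beta> \<in> S" "i < n" "j < n" for \<beta> i j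
    using Tskew B[OF that(1)] that(2,3) unfolding real_skew_def by blast
  have w_sym: "w i j = w j i" for i j
  proof -
    have "(cmod (T (B \<beta>) $$ (i, j)))\<^sup>2 = (cmod (T (B \<beta>) $$ (j, i)))\<^sup>2" if "\<beta> \<in> S" "i < n" "j < n" for \<beta>
      using TB[OF that] by (metis norm_minus_cancel)
    then show ?thesis unfolding w_def by (auto intro!: sum.cong)
  qed
  have w_diag: "w i i = 0" for i
  proof -
    have "T (B \<beta>) $$ (i, i) = 0" if "\<beta> \<in> S" "i < n" for \<beta>
      using TB[OF that(1) that(2,2)] by simp
    then show ?thesis unfolding w_def by (auto intro!: sum.neutral)
  qed
  have w0: "w i j \<ge> 0" for i j by (simp add: w_def sum_nonneg)
  have w1: "w i j \<le> 1/2" for i j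
  proof (cases "i < n \<and> j < n \<and> i \<noteq> j")
    case True
    let ?K = "{..<n} \<times> {..<n}"
    \<comment> \<open>Bessel is applied to a skew matrix unit: by skew symmetry its inner product
      with \<open>T (B \<beta>)\<close> has twice the modulus of the entry, and its squared norm is
      2, hence \<open>4 * w i j <= 2\<close>.\<close>
    define F :: "nat \<times> nat \<Rightarrow> complex" where "F k = (if k = (i, j) then 1 else 0) - (if k = (j, i) then 1 else 0)" for k
    have K: "(i, j) \<in> ?K" "(j, i) \<in> ?K" using True by auto
    have Fs: "(\<Sum>k\<in>?K. F k * u k) = u (i, j) - u (j, i)" for u :: "nat \<times> nat \<Rightarrow> complex"
    proof -
      have "F k * u k = (if k = (i, j) then u k else 0) - (if k = (j, i) then u k else 0)" for k
        unfolding F_def left_diff_distrib by (rule arg_cong2[where f = minus]) simp_all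
      then show ?thesis using K by (simp only: sum_subtractf sum.delta finite_cartesian_product finite_lessThan if_True)
    qed
    have F2: "(\<Sum>k\<in>?K. (cmod (F k))\<^sup>2) = 2"
    proof -
      have "(cmod (F k))\<^sup>2 = (if k = (i, j) then 1 else 0) + (if k = (j, i) then 1 else 0)" for k
        unfolding F_def using True by (cases "k = (i, j)"; cases "k = (j, i)") simp_all
      then show ?thesis using K by (simp only: sum.distrib sum.delta finite_cartesian_product finite_lessThan if_True one_add_one)
    qed
    have "(\<Sum>\<beta>\<in>S. (cmod (\<Sum>k\<in>?K. F k * cnj (T (B \<beta>) $$ k)))\<^sup>2) \<le> (\<Sum>k\<in>?K. (cmod (F k))\<^sup>2)"
    proof (rule bessel[OF S])
      fix \<beta> \<gamma> assume s: "\<beta> \<in> S" "\<gamma> \<in> S"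
      have "(\<Sum>k\<in>?K. T (B \<beta>) $$ k * cnj (T (B \<gamma>) $$ k)) = fip (T (B \<beta>)) (T (B \<gamma>))"
        using TC Bc s by (simp add: fip_entries[of _ n n] sum.cartesian_product case_prod_unfold)
      then show "(\<Sum>k\<in>?K. T (B \<beta>) $$ k * cnj (T (B \<gamma>) $$ k)) = (if \<beta> = \<gamma> then 1 else 0)"
        using Tip Bc s on by simp
    qed
    moreover have "(cmod (\<Sum>k\<in>?K. F k * cnj (T (B \<beta>) $$ k)))\<^sup>2 = 4 * (cmod (T (B \<beta>) $$ (i, j)))\<^sup>2" if "\<beta> \<in> S" for \<beta>
    proof -
      have "(\<Sum>k\<in>?K. F k * cnj (T (B \<beta>) $$ k)) = 2 * cnj (T (B \<beta>) $$ (i, j))"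
        unfolding Fs using TB[OF that, of i j] True by simp
      then show ?thesis by (simp only: norm_mult power_mult_distrib complex_mod_cnj) simp
    qed
    ultimately show ?thesis using True by (simp add: F2 w_def sum_distrib_left[symmetric])
  qed (auto simp: w_diag, auto simp: w_def)
  let ?h = "frob_sq A / 2"
  let ?P = "{i. i < n \<and> 0 \<le> \<theta> i}" and ?N = "{i. i < n \<and> \<theta> i < 0}"
  have fin: "finite ?P" "finite ?N" by auto
  have split: "(\<Sum>i<n. \<Sum>j<n. f i j) = ((\<Sum>i\<in>?P. \<Sum>j\<in>?P. f i j) + (\<Sum>i\<in>?P. \<Sum>j\<in>?N. f i j)) +
      ((\<Sum>i\<in>?N. \<Sum>j\<in>?P. f i j) + (\<Sum>i\<in>?N. \<Sum>j\<in>?N. f i j))" for f :: "nat \<Rightarrow> nat \<Rightarrow> real"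
  proof -
    have u: "{..<n} = ?P \<union> ?N" and d: "?P \<inter> ?N = {}" by auto
    show ?thesis unfolding u sum.union_disjoint[OF fin d] sum.distrib by (simp only: add_ac)
  qed
  have total: "(\<Sum>i<n. \<Sum>j<n. w i j) = card S"
  proof -
    have "(\<Sum>i<n. \<Sum>j<n. w i j) = (\<Sum>i<n. \<Sum>\<beta>\<in>S. \<Sum>j<n. (cmod (T (B \<beta>) $$ (i, j)))\<^sup>2)"
      by (intro sum.cong refl) (simp add: w_def, rule sum.swap)
    also have "\<dots> = (\<Sum>\<beta>\<in>S. frob_sq (T (B \<beta>)))"
      using TC Bc by (subst sum.swap) (auto simp: frob_sq_entries[of _ n n] intro!: sum.cong)
    also have "\<dots> = (\<Sum>\<beta>\<in>S. 1)"
    proof (intro sum.cong refl)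
      fix \<beta> assume s: "\<beta> \<in> S"
      have "complex_of_real (frob_sq (B \<beta>)) = 1" using on[OF s s] by (simp add: fip_self)
      then show "frob_sq (T (B \<beta>)) = 1" using T_frob[OF Bc[OF s]] by simp
    qed
    finally show ?thesis by simp
  qed
  have "(\<Sum>\<beta>\<in>S. frob_sq (commutator A (B \<beta>))) =
      (\<Sum>\<beta>\<in>S. \<Sum>i<n. \<Sum>j<n. (\<theta> i + \<theta> j)\<^sup>2 * (cmod (T (B \<beta>) $$ (i, j)))\<^sup>2)"
    by (intro sum.cong refl frob_commutator Bc)
  also have "\<dots> = (\<Sum>i<n. \<Sum>\<beta>\<in>S. \<Sum>j<n. (\<theta> i + \<theta> j)\<^sup>2 * (cmod (T (B \<beta>) $$ (i, j)))\<^sup>2)"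
    by (rule sum.swap)
  also have "\<dots> = (\<Sum>i<n. \<Sum>j<n. w i j * (\<theta> i + \<theta> j)\<^sup>2)"
    by (intro sum.cong refl) (subst sum.swap, simp add: w_def sum_distrib_left mult.commute)
  \<comment> \<open>Each block of equal sign carries the extra 1 of the edge bound, the mixed blocks
    none. Both halves of the squared spectrum equal \<open>?h\<close>, so the total is
    \<open>(card S + 2) * ?h\<close>.\<close>
  also have "\<dots> \<le> ((\<Sum>i\<in>?P. \<Sum>j\<in>?P. w i j) + 1) * ?h + (\<Sum>i\<in>?P. \<Sum>j\<in>?N. w i j) * ?h +
      ((\<Sum>i\<in>?N. \<Sum>j\<in>?P. w i j) * ?h + ((\<Sum>i\<in>?N. \<Sum>j\<in>?N. w i j) + 1) * ?h)"
  proof -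
    have "(\<Sum>i\<in>?P. \<Sum>j\<in>?P. w i j * (\<theta> i + \<theta> j)\<^sup>2) \<le> ((\<Sum>i\<in>?P. \<Sum>j\<in>?P. w i j) + 1) * ?h"
      unfolding pos[symmetric] by (intro weighted_edge_bound w_sym w_diag w0 w1 fin)
    moreover have "(\<Sum>i\<in>?N. \<Sum>j\<in>?N. w i j * (\<theta> i + \<theta> j)\<^sup>2) \<le> ((\<Sum>i\<in>?N. \<Sum>j\<in>?N. w i j) + 1) * ?h"
      unfolding neg[symmetric] by (intro weighted_edge_bound w_sym w_diag w0 w1 fin)
    moreover have "(\<Sum>i\<in>?P. \<Sum>j\<in>?N. w i j * (\<theta> i + \<theta> j)\<^sup>2) \<le> (\<Sum>i\<in>?P. \<Sum>j\<in>?N. w i j) * ?h"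
      unfolding sum_distrib_right using mixed_sign w0 by (intro sum_mono mult_left_mono) auto
    moreover have "(\<Sum>i\<in>?N. \<Sum>j\<in>?P. w i j * (\<theta> i + \<theta> j)\<^sup>2) \<le> (\<Sum>i\<in>?N. \<Sum>j\<in>?P. w i j) * ?h"
    proof -
      have "(\<theta> i + \<theta> j)\<^sup>2 \<le> ?h" if "i \<in> ?N" "j \<in> ?P" for i j
        using mixed_sign[of j i] that by (simp add: add.commute)
      then show ?thesis unfolding sum_distrib_right by (intro sum_mono mult_left_mono w0)
    qed
    ultimately show ?thesis unfolding split by linarith
  qed
  also have "\<dots> = (real (card S) + 2) * ?h"
    unfolding total[symmetric] split by (simp add: algebra_simps)
  finally show ?thesis by (simp add: field_simps)
qed

end

lemma frob_commutator_le:
  assumes "real_skew n A" "real_skew n X"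
  shows "frob_sq (commutator A X) \<le> frob_sq A * frob_sq X"
  by (rule skew_eigenbasis[OF assms(1)]) (rule frob_commutator_le_aux[OF assms(1) _ _ _ _ _ _ _ _ assms(2)])

lemma frob_commutator_equality:
  assumes "real_skew n A" "real_skew n X" "frob_sq (commutator A X) = frob_sq A * frob_sq X"
  shows "A * X + X * A = 0\<^sub>m n n" "A * (A * X) + complex_of_real (frob_sq A / 4) \<cdot>\<^sub>m X = 0\<^sub>m n n"
proof -
  show "A * X + X * A = 0\<^sub>m n n"
    by (rule skew_eigenbasis[OF assms(1)]) (rule frob_commutator_equality_aux(1)[OF assms(1) _ _ _ _ _ _ _ _ assms(2,3)])
  show "A * (A * X) + complex_of_real (frob_sq A / 4) \<cdot>\<^sub>m X = 0\<^sub>m n n"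
    by (rule skew_eigenbasis[OF assms(1)]) (rule frob_commutator_equality_aux(2)[OF assms(1) _ _ _ _ _ _ _ _ assms(2,3)])
qed

lemma sum_frob_commutator_le:
  assumes "real_skew n A" "finite S" "\<And>\<beta>. \<beta> \<in> S \<Longrightarrow> real_skew n (B \<beta>)"
    and "\<And>\<beta> \<gamma>. \<beta> \<in> S \<Longrightarrow> \<gamma> \<in> S \<Longrightarrow> fip (B \<beta>) (B \<gamma>) = (if \<beta> = \<gamma> then 1 else 0)"
  shows "(\<Sum>\<beta>\<in>S. frob_sq (commutator A (B \<beta>))) \<le> (card S / 2 + 1) * frob_sq A"
  by (rule skew_eigenbasis[OF assms(1)]) (rule sum_frob_commutator_le_aux[OF assms(1) _ _ _ _ _ _ _ _ assms(2-4)])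

subsection \<open>Orthogonal changes of tuples\<close>

definition real_orthonormal :: "nat \<Rightarrow> nat \<Rightarrow> (nat \<Rightarrow> nat \<Rightarrow> real) \<Rightarrow> bool" where
  "real_orthonormal k q \<rho> \<longleftrightarrow> (\<forall>i<q. \<forall>j<q. (\<Sum>t<k. \<rho> i t * \<rho> j t) = (if i = j then 1 else 0))"

lemma real_orthonormal_iff: "real_orthonormal k q \<rho> \<longleftrightarrow> orthonormal k q (\<lambda>i t. complex_of_real (\<rho> i t))"
proof -
  have "hdot k (\<lambda>t. complex_of_real (\<rho> i t)) (\<lambda>t. complex_of_real (\<rho> j t)) = (if i = j then 1 else 0)
      \<longleftrightarrow> (\<Sum>t<k. \<rho> i t * \<rho> j t) = (if i = j then 1 else 0)" for i j
  proof -
    have "hdot k (\<lambda>t. complex_of_real (\<rho> i t)) (\<lambda>t. complex_of_real (\<rho> j t)) = complex_of_real (\<Sum>t<k. \<rho> i t * \<rho> j t)"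
      by (simp add: hdot_def)
    moreover have "(if i = j then 1 else 0) = complex_of_real (if i = j then 1 else 0)" by simp
    ultimately show ?thesis by (simp only: of_real_eq_iff)
  qed
  then show ?thesis by (simp add: real_orthonormal_def orthonormal_def)
qed

lemma real_orthonormal_Re:
  assumes "orthonormal k q z" "\<forall>i<q. \<forall>t. z i t \<in> \<real>"
  shows "real_orthonormal k q (\<lambda>i t. Re (z i t))"
proof -
  have "complex_of_real (Re (z i t)) = z i t" if "i < q" for i t
    using assms(2) that by (simp add: of_real_Re)
  then show ?thesis
    using assms(1) unfolding real_orthonormal_iff orthonormal_def by simp
qed

lemma real_orthonormal_extend:
  assumes "real_orthonormal k q \<rho>" "q \<le> k"
  obtains \<rho>' where "real_orthonormal k k \<rho>'" "\<forall>i<q. \<rho>' i = \<rho> i"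
proof -
  obtain g where g: "orthonormal k k g" "\<forall>i<q. g i = (\<lambda>t. complex_of_real (\<rho> i t))" "\<forall>i<k. \<forall>t. g i t \<in> \<real>"
    by (rule orthonormal_extend[of \<real> k q "\<lambda>i t. complex_of_real (\<rho> i t)"]) (use assms in \<open>auto simp: real_orthonormal_iff\<close>)
  show ?thesis
    by (rule that[OF real_orthonormal_Re[OF g(1,3)]]) (use g(2) in auto)
qed

lemma real_orthonormal_complete:
  assumes "real_orthonormal k k \<rho>" "s < k" "t < k"
  shows "(\<Sum>l<k. \<rho> l s * \<rho> l t) = (if s = t then 1 else 0)"
proof -
  have "complex_of_real (\<Sum>l<k. \<rho> l s * \<rho> l t) = complex_of_real (if s = t then 1 else 0)"
    using orthonormal_complete[OF assms(1)[unfolded real_orthonormal_iff] assms(2,3)] by simp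
  then show ?thesis by (simp only: of_real_eq_iff)
qed

text \<open>With \<open>c j = R $$ (j, l)\<close> this is the shape of entry \<open>l\<close> of the
  group action, so that results on orthogonal changes of a tuple apply to
  \<open>K_act\<close>.\<close>

definition comb :: "nat \<Rightarrow> nat \<Rightarrow> (nat \<Rightarrow> real) \<Rightarrow> (nat \<Rightarrow> complex mat) \<Rightarrow> complex mat" where
  "comb n k c A = mat_sum n (\<lambda>j. complex_of_real (c j) \<cdot>\<^sub>m A j) {..<k}"

lemma comb_carrier [simp]: "comb n k c A \<in> carrier_mat n n"
  by (simp add: comb_def mat_sum_def)

lemma comb_dim [simp]: "dim_row (comb n k c A) = n" "dim_col (comb n k c A) = n"
  by (simp_all add: comb_def mat_sum_def)

lemma comb_entry:
  assumes "\<And>j. j < k \<Longrightarrow> A j \<in> carrier_mat n n" "a < n" "b < n"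
  shows "comb n k c A $$ (a, b) = (\<Sum>j<k. complex_of_real (c j) * A j $$ (a, b))"
proof -
  have "(complex_of_real (c j) \<cdot>\<^sub>m A j) $$ (a, b) = complex_of_real (c j) * A j $$ (a, b)" if "j < k" for j
    using carrier_matD[OF assms(1)[OF that]] assms(2,3) by simp
  then show ?thesis using assms(2,3) by (simp add: comb_def mat_sum_def)
qed

lemma comb_cong: "(\<And>j. j < k \<Longrightarrow> c j = d j) \<Longrightarrow> (\<And>j. j < k \<Longrightarrow> A j = B j) \<Longrightarrow> comb n k c A = comb n k d B"
  by (simp add: comb_def mat_sum_def)

lemma comb_mult_right:
  assumes A: "\<And>j. j < k \<Longrightarrow> A j \<in> carrier_mat n n" and X: "X \<in> carrier_mat n n"
  shows "comb n k c A * X = comb n k c (\<lambda>j. A j * X)"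
proof (intro eq_matI)
  fix a b assume "a < dim_row (comb n k c (\<lambda>j. A j * X))" "b < dim_col (comb n k c (\<lambda>j. A j * X))"
  then have ab: "a < n" "b < n" by simp_all
  have "(comb n k c A * X) $$ (a, b) = (\<Sum>t<n. \<Sum>j<k. complex_of_real (c j) * (A j $$ (a, t) * X $$ (t, b)))"
    using ab by (simp add: mat_mult_entry[OF comb_carrier X] comb_entry[OF A] sum_distrib_right mult.assoc del: index_mult_mat(1))
  also have "\<dots> = (\<Sum>j<k. \<Sum>t<n. complex_of_real (c j) * (A j $$ (a, t) * X $$ (t, b)))"
    by (rule sum.swap)
  also have "\<dots> = (\<Sum>j<k. complex_of_real (c j) * (A j * X) $$ (a, b))"
    using ab by (intro sum.cong refl) (simp add: mat_mult_entry[OF A X] sum_distrib_left del: index_mult_mat(1))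
  also have "\<dots> = comb n k c (\<lambda>j. A j * X) $$ (a, b)"
    using ab A X by (intro comb_entry[symmetric]) auto
  finally show "(comb n k c A * X) $$ (a, b) = comb n k c (\<lambda>j. A j * X) $$ (a, b)" .
qed (use X in auto)

lemma comb_mult_left:
  assumes A: "\<And>j. j < k \<Longrightarrow> A j \<in> carrier_mat n n" and X: "X \<in> carrier_mat n n"
  shows "X * comb n k c A = comb n k c (\<lambda>j. X * A j)"
proof (intro eq_matI)
  fix a b assume "a < dim_row (comb n k c (\<lambda>j. X * A j))" "b < dim_col (comb n k c (\<lambda>j. X * A j))"
  then have ab: "a < n" "b < n" by simp_all
  have "(X * comb n k c A) $$ (a, b) = (\<Sum>t<n. \<Sum>j<k. complex_of_real (c j) * (X $$ (a, t) * A j $$ (t, b)))"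
    using ab by (simp add: mat_mult_entry[OF X comb_carrier] comb_entry[OF A] sum_distrib_left mult.left_commute del: index_mult_mat(1))
  also have "\<dots> = (\<Sum>j<k. \<Sum>t<n. complex_of_real (c j) * (X $$ (a, t) * A j $$ (t, b)))"
    by (rule sum.swap)
  also have "\<dots> = (\<Sum>j<k. complex_of_real (c j) * (X * A j) $$ (a, b))"
    using ab by (intro sum.cong refl) (simp add: mat_mult_entry[OF X A] sum_distrib_left del: index_mult_mat(1))
  also have "\<dots> = comb n k c (\<lambda>j. X * A j) $$ (a, b)"
    using ab A X by (intro comb_entry[symmetric]) auto
  finally show "(X * comb n k c A) $$ (a, b) = comb n k c (\<lambda>j. X * A j) $$ (a, b)" .
qed (use X in auto)

lemma comb_diff:
  assumes A: "\<And>j. j < k \<Longrightarrow> A j \<in> carrier_mat n n" and B: "\<And>j. j < k \<Longrightarrow> B j \<in> carrier_mat n n"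
  shows "comb n k c A - comb n k c B = comb n k c (\<lambda>j. A j - B j)"
proof (intro eq_matI)
  fix a b assume "a < dim_row (comb n k c (\<lambda>j. A j - B j))" "b < dim_col (comb n k c (\<lambda>j. A j - B j))"
  then have ab: "a < n" "b < n" by simp_all
  have "(comb n k c A - comb n k c B) $$ (a, b) = (\<Sum>j<k. complex_of_real (c j) * (A j $$ (a, b) - B j $$ (a, b)))"
    using ab by (simp add: comb_entry[OF A] comb_entry[OF B] sum_subtractf right_diff_distrib)
  also have "\<dots> = (\<Sum>j<k. complex_of_real (c j) * (A j - B j) $$ (a, b))"
  proof (intro sum.cong refl)
    fix j assume "j \<in> {..<k}"
    then have "j < k" by simp
    then show "complex_of_real (c j) * (A j $$ (a, b) - B j $$ (a, b)) = complex_of_real (c j) * (A j - B j) $$ (a, b)"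
      using ab carrier_matD[OF B] by simp
  qed
  also have "\<dots> = comb n k c (\<lambda>j. A j - B j) $$ (a, b)"
    using ab A B by (intro comb_entry[symmetric]) (auto intro: minus_carrier_mat)
  finally show "(comb n k c A - comb n k c B) $$ (a, b) = comb n k c (\<lambda>j. A j - B j) $$ (a, b)" .
qed auto

lemma commutator_comb:
  assumes A: "\<And>j. j < k \<Longrightarrow> A j \<in> carrier_mat n n" and X: "X \<in> carrier_mat n n"
  shows "commutator (comb n k c A) X = comb n k c (\<lambda>j. commutator (A j) X)"
    and "commutator X (comb n k c A) = comb n k c (\<lambda>j. commutator X (A j))"
proof -
  have r: "comb n k c A * X = comb n k c (\<lambda>j. A j * X)" by (rule comb_mult_right[OF A X])
  have l: "X * comb n k c A = comb n k c (\<lambda>j. X * A j)" by (rule comb_mult_left[OF A X])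
  show "commutator (comb n k c A) X = comb n k c (\<lambda>j. commutator (A j) X)"
    unfolding commutator_def r l by (rule comb_diff) (use A X in auto)
  show "commutator X (comb n k c A) = comb n k c (\<lambda>j. commutator X (A j))"
    unfolding commutator_def r l by (rule comb_diff) (use A X in auto)
qed

lemma fip_commute:
  assumes "X \<in> carrier_mat n m" "Y \<in> carrier_mat n m"
  shows "fip X Y = cnj (fip Y X)"
  using assms by (simp add: fip_entries[of _ n m] mult.commute)

lemma fip_comb_left:
  assumes A: "\<And>j. j < k \<Longrightarrow> A j \<in> carrier_mat n n" and Y: "Y \<in> carrier_mat n n"
  shows "fip (comb n k c A) Y = (\<Sum>j<k. complex_of_real (c j) * fip (A j) Y)"
proof -
  have "fip (comb n k c A) Y = (\<Sum>a<n. \<Sum>b<n. \<Sum>j<k. complex_of_real (c j) * (A j $$ (a, b) * cnj (Y $$ (a, b))))"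
    by (simp add: fip_entries[OF comb_carrier Y] comb_entry[OF A] sum_distrib_right mult.assoc)
  also have "\<dots> = (\<Sum>a<n. \<Sum>j<k. \<Sum>b<n. complex_of_real (c j) * (A j $$ (a, b) * cnj (Y $$ (a, b))))"
    by (rule sum.cong[OF refl], rule sum.swap)
  also have "\<dots> = (\<Sum>j<k. \<Sum>a<n. \<Sum>b<n. complex_of_real (c j) * (A j $$ (a, b) * cnj (Y $$ (a, b))))"
    by (rule sum.swap)
  also have "\<dots> = (\<Sum>j<k. complex_of_real (c j) * fip (A j) Y)"
    by (intro sum.cong refl) (simp add: fip_entries[OF A Y] sum_distrib_left)
  finally show ?thesis .
qed

lemma fip_comb_right:
  assumes A: "\<And>j. j < k \<Longrightarrow> A j \<in> carrier_mat n n" and Y: "Y \<in> carrier_mat n n"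
  shows "fip Y (comb n k c A) = (\<Sum>j<k. complex_of_real (c j) * fip Y (A j))"
proof -
  have "fip Y (comb n k c A) = cnj (\<Sum>j<k. complex_of_real (c j) * fip (A j) Y)"
    by (subst fip_comb_left[OF A Y, symmetric]) (auto intro: fip_commute[OF Y comb_carrier])
  also have "\<dots> = (\<Sum>j<k. complex_of_real (c j) * cnj (fip (A j) Y))" by simp
  also have "\<dots> = (\<Sum>j<k. complex_of_real (c j) * fip Y (A j))"
  proof (intro sum.cong refl)
    fix j assume "j \<in> {..<k}"
    then show "complex_of_real (c j) * cnj (fip (A j) Y) = complex_of_real (c j) * fip Y (A j)"
      using fip_commute[OF Y A, of j] by simp
  qed
  finally show ?thesis .
qed

lemma frob_comb:
  assumes X: "\<And>j. j < k \<Longrightarrow> X j \<in> carrier_mat n n"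
  shows "complex_of_real (frob_sq (comb n k c X)) = (\<Sum>s<k. \<Sum>t<k. complex_of_real (c s * c t) * fip (X s) (X t))"
proof -
  have "complex_of_real (frob_sq (comb n k c X)) = (\<Sum>s<k. complex_of_real (c s) * fip (X s) (comb n k c X))"
    unfolding fip_self[symmetric] by (rule fip_comb_left[OF X comb_carrier])
  also have "\<dots> = (\<Sum>s<k. \<Sum>t<k. complex_of_real (c s * c t) * fip (X s) (X t))"
  proof (intro sum.cong refl)
    fix s assume "s \<in> {..<k}"
    then have "fip (X s) (comb n k c X) = (\<Sum>t<k. complex_of_real (c t) * fip (X s) (X t))"
      by (intro fip_comb_right X) auto
    then show "complex_of_real (c s) * fip (X s) (comb n k c X) =
        (\<Sum>t<k. complex_of_real (c s * c t) * fip (X s) (X t))"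
      by (simp add: sum_distrib_left mult.assoc)
  qed
  finally show ?thesis .
qed

text \<open>Expanding the norms gives the Gram matrix of \<open>X\<close> weighted by inner products
  of the columns of \<rho>, and these columns are orthonormal as well as the rows.\<close>

lemma sum_frob_comb:
  assumes \<rho>: "real_orthonormal k k \<rho>" and X: "\<And>j. j < k \<Longrightarrow> X j \<in> carrier_mat n n"
  shows "(\<Sum>l<k. frob_sq (comb n k (\<rho> l) X)) = (\<Sum>j<k. frob_sq (X j))"
proof -
  have "complex_of_real (\<Sum>l<k. frob_sq (comb n k (\<rho> l) X)) =
      (\<Sum>l<k. \<Sum>s<k. \<Sum>t<k. complex_of_real (\<rho> l s * \<rho> l t) * fip (X s) (X t))"
    by (simp add: frob_comb[OF X] del: of_real_mult)
  also have "\<dots> = (\<Sum>s<k. \<Sum>l<k. \<Sum>t<k. complex_of_real (\<rho> l s * \<rho> l t) * fip (X s) (X t))"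
    by (rule sum.swap)
  also have "\<dots> = (\<Sum>s<k. \<Sum>t<k. \<Sum>l<k. complex_of_real (\<rho> l s * \<rho> l t) * fip (X s) (X t))"
    by (rule sum.cong[OF refl], rule sum.swap)
  also have "\<dots> = (\<Sum>s<k. \<Sum>t<k. complex_of_real (\<Sum>l<k. \<rho> l s * \<rho> l t) * fip (X s) (X t))"
    by (simp only: of_real_sum sum_distrib_right)
  also have "\<dots> = (\<Sum>s<k. \<Sum>t<k. if s = t then fip (X s) (X t) else 0)"
    by (intro sum.cong refl) (simp add: real_orthonormal_complete[OF \<rho>])
  also have "\<dots> = complex_of_real (\<Sum>j<k. frob_sq (X j))"
    by (simp add: fip_self)
  finally show ?thesis by (simp only: of_real_eq_iff)
qed

text \<open>The commutator is linear in each slot, so the invariance of the sum of squared norms is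
  used once per slot.\<close>

lemma sum_commutator_comb:
  assumes \<rho>: "real_orthonormal k k \<rho>" and X: "\<And>j. j < k \<Longrightarrow> X j \<in> carrier_mat n n"
  shows "(\<Sum>l<k. \<Sum>p<k. frob_sq (commutator (comb n k (\<rho> l) X) (comb n k (\<rho> p) X))) =
    (\<Sum>i<k. \<Sum>j<k. frob_sq (commutator (X i) (X j)))"
proof -
  have "(\<Sum>l<k. \<Sum>p<k. frob_sq (commutator (comb n k (\<rho> l) X) (comb n k (\<rho> p) X))) =
      (\<Sum>l<k. \<Sum>j<k. frob_sq (commutator (comb n k (\<rho> l) X) (X j)))"
  proof (rule sum.cong[OF refl])
    fix l
    have "(\<Sum>p<k. frob_sq (comb n k (\<rho> p) (\<lambda>j. commutator (comb n k (\<rho> l) X) (X j)))) =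
        (\<Sum>j<k. frob_sq (commutator (comb n k (\<rho> l) X) (X j)))"
      using X by (intro sum_frob_comb[OF \<rho>]) simp
    moreover have "commutator (comb n k (\<rho> l) X) (comb n k (\<rho> p) X) =
        comb n k (\<rho> p) (\<lambda>j. commutator (comb n k (\<rho> l) X) (X j))" for p
      by (rule commutator_comb(2)[OF X comb_carrier])
    ultimately show "(\<Sum>p<k. frob_sq (commutator (comb n k (\<rho> l) X) (comb n k (\<rho> p) X))) =
        (\<Sum>j<k. frob_sq (commutator (comb n k (\<rho> l) X) (X j)))" by simp
  qed
  also have "\<dots> = (\<Sum>j<k. \<Sum>l<k. frob_sq (comb n k (\<rho> l) (\<lambda>i. commutator (X i) (X j))))"
  proof (subst sum.swap, intro sum.cong[OF refl])
    fix j l assume "j \<in> {..<k}"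
    then have "commutator (comb n k (\<rho> l) X) (X j) = comb n k (\<rho> l) (\<lambda>i. commutator (X i) (X j))"
      by (intro commutator_comb(1) X) auto
    then show "frob_sq (commutator (comb n k (\<rho> l) X) (X j)) = frob_sq (comb n k (\<rho> l) (\<lambda>i. commutator (X i) (X j)))"
      by simp
  qed
  also have "\<dots> = (\<Sum>j<k. \<Sum>i<k. frob_sq (commutator (X i) (X j)))"
  proof (rule sum.cong[OF refl])
    fix j assume "j \<in> {..<k}"
    then show "(\<Sum>l<k. frob_sq (comb n k (\<rho> l) (\<lambda>i. commutator (X i) (X j)))) = (\<Sum>i<k. frob_sq (commutator (X i) (X j)))"
      using X by (intro sum_frob_comb[OF \<rho>]) simp
  qed
  also have "\<dots> = (\<Sum>i<k. \<Sum>j<k. frob_sq (commutator (X i) (X j)))" by (rule sum.swap)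
  finally show ?thesis .
qed

lemma real_skewI:
  assumes "A \<in> carrier_mat n n" "\<And>i j. i < n \<Longrightarrow> j < n \<Longrightarrow> A $$ (j, i) = - A $$ (i, j)"
    "\<And>i j. i < n \<Longrightarrow> j < n \<Longrightarrow> cnj (A $$ (i, j)) = A $$ (i, j)"
  shows "real_skew n A"
proof -
  have d: "dim_row A = n" "dim_col A = n" using assms(1) by auto
  have "transpose_mat A = - A"
  proof (rule eq_matI)
    fix i j assume "i < dim_row (- A)" "j < dim_col (- A)"
    then have ij: "i < n" "j < n" using d by simp_all
    have "transpose_mat A $$ (i, j) = A $$ (j, i)" using ij d by simp
    also have "\<dots> = - A $$ (i, j)" by (rule assms(2)[OF ij])
    finally show "transpose_mat A $$ (i, j) = (- A) $$ (i, j)" using ij d by simp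
  qed (use d in simp_all)
  moreover have "mat_cnj A = A"
    using assms(3) d by (intro eq_matI) auto
  ultimately show ?thesis using assms(1) by (simp add: real_skew_def)
qed

lemma real_skew_comb:
  assumes A: "\<And>j. j < k \<Longrightarrow> real_skew n (A j)"
  shows "real_skew n (comb n k c A)"
proof (rule real_skewI)
  have Ac: "\<And>j. j < k \<Longrightarrow> A j \<in> carrier_mat n n" using A by (rule real_skewD)
  fix a b assume ab: "a < n" "b < n"
  have "(\<Sum>j<k. complex_of_real (c j) * A j $$ (b, a)) = (\<Sum>j<k. - (complex_of_real (c j) * A j $$ (a, b)))"
  proof (intro sum.cong refl)
    fix j assume "j \<in> {..<k}"
    then show "complex_of_real (c j) * A j $$ (b, a) = - (complex_of_real (c j) * A j $$ (a, b))"
      using real_skewD(2)[OF A ab, of j] by simp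
  qed
  then show "comb n k c A $$ (b, a) = - comb n k c A $$ (a, b)"
    by (simp only: comb_entry[OF Ac ab] comb_entry[OF Ac ab(2,1)] sum_negf)
  show "cnj (comb n k c A $$ (a, b)) = comb n k c A $$ (a, b)"
    using real_skewD(3)[OF A ab] by (simp add: comb_entry[OF Ac ab])
qed simp

lemma frob_sq_smult: "X \<in> carrier_mat n m \<Longrightarrow> frob_sq (c \<cdot>\<^sub>m X) = (cmod c)\<^sup>2 * frob_sq X"
  by (simp add: frob_sq_entries[of _ n m] norm_mult power_mult_distrib sum_distrib_left)

lemma commutator_smult_right:
  assumes "X \<in> carrier_mat n n" "Y \<in> carrier_mat n n"
  shows "commutator X (c \<cdot>\<^sub>m Y) = c \<cdot>\<^sub>m commutator X Y"
  using assms by (intro eq_matI)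
    (auto simp: commutator_def mult_smult_distrib[of _ n n] mult_smult_assoc_mat[of _ n n] right_diff_distrib)

lemma frob_commutator_sym:
  assumes "X \<in> carrier_mat n n" "Y \<in> carrier_mat n n"
  shows "frob_sq (commutator X Y) = frob_sq (commutator Y X)"
proof -
  have "commutator X Y = (-1) \<cdot>\<^sub>m commutator Y X"
    using assms by (intro eq_matI) (auto simp: commutator_def)
  then show ?thesis
    using assms by (simp add: frob_sq_smult[of _ n n])
qed

lemma frob_commutator_self: "frob_sq (commutator X X) = 0"
proof -
  have "commutator X X = 0\<^sub>m (dim_row X) (dim_col X)"
    by (intro eq_matI) (auto simp: commutator_def)
  then show ?thesis by simp
qed

lemma real_skew_smult:
  assumes "real_skew n X" shows "real_skew n (complex_of_real c \<cdot>\<^sub>m X)"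
proof (rule real_skewI)
  note d = carrier_matD[OF real_skewD(1)[OF assms]]
  fix i j assume ij: "i < n" "j < n"
  show "(complex_of_real c \<cdot>\<^sub>m X) $$ (j, i) = - (complex_of_real c \<cdot>\<^sub>m X) $$ (i, j)"
    using real_skewD(2)[OF assms ij] ij d by simp
  show "cnj ((complex_of_real c \<cdot>\<^sub>m X) $$ (i, j)) = (complex_of_real c \<cdot>\<^sub>m X) $$ (i, j)"
    using real_skewD(3)[OF assms ij] ij d by simp
qed (use real_skewD(1)[OF assms] in simp)

lemma fip_smult:
  assumes "X \<in> carrier_mat n n" "Y \<in> carrier_mat n n"
  shows "fip (c \<cdot>\<^sub>m X) (d \<cdot>\<^sub>m Y) = c * cnj d * fip X Y"
  using assms by (simp add: fip_entries[of _ n n] sum_distrib_left mult_ac)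

text \<open>The Gram matrix of the tuple is real symmetric; a real orthonormal eigenbasis of it
  supplies the coefficients.\<close>

lemma orthogonal_comb:
  assumes A: "\<And>j. j < k \<Longrightarrow> real_skew n (A j)"
  obtains \<rho> where "real_orthonormal k k \<rho>"
    "\<forall>l<k. \<forall>p<k. l \<noteq> p \<longrightarrow> fip (comb n k (\<rho> l) A) (comb n k (\<rho> p) A) = 0"
proof -
  have Ac: "\<And>j. j < k \<Longrightarrow> A j \<in> carrier_mat n n" using A by (rule real_skewD)
  define H where "H a b = fip (A a) (A b)" for a b
  have herm: "H b a = cnj (H a b)" if "a < k" "b < k" for a b
    unfolding H_def using fip_commute[OF Ac Ac] that by blast
  have real: "H a b \<in> \<real>" if "a < k" "b < k" for a b
  proof -
    have "A a $$ (i, j) \<in> \<real>" "A b $$ (i, j) \<in> \<real>" if "i < n" "j < n" for i j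
      using real_skewD(3)[OF A] that \<open>a < k\<close> \<open>b < k\<close> by (auto simp: Reals_cnj_iff)
    then show ?thesis
      unfolding H_def fip_entries[OF Ac[OF that(1)] Ac[OF that(2)]]
      by (intro sum_in_Reals Reals_mult) (auto simp: Reals_cnj_iff)
  qed
  obtain z and \<theta> :: "nat \<Rightarrow> real" where z: "orthonormal k k z" "\<forall>i<k. \<forall>t. z i t \<in> \<real>"
    and ev: "\<forall>i<k. \<forall>a<k. (\<Sum>b<k. H a b * z i b) = complex_of_real (\<theta> i) * z i a"
    by (rule hermitian_spectral[of \<real> k H, OF _ herm real]) auto
  define \<rho> where "\<rho> i t = Re (z i t)" for i t
  have \<rho>z: "complex_of_real (\<rho> i t) = z i t" if "i < k" for i t
    using z(2) that by (simp add: \<rho>_def of_real_Re)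
  show ?thesis
  proof (rule that)
    show ron: "real_orthonormal k k \<rho>"
      unfolding \<rho>_def by (rule real_orthonormal_Re[OF z])
    show "\<forall>l<k. \<forall>p<k. l \<noteq> p \<longrightarrow> fip (comb n k (\<rho> l) A) (comb n k (\<rho> p) A) = 0"
    proof (intro allI impI)
      fix l p assume lp: "l < k" "p < k" "l \<noteq> p"
      have "fip (comb n k (\<rho> l) A) (comb n k (\<rho> p) A) = (\<Sum>s<k. z l s * (\<Sum>t<k. H s t * z p t))"
      proof -
        have "fip (A s) (comb n k (\<rho> p) A) = (\<Sum>t<k. H s t * z p t)" if "s < k" for s
          by (subst fip_comb_right[OF Ac Ac[OF that]]) (simp_all add: \<rho>z lp H_def mult.commute)
        then show ?thesis
          by (subst fip_comb_left[OF Ac comb_carrier]) (simp_all add: \<rho>z lp)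
      qed
      also have "\<dots> = complex_of_real (\<theta> p) * (\<Sum>s<k. z l s * z p s)"
        using ev lp by (simp add: sum_distrib_left mult.left_commute)
      also have "(\<Sum>s<k. z l s * z p s) = complex_of_real (\<Sum>s<k. \<rho> l s * \<rho> p s)"
        by (simp add: \<rho>z lp)
      also have "\<dots> = 0"
        using ron lp by (simp add: real_orthonormal_def del: of_real_sum)
      finally show "fip (comb n k (\<rho> l) A) (comb n k (\<rho> p) A) = 0" by simp
    qed
  qed
qed

subsection \<open>The inequality for real skew-symmetric tuples\<close>

context
  fixes n k :: nat and A :: "nat \<Rightarrow> complex mat"
  assumes A: "\<And>j. j < k \<Longrightarrow> real_skew n (A j)"
    and orth: "\<And>l p. l < k \<Longrightarrow> p < k \<Longrightarrow> l \<noteq> p \<Longrightarrow> fip (A l) (A p) = 0"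
begin

text \<open>Zero matrices are left out, because the ratios divide by the norms.\<close>

private definition "active = {l. l < k \<and> frob_sq (A l) \<noteq> 0}"
text \<open>The value is 0 off \<open>active\<close>, since the quadratic form lemmas ask for
  symmetry at all indices.\<close>

private definition "ratio l p = (if l \<in> active \<and> p \<in> active then frob_sq (commutator (A l) (A p)) / (frob_sq (A l) * frob_sq (A p)) else 0)"

private lemma A_carrier: "j < k \<Longrightarrow> A j \<in> carrier_mat n n" using A by (rule real_skewD)

private lemma active: "finite active" "\<And>l. l \<in> active \<Longrightarrow> l < k" "\<And>l. l \<in> active \<Longrightarrow> frob_sq (A l) > 0"
  using frob_sq_nonneg by (auto simp: active_def order.strict_iff_order)

private lemma ratio_sym: "ratio i j = ratio j i"
proof (cases "i \<in> active \<and> j \<in> active")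
  case True
  then show ?thesis
    using frob_commutator_sym[OF A_carrier A_carrier, of i j] active(2) by (simp add: ratio_def mult.commute)
qed (auto simp: ratio_def)

private lemma ratio_diag: "ratio i i = 0"
  by (simp add: ratio_def frob_commutator_self)

private lemma ratio_le1: "ratio i j \<le> 1" if "i \<in> active" "j \<in> active"
  using frob_commutator_le[OF A A] active that by (simp add: ratio_def)

text \<open>Division by the norms makes the orthogonal family orthonormal, as
  \<open>sum_frob_commutator_le\<close> requires.\<close>

private lemma ratio_row:
  assumes i: "i \<in> active" and T: "T \<subseteq> active"
  shows "(\<Sum>j\<in>T. ratio i j) \<le> card T / 2 + 1"
proof -
  define B where "B j = complex_of_real (1 / sqrt (frob_sq (A j))) \<cdot>\<^sub>m A j" for j
  have fT: "finite T" using active(1) T finite_subset by blast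
  have pos: "frob_sq (A j) > 0" "j < k" if "j \<in> T" for j using that T active by auto
  have "(\<Sum>j\<in>T. frob_sq (commutator (A i) (B j))) \<le> (card T / 2 + 1) * frob_sq (A i)"
  proof (rule sum_frob_commutator_le[OF A fT])
    show "i < k" using i active by simp
    show "real_skew n (B j)" if "j \<in> T" for j
      unfolding B_def by (intro real_skew_smult A pos that)
    show "fip (B j) (B l) = (if j = l then 1 else 0)" if jl: "j \<in> T" "l \<in> T" for j l
    proof (cases "j = l")
      case True
      have "frob_sq (B l) = (1 / sqrt (frob_sq (A l)))\<^sup>2 * frob_sq (A l)"
        unfolding B_def using frob_sq_nonneg
        by (subst frob_sq_smult[OF A_carrier[OF pos(2)[OF jl(2)]]]) (simp add: norm_divide power_divide)
      also have "\<dots> = 1" using pos(1)[OF jl(2)] by (simp add: power_divide)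
      finally show ?thesis using True by (simp add: fip_self)
    next
      case False
      then show ?thesis using jl pos orth by (simp add: B_def fip_smult[OF A_carrier A_carrier])
    qed
  qed
  moreover have "frob_sq (commutator (A i) (B j)) = frob_sq (A i) * ratio i j" if "j \<in> T" for j
  proof -
    have "frob_sq (commutator (A i) (B j)) = (1 / sqrt (frob_sq (A j)))\<^sup>2 * frob_sq (commutator (A i) (A j))"
      unfolding B_def commutator_smult_right[OF A_carrier A_carrier, OF active(2)[OF i] pos(2)[OF that]]
      using A_carrier[OF active(2)[OF i]] A_carrier[OF pos(2)[OF that]] pos(1)[OF that]
      by (subst frob_sq_smult[of _ n n]) (auto simp: norm_divide power_divide)
    then show ?thesis
      using pos(1)[OF that] active(3)[OF i] i that T by (auto simp: ratio_def power_divide)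
  qed
  ultimately have "frob_sq (A i) * (\<Sum>j\<in>T. ratio i j) \<le> frob_sq (A i) * (card T / 2 + 1)"
    by (simp add: sum_distrib_left mult.commute)
  then show ?thesis using active(3)[OF i] by simp
qed

private lemma sum_active:
  "(\<Sum>j\<in>active. frob_sq (A j)) = (\<Sum>j<k. frob_sq (A j))"
  "(\<Sum>i\<in>active. \<Sum>j\<in>active. ratio i j * (frob_sq (A i) * frob_sq (A j))) = (\<Sum>i<k. \<Sum>j<k. frob_sq (commutator (A i) (A j)))"
proof -
  show "(\<Sum>j\<in>active. frob_sq (A j)) = (\<Sum>j<k. frob_sq (A j))"
    by (intro sum.mono_neutral_left) (auto simp: active_def)
  \<comment> \<open>Commutators with a matrix of norm 0 vanish, by the pairwise estimate.\<close>
  have out: "frob_sq (commutator (A i) (A j)) = 0" if "i < k" "j < k" "i \<notin> active \<or> j \<notin> active" for i j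
    using frob_commutator_le[OF A A, of i j] frob_sq_nonneg[of "commutator (A i) (A j)"] that
    by (auto simp: active_def)
  have "(\<Sum>i\<in>active. \<Sum>j\<in>active. ratio i j * (frob_sq (A i) * frob_sq (A j))) = (\<Sum>i\<in>active. \<Sum>j\<in>active. frob_sq (commutator (A i) (A j)))"
    by (intro sum.cong refl) (auto simp: ratio_def active_def)
  also have "\<dots> = (\<Sum>i\<in>active. \<Sum>j<k. frob_sq (commutator (A i) (A j)))"
    using out active(2) by (intro sum.cong refl sum.mono_neutral_left) auto
  also have "\<dots> = (\<Sum>i<k. \<Sum>j<k. frob_sq (commutator (A i) (A j)))"
    using out active(2) by (intro sum.mono_neutral_left) auto
  finally show "(\<Sum>i\<in>active. \<Sum>j\<in>active. ratio i j * (frob_sq (A i) * frob_sq (A j))) = (\<Sum>i<k. \<Sum>j<k. frob_sq (commutator (A i) (A j)))" .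
qed

lemma orthogonal_tuple_bound:
  "(\<Sum>i<k. \<Sum>j<k. frob_sq (commutator (A i) (A j))) \<le> 2/3 * (\<Sum>j<k. frob_sq (A j))\<^sup>2"
  unfolding sum_active[symmetric]
  by (rule quadratic_form_bound[OF active(1) active(3) ratio_sym ratio_diag ratio_le1 ratio_row])

lemma orthogonal_tuple_equality:
  assumes eq: "(\<Sum>i<k. \<Sum>j<k. frob_sq (commutator (A i) (A j))) = 2/3 * (\<Sum>j<k. frob_sq (A j))\<^sup>2"
    and ne: "(\<Sum>j<k. frob_sq (A j)) \<noteq> 0"
  obtains \<alpha> \<beta> \<gamma> where "\<alpha> < k" "\<beta> < k" "\<gamma> < k" "\<alpha> \<noteq> \<beta>" "\<alpha> \<noteq> \<gamma>" "\<beta> \<noteq> \<gamma>"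
    "\<forall>i\<in>{\<alpha>, \<beta>, \<gamma>}. frob_sq (A i) = (\<Sum>j<k. frob_sq (A j)) / 3"
    "\<forall>i\<in>{\<alpha>, \<beta>, \<gamma>}. \<forall>j\<in>{\<alpha>, \<beta>, \<gamma>}. i \<noteq> j \<longrightarrow>
      frob_sq (commutator (A i) (A j)) = frob_sq (A i) * frob_sq (A j)"
proof -
  have neS: "active \<noteq> {}" using ne by (auto simp: sum_active(1)[symmetric])
  have eqS: "(\<Sum>i\<in>active. \<Sum>j\<in>active. ratio i j * (frob_sq (A i) * frob_sq (A j))) = 2/3 * (\<Sum>j\<in>active. frob_sq (A j))\<^sup>2"
    unfolding sum_active by (rule eq)
  note E = quadratic_form_equality[of active "\<lambda>l. frob_sq (A l)" ratio, OF active(1) active(3) ratio_sym ratio_diag ratio_le1 ratio_row eqS neS]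
  have "card active = 3" by (rule E(1))
  then obtain \<alpha> \<beta> \<gamma> where abc: "active = {\<alpha>, \<beta>, \<gamma>}" "\<alpha> \<noteq> \<beta>" "\<alpha> \<noteq> \<gamma>" "\<beta> \<noteq> \<gamma>"
    by (auto simp: card_3_iff)
  show ?thesis
  proof (rule that[of \<alpha> \<beta> \<gamma>])
    show "\<alpha> < k" "\<beta> < k" "\<gamma> < k" using active(2) abc by auto
    show "\<forall>i\<in>{\<alpha>, \<beta>, \<gamma>}. frob_sq (A i) = (\<Sum>j<k. frob_sq (A j)) / 3"
      unfolding abc(1)[symmetric] sum_active(1)[symmetric] by (intro ballI) (rule E(2))
    show "\<forall>i\<in>{\<alpha>, \<beta>, \<gamma>}. \<forall>j\<in>{\<alpha>, \<beta>, \<gamma>}. i \<noteq> j \<longrightarrow>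
        frob_sq (commutator (A i) (A j)) = frob_sq (A i) * frob_sq (A j)"
      unfolding abc(1)[symmetric]
    proof (intro ballI impI)
      fix i j assume ij: "i \<in> active" "j \<in> active" "i \<noteq> j"
      have "ratio i j = 1" by (rule E(3)) (assumption | rule ij)+
      then show "frob_sq (commutator (A i) (A j)) = frob_sq (A i) * frob_sq (A j)"
        using active(3)[OF ij(1)] active(3)[OF ij(2)] ij by (simp add: ratio_def)
    qed
  qed (use abc in auto)
qed

end

text \<open>Neither side changes under the orthogonal change that makes the tuple
  orthogonal.\<close>

lemma skew_tuple_bound:
  fixes k n :: nat and A :: "nat \<Rightarrow> complex mat"
  assumes A: "\<And>j. j < k \<Longrightarrow> real_skew n (A j)"
  shows "(\<Sum>i<k. \<Sum>j<k. frob_sq (commutator (A i) (A j))) \<le> 2/3 * (\<Sum>j<k. frob_sq (A j))\<^sup>2"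
proof -
  have Ac: "\<And>j. j < k \<Longrightarrow> A j \<in> carrier_mat n n" using A by (rule real_skewD)
  obtain \<rho> where \<rho>: "real_orthonormal k k \<rho>"
    "\<forall>l<k. \<forall>p<k. l \<noteq> p \<longrightarrow> fip (comb n k (\<rho> l) A) (comb n k (\<rho> p) A) = 0"
    by (rule orthogonal_comb[of k n A]) (use A in auto)
  have "(\<Sum>i<k. \<Sum>j<k. frob_sq (commutator (comb n k (\<rho> i) A) (comb n k (\<rho> j) A)))
      \<le> 2/3 * (\<Sum>j<k. frob_sq (comb n k (\<rho> j) A))\<^sup>2"
    using \<rho>(2) by (intro orthogonal_tuple_bound[of k n "\<lambda>l. comb n k (\<rho> l) A"] real_skew_comb A) auto
  moreover have "(\<Sum>i<k. \<Sum>j<k. frob_sq (commutator (comb n k (\<rho> i) A) (comb n k (\<rho> j) A))) =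
      (\<Sum>i<k. \<Sum>j<k. frob_sq (commutator (A i) (A j)))"
    by (rule sum_commutator_comb[OF \<rho>(1) Ac])
  moreover have "(\<Sum>j<k. frob_sq (comb n k (\<rho> j) A)) = (\<Sum>j<k. frob_sq (A j))"
    by (rule sum_frob_comb[OF \<rho>(1) Ac])
  ultimately show ?thesis by simp
qed

subsection \<open>Quaternionic normal form\<close>

lemma diag_zero_carrier [simp]: "C \<in> carrier_mat d d \<Longrightarrow> d \<le> n \<Longrightarrow> diag_zero n C \<in> carrier_mat n n"
  by (auto simp: diag_zero_def Let_def)

lemma diag_zero_entry:
  assumes "C \<in> carrier_mat d d" "d \<le> n" "a < n" "b < n"
  shows "diag_zero n C $$ (a, b) = (if a < d \<and> b < d then C $$ (a, b) else 0)"
  using assms by (auto simp: diag_zero_def Let_def)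

lemma D_carrier [simp]: "D1 x \<in> carrier_mat 4 4" "D2 x \<in> carrier_mat 4 4" "D3 x \<in> carrier_mat 4 4"
  by (intro carrier_matI; simp add: D1_def D2_def D3_def mat_of_rows_list_def)+

lemma less_4_cases: "a < 4 \<Longrightarrow> a = 0 \<or> a = 1 \<or> a = 2 \<or> a = (3 :: nat)"
  by linarith

lemma D1_columns:
  assumes "a < 4"
  shows "D1 x $$ (a, 0) = (if a = Suc 0 then - x else 0)" "D1 x $$ (a, Suc 0) = (if a = 0 then x else 0)"
    "D1 x $$ (a, 2) = (if a = 3 then - x else 0)" "D1 x $$ (a, 3) = (if a = 2 then x else 0)"
  using less_4_cases[OF assms] by (elim disjE; simp add: D1_def mat_of_rows_list_def)+

lemma D2_columns:
  assumes "a < 4"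
  shows "D2 x $$ (a, 0) = (if a = 2 then - x else 0)" "D2 x $$ (a, Suc 0) = (if a = 3 then x else 0)"
    "D2 x $$ (a, 2) = (if a = 0 then x else 0)" "D2 x $$ (a, 3) = (if a = Suc 0 then - x else 0)"
  using less_4_cases[OF assms] by (elim disjE; simp add: D2_def mat_of_rows_list_def)+

lemma D3_columns:
  assumes "a < 4"
  shows "D3 x $$ (a, 0) = (if a = 3 then - x else 0)" "D3 x $$ (a, Suc 0) = (if a = 2 then - x else 0)"
    "D3 x $$ (a, 2) = (if a = Suc 0 then x else 0)" "D3 x $$ (a, 3) = (if a = 0 then x else 0)"
  using less_4_cases[OF assms] by (elim disjE; simp add: D3_def mat_of_rows_list_def)+

lemma sum_less_4: "(\<Sum>a<4. f a) = f 0 + f 1 + f 2 + f (3 :: nat)"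
  by (simp add: eval_nat_numeral add_ac)

lemma real_skew_scalar_prod:
  assumes A: "real_skew n A" and u: "u \<in> carrier_vec n" and v: "v \<in> carrier_vec n"
  shows "(A *\<^sub>v u) \<bullet> v = - (u \<bullet> (A *\<^sub>v v))"
proof -
  note d = carrier_matD[OF real_skewD(1)[OF A]]
  have "(A *\<^sub>v u) \<bullet> v = (\<Sum>i<n. \<Sum>j<n. A $$ (i, j) * u $ j * v $ i)"
    using u v d by (auto simp: scalar_prod_def atLeast0LessThan sum_distrib_right intro!: sum.cong)
  also have "\<dots> = (\<Sum>j<n. \<Sum>i<n. A $$ (i, j) * u $ j * v $ i)" by (rule sum.swap)
  also have "\<dots> = (\<Sum>j<n. \<Sum>i<n. - (u $ j * (A $$ (j, i) * v $ i)))"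
  proof (intro sum.cong refl)
    fix j i assume "j \<in> {..<n}" "i \<in> {..<n}"
    then have "A $$ (i, j) = - A $$ (j, i)" using real_skewD(2)[OF A, of j i] by simp
    then show "A $$ (i, j) * u $ j * v $ i = - (u $ j * (A $$ (j, i) * v $ i))" by simp
  qed
  also have "\<dots> = - (u \<bullet> (A *\<^sub>v v))"
    using u v d by (auto simp: scalar_prod_def atLeast0LessThan sum_distrib_left sum_negf intro!: sum.cong)
  finally show ?thesis .
qed

lemma real_skew_scalar_prod_self:
  assumes A: "real_skew n A" and u: "u \<in> carrier_vec n"
  shows "u \<bullet> (A *\<^sub>v u) = 0"
proof -
  have Au: "A *\<^sub>v u \<in> carrier_vec n" using real_skewD(1)[OF A] u by simp
  have "u \<bullet> (A *\<^sub>v u) = - (u \<bullet> (A *\<^sub>v u))"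
    using real_skew_scalar_prod[OF A u u] comm_scalar_prod[OF Au u] by simp
  then show ?thesis by simp
qed

lemma anticommute_vec:
  assumes X: "X \<in> carrier_mat n n" and Y: "Y \<in> carrier_mat n n" and v: "v \<in> carrier_vec n"
    and anti: "X * Y + Y * X = 0\<^sub>m n n"
  shows "X *\<^sub>v (Y *\<^sub>v v) = (- 1) \<cdot>\<^sub>v (Y *\<^sub>v (X *\<^sub>v (v :: complex vec)))"
proof (rule eq_vecI)
  fix i assume "i < dim_vec ((- 1) \<cdot>\<^sub>v (Y *\<^sub>v (X *\<^sub>v v)))"
  then have i: "i < n" using Y by simp
  have "X *\<^sub>v (Y *\<^sub>v v) + Y *\<^sub>v (X *\<^sub>v v) = 0\<^sub>m n n *\<^sub>v v"
    unfolding anti[symmetric] using X Y v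
    by (simp add: add_mult_distrib_mat_vec[of _ n n] assoc_mult_mat_vec[of _ n n _ n])
  then have "(X *\<^sub>v (Y *\<^sub>v v) + Y *\<^sub>v (X *\<^sub>v v)) $ i = (0\<^sub>m n n *\<^sub>v v) $ i" by simp
  then have "(X *\<^sub>v (Y *\<^sub>v v)) $ i + (Y *\<^sub>v (X *\<^sub>v v)) $ i = 0"
    using i X Y v by (simp add: scalar_prod_def del: index_mult_mat_vec) (simp add: scalar_prod_def)
  then show "(X *\<^sub>v (Y *\<^sub>v v)) $ i = ((- 1) \<cdot>\<^sub>v (Y *\<^sub>v (X *\<^sub>v v))) $ i"
    using i X Y by (simp add: add_eq_0_iff2 del: index_mult_mat_vec)
qed (use X Y in simp)

text \<open>\<open>X * X\<close> is known to be a scalar only on the range of \<open>Y\<close>, so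
  vectors have to be presented as images under \<open>Y\<close>.\<close>

lemma square_vec:
  assumes X: "X \<in> carrier_mat n n" and Y: "Y \<in> carrier_mat n n" and v: "v \<in> carrier_vec n"
    and sq: "X * (X * Y) + c \<cdot>\<^sub>m Y = 0\<^sub>m n n"
  shows "X *\<^sub>v (X *\<^sub>v (Y *\<^sub>v v)) = (- c) \<cdot>\<^sub>v (Y *\<^sub>v (v :: complex vec))"
proof (rule eq_vecI)
  fix i assume "i < dim_vec ((- c) \<cdot>\<^sub>v (Y *\<^sub>v v))"
  then have i: "i < n" using Y by simp
  have XY: "X * (X * Y) \<in> carrier_mat n n" "c \<cdot>\<^sub>m Y \<in> carrier_mat n n" using X Y by auto
  have cY: "(c \<cdot>\<^sub>m Y) *\<^sub>v v = c \<cdot>\<^sub>v (Y *\<^sub>v v)"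
    using Y v by (intro eq_vecI) auto
  have "X *\<^sub>v (X *\<^sub>v (Y *\<^sub>v v)) + c \<cdot>\<^sub>v (Y *\<^sub>v v) = 0\<^sub>m n n *\<^sub>v v"
    unfolding sq[symmetric] add_mult_distrib_mat_vec[OF XY v] cY using X Y v
    by (simp add: assoc_mult_mat_vec[of _ n n _ n])
  then have "(X *\<^sub>v (X *\<^sub>v (Y *\<^sub>v v)) + c \<cdot>\<^sub>v (Y *\<^sub>v v)) $ i = (0\<^sub>m n n *\<^sub>v v) $ i" by simp
  then have "(X *\<^sub>v (X *\<^sub>v (Y *\<^sub>v v))) $ i + c * (Y *\<^sub>v v) $ i = 0"
    using i X Y v by (simp add: scalar_prod_def del: index_mult_mat_vec) (simp add: scalar_prod_def)
  then show "(X *\<^sub>v (X *\<^sub>v (Y *\<^sub>v v))) $ i = ((- c) \<cdot>\<^sub>v (Y *\<^sub>v v)) $ i"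
    using i X Y by (simp add: add_eq_0_iff2 del: index_mult_mat_vec)
qed (use X Y in simp)

definition real_vec :: "complex vec \<Rightarrow> bool" where
  "real_vec v \<longleftrightarrow> (\<forall>i<dim_vec v. v $ i \<in> \<real>)"

lemma real_vec_mult:
  assumes A: "real_skew n A" and v: "v \<in> carrier_vec n" "real_vec v"
  shows "real_vec (A *\<^sub>v v)"
proof -
  note d = carrier_matD[OF real_skewD(1)[OF A]]
  have "A $$ (i, j) \<in> \<real>" if "i < n" "j < n" for i j
    using real_skewD(3)[OF A that] by (simp add: Reals_cnj_iff)
  then show ?thesis
    using v d by (auto simp: real_vec_def scalar_prod_def intro!: sum_in_Reals Reals_mult)
qed

lemma real_vec_smult: "real_vec v \<Longrightarrow> c \<in> \<real> \<Longrightarrow> real_vec (c \<cdot>\<^sub>v v)"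
  by (simp add: real_vec_def Reals_mult)

lemma hdot_real_vec:
  assumes "u \<in> carrier_vec n" "v \<in> carrier_vec n" "real_vec v"
  shows "hdot n (($) u) (($) v) = u \<bullet> v"
proof -
  have "cnj (v $ t) = v $ t" if "t < n" for t
    using assms that by (auto simp: real_vec_def Reals_cnj_iff)
  then show ?thesis using assms by (simp add: hdot_def scalar_prod_def atLeast0LessThan)
qed

lemma sum_truncate:
  fixes f :: "nat \<Rightarrow> 'a :: comm_monoid_add"
  assumes "d \<le> n"
  shows "(\<Sum>a<n. if a < d then f a else 0) = (\<Sum>a<d. f a)"
proof -
  have "{a \<in> {..<n}. a < d} = {..<d}" using assms by auto
  then show ?thesis by (simp add: sum.inter_filter[symmetric])
qed

text \<open>Only the first four columns are computed. Their entries already exhaust the squared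
  norm, which conjugation preserves, so all other columns vanish.\<close>

lemma conjugation_block:
  assumes A: "A \<in> carrier_mat n n" and P: "unitary n P" and n: "4 \<le> n"
    and C: "C \<in> carrier_mat 4 4" "(\<Sum>a<4. \<Sum>b<4. (cmod (C $$ (a, b)))\<^sup>2) = frob_sq A"
    and cols: "\<And>a b. a < n \<Longrightarrow> b < 4 \<Longrightarrow>
      (mat_adjoint P * A * P) $$ (a, b) = (if a < 4 then C $$ (a, b) else 0)"
  shows "mat_adjoint P * A * P = diag_zero n C"
proof -
  let ?M = "mat_adjoint P * A * P"
  have Pc: "P \<in> carrier_mat n n" using P by (simp add: unitary_def)
  then have M: "?M \<in> carrier_mat n n" using A by simp
  let ?N = "\<lambda>a b. (if a < 4 \<and> b < 4 then (cmod (C $$ (a, b)))\<^sup>2 else 0)"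
  have "(\<Sum>a<n. \<Sum>b<n. ?N a b) = (\<Sum>a<n. if a < 4 then \<Sum>b<n. if b < 4 then (cmod (C $$ (a, b)))\<^sup>2 else 0 else 0)"
    by (intro sum.cong refl) auto
  also have "\<dots> = (\<Sum>a<4. \<Sum>b<4. (cmod (C $$ (a, b)))\<^sup>2)"
    by (simp only: sum_truncate[OF n])
  also have "\<dots> = frob_sq ?M"
    unfolding C(2) using frob_sq_unitary[OF unitary_adjoint[OF P] P A] by simp
  finally have z: "(\<Sum>a<n. \<Sum>b<n. (cmod (?M $$ (a, b)))\<^sup>2 - ?N a b) = 0"
    by (simp add: frob_sq_entries[OF M] sum_subtractf)
  have N0: "(cmod (?M $$ (a, b)))\<^sup>2 - ?N a b = 0" if ab: "a < n" "b < n" for a b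
  proof (rule double_sum_nonneg_0[of "{..<n}" "{..<n}" "\<lambda>a b. (cmod (?M $$ (a, b)))\<^sup>2 - ?N a b"])
    fix i j assume "i \<in> {..<n}" "j \<in> {..<n}"
    then show "0 \<le> (cmod (?M $$ (i, j)))\<^sup>2 - ?N i j"
      using cols[of i j] by (cases "j < 4") (auto simp del: index_mult_mat(1))
  qed (use z ab in auto)
  show ?thesis
  proof (rule eq_matI)
    fix a b assume "a < dim_row (diag_zero n C)" "b < dim_col (diag_zero n C)"
    then have ab: "a < n" "b < n" using carrier_matD[OF diag_zero_carrier[OF C(1) n]] by simp_all
    have "?M $$ (a, b) = (if a < 4 \<and> b < 4 then C $$ (a, b) else 0)"
    proof (cases "b < 4")
      case True
      then show ?thesis using cols[OF ab(1) True] by simp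
    next
      case False
      then have "(cmod (?M $$ (a, b)))\<^sup>2 = 0" using N0[OF ab] by simp
      then show ?thesis using False by simp
    qed
    then show "?M $$ (a, b) = diag_zero n C $$ (a, b)"
      using diag_zero_entry[OF C(1) n ab] by simp
  qed (use M carrier_matD[OF diag_zero_carrier[OF C(1) n]] in auto)
qed


text \<open>A unit vector \<open>e\<close> in the range of \<open>A2\<close> generates the frame
  \<open>e\<close>, \<open>A1 e\<close>, \<open>A2 e\<close>, \<open>A1 A2 e\<close>, orthogonal
  because the matrices are skew and anticommute. Norm counting confines \<open>A1\<close> and
  \<open>A2\<close> to its span. \<open>A3 e\<close> is orthogonal to the first three vectors and to
  the complement of the frame, which \<open>A1\<close> annihilates; hence it is a multiple of the
  fourth. Its sign is not determined, which is why \<open>s\<close> appears.\<close>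

lemma quaternion_normal_form:
  fixes \<kappa> :: real
  assumes n: "4 \<le> n" and \<kappa>: "\<kappa> > 0"
    and A: "real_skew n A1" "real_skew n A2" "real_skew n A3"
    and fr: "frob_sq A1 = 4 * \<kappa>\<^sup>2" "frob_sq A2 = 4 * \<kappa>\<^sup>2" "frob_sq A3 = 4 * \<kappa>\<^sup>2"
    and anti: "A1 * A2 + A2 * A1 = 0\<^sub>m n n" "A1 * A3 + A3 * A1 = 0\<^sub>m n n" "A2 * A3 + A3 * A2 = 0\<^sub>m n n"
    and sq12: "A1 * (A1 * A2) + complex_of_real (\<kappa>\<^sup>2) \<cdot>\<^sub>m A2 = 0\<^sub>m n n"
    and sq21: "A2 * (A2 * A1) + complex_of_real (\<kappa>\<^sup>2) \<cdot>\<^sub>m A1 = 0\<^sub>m n n"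
    and sq13: "A1 * (A1 * A3) + complex_of_real (\<kappa>\<^sup>2) \<cdot>\<^sub>m A3 = 0\<^sub>m n n"
    and sq32: "A3 * (A3 * A2) + complex_of_real (\<kappa>\<^sup>2) \<cdot>\<^sub>m A2 = 0\<^sub>m n n"
  obtains P and s :: real where "unitary n P" "mat_cnj P = P" "s = 1 \<or> s = - 1"
    "mat_adjoint P * A1 * P = diag_zero n (D1 (complex_of_real \<kappa>))"
    "mat_adjoint P * A2 * P = diag_zero n (D2 (complex_of_real \<kappa>))"
    "mat_adjoint P * (complex_of_real s \<cdot>\<^sub>m A3) * P = diag_zero n (D3 (complex_of_real \<kappa>))"
proof -
  define L where "L = complex_of_real \<kappa>"
  have L0: "L \<noteq> 0" using \<kappa> by (simp add: L_def)
  have L2: "complex_of_real (\<kappa>\<^sup>2) = L\<^sup>2" by (simp add: L_def)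
  note Ac = A(1)[THEN real_skewD(1)] A(2)[THEN real_skewD(1)] A(3)[THEN real_skewD(1)]
  note sq = sq12[unfolded L2] sq21[unfolded L2] sq13[unfolded L2] sq32[unfolded L2]
  have "A2 \<noteq> 0\<^sub>m n n" using fr(2) \<kappa> by auto
  then obtain a j where aj: "a < n" "j < n" "A2 $$ (a, j) \<noteq> 0"
    using Ac(2) by (metis carrier_matD eq_matI index_zero_mat)
  define u where "u = A2 *\<^sub>v unit_vec n j"
  have u: "u \<in> carrier_vec n" using Ac by (simp add: u_def)
  have "real_vec (unit_vec n j)" by (auto simp: real_vec_def unit_vec_def)
  then have ru: "real_vec u" unfolding u_def by (intro real_vec_mult[OF A(2)]) auto
  have "u $ a = A2 $$ (a, j)"
    using aj Ac(2) by (auto simp: u_def scalar_prod_right_unit)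
  then have "\<exists>t<n. u $ t \<noteq> 0" using aj by auto
  then obtain c0 :: real where c0: "c0 > 0"
    "hdot n (\<lambda>t. complex_of_real c0 * u $ t) (\<lambda>t. complex_of_real c0 * u $ t) = 1"
    by (rule normalize_vector)
  \<comment> \<open>The scaling is done before \<open>A2\<close> is applied, which keeps
    \<open>e\<close> explicitly in the range of \<open>A2\<close>, where \<open>A1 * A1\<close> and
    \<open>A3 * A3\<close> act as \<open>- L^2\<close>.\<close>
  define w where "w = complex_of_real c0 \<cdot>\<^sub>v unit_vec n j"
  have w: "w \<in> carrier_vec n" by (simp add: w_def)
  define e where "e = A2 *\<^sub>v w"
  have e_u: "e = complex_of_real c0 \<cdot>\<^sub>v u"
    unfolding e_def w_def u_def by (rule mult_mat_vec[OF Ac(2)]) simp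
  have e: "e \<in> carrier_vec n" using u by (simp add: e_u)
  have re: "real_vec e" unfolding e_u by (intro real_vec_smult ru) auto
  have ee: "e \<bullet> e = 1"
  proof -
    have "e \<bullet> e = hdot n (($) e) (($) e)" by (rule hdot_real_vec[OF e e re, symmetric])
    also have "\<dots> = hdot n (\<lambda>t. complex_of_real c0 * u $ t) (\<lambda>t. complex_of_real c0 * u $ t)"
      using u by (intro hdot_cong) (auto simp: e_u)
    finally show ?thesis using c0 by simp
  qed
  define x where "x = A1 *\<^sub>v e"
  define y where "y = A2 *\<^sub>v e"
  define z where "z = A1 *\<^sub>v y"
  define t where "t = A3 *\<^sub>v e"
  have c: "x \<in> carrier_vec n" "y \<in> carrier_vec n" "z \<in> carrier_vec n" "t \<in> carrier_vec n"
    using Ac e by (auto simp: x_def y_def z_def t_def)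
  have r: "real_vec x" "real_vec y" "real_vec z" "real_vec t"
    using c e re unfolding x_def y_def z_def t_def by (auto intro!: real_vec_mult[OF A(1)] real_vec_mult[OF A(2)] real_vec_mult[OF A(3)])
  have A1x: "A1 *\<^sub>v x = (- (L\<^sup>2)) \<cdot>\<^sub>v e"
    unfolding x_def e_def by (rule square_vec[OF Ac(1) Ac(2) w sq(1)])
  have A3t: "A3 *\<^sub>v t = (- (L\<^sup>2)) \<cdot>\<^sub>v e"
    unfolding t_def e_def by (rule square_vec[OF Ac(3) Ac(2) w sq(4)])
  have A1z: "A1 *\<^sub>v z = (- (L\<^sup>2)) \<cdot>\<^sub>v y"
    unfolding z_def y_def by (rule square_vec[OF Ac(1) Ac(2) e sq(1)])
  have A2x: "A2 *\<^sub>v x = (- 1) \<cdot>\<^sub>v z"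
    unfolding z_def x_def y_def
    using anticommute_vec[OF Ac(1) Ac(2) e anti(1)] Ac e
    by (simp add: smult_smult_assoc)
  \<comment> \<open>The hypothesis on \<open>A2 * A2\<close> concerns the range of
    \<open>A1\<close>, so \<open>e\<close> is first written as a multiple of
    \<open>A1 x\<close>.\<close>
  have A2y: "A2 *\<^sub>v y = (- (L\<^sup>2)) \<cdot>\<^sub>v e"
  proof -
    have "e = (- (1 / L\<^sup>2)) \<cdot>\<^sub>v (A1 *\<^sub>v x)"
      unfolding A1x using L0 by (simp add: smult_smult_assoc)
    then have "A2 *\<^sub>v (A2 *\<^sub>v e) = A2 *\<^sub>v (A2 *\<^sub>v ((- (1 / L\<^sup>2)) \<cdot>\<^sub>v (A1 *\<^sub>v x)))" by simp
    also have "\<dots> = (- (1 / L\<^sup>2)) \<cdot>\<^sub>v (A2 *\<^sub>v (A2 *\<^sub>v (A1 *\<^sub>v x)))"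
      using Ac c by (simp add: mult_mat_vec[of _ n n])
    also have "A2 *\<^sub>v (A2 *\<^sub>v (A1 *\<^sub>v x)) = (- (L\<^sup>2)) \<cdot>\<^sub>v (A1 *\<^sub>v x)"
      by (rule square_vec[OF Ac(2) Ac(1) c(1) sq(2)])
    also have "(- (1 / L\<^sup>2)) \<cdot>\<^sub>v ((- (L\<^sup>2)) \<cdot>\<^sub>v (A1 *\<^sub>v x)) = (- (L\<^sup>2)) \<cdot>\<^sub>v e"
    proof -
      have "(- (1 / L\<^sup>2)) \<cdot>\<^sub>v ((- (L\<^sup>2)) \<cdot>\<^sub>v v) = v" for v
        using L0 by (simp add: smult_smult_assoc)
      then show ?thesis by (simp only: A1x)
    qed
    finally show ?thesis unfolding y_def .
  qed
  have A2z: "A2 *\<^sub>v z = L\<^sup>2 \<cdot>\<^sub>v x"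
  proof -
    have "A1 *\<^sub>v (A2 *\<^sub>v y) = (- 1) \<cdot>\<^sub>v (A2 *\<^sub>v z)"
      unfolding z_def by (rule anticommute_vec[OF Ac(1) Ac(2) c(2) anti(1)])
    moreover have "A1 *\<^sub>v (A2 *\<^sub>v y) = (- (L\<^sup>2)) \<cdot>\<^sub>v x"
      unfolding A2y x_def by (rule mult_mat_vec[OF Ac(1) e])
    ultimately have "(- 1) \<cdot>\<^sub>v ((- 1) \<cdot>\<^sub>v (A2 *\<^sub>v z)) = (- 1) \<cdot>\<^sub>v ((- (L\<^sup>2)) \<cdot>\<^sub>v x)" by simp
    then show ?thesis by (simp add: smult_smult_assoc)
  qed
  have smul: "(k \<cdot>\<^sub>v v) \<bullet> v' = k * (v \<bullet> v')" "v \<bullet> (k \<cdot>\<^sub>v v') = k * (v \<bullet> v')"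
    if "v \<in> carrier_vec n" "v' \<in> carrier_vec n" for k :: complex and v v'
    using that by (auto intro: smult_scalar_prod_distrib scalar_prod_smult_distrib)
  note dot1 = real_skew_scalar_prod[OF A(1)] and dot2 = real_skew_scalar_prod[OF A(2)]
    and dot3 = real_skew_scalar_prod[OF A(3)]
  note comm = comm_scalar_prod[of _ n]
  have ex: "e \<bullet> x = 0" unfolding x_def by (rule real_skew_scalar_prod_self[OF A(1) e])
  have ey: "e \<bullet> y = 0" unfolding y_def by (rule real_skew_scalar_prod_self[OF A(2) e])
  have et: "e \<bullet> t = 0" unfolding t_def by (rule real_skew_scalar_prod_self[OF A(3) e])
  have yz: "y \<bullet> z = 0" unfolding z_def by (rule real_skew_scalar_prod_self[OF A(1) c(2)])
  have xx: "x \<bullet> x = L\<^sup>2"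
    using dot1[OF e c(1)] by (simp add: x_def[symmetric] A1x smul e ee)
  have yy: "y \<bullet> y = L\<^sup>2"
    using dot2[OF e c(2)] by (simp add: y_def[symmetric] A2y smul e ee)
  have tt: "t \<bullet> t = L\<^sup>2"
    using dot3[OF e c(4)] by (simp add: t_def[symmetric] A3t smul e ee)
  have zz: "z \<bullet> z = L\<^sup>2 * L\<^sup>2"
    using dot1[OF c(2) c(3)] by (simp add: z_def[symmetric] A1z smul c yy)
  have ez: "e \<bullet> z = - (x \<bullet> y)"
    using dot1[OF e c(2)] by (simp add: x_def[symmetric] z_def[symmetric])
  \<comment> \<open>Skewness of \<open>A1\<close> gave \<open>e . z = - (x . y)\<close>; skewness of
    \<open>A2\<close> and anticommutation give \<open>e . z = x . y\<close>. So both are 0.\<close>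
  have "e \<bullet> ((- 1) \<cdot>\<^sub>v z) = - (y \<bullet> x)"
    using dot2[OF e c(1)] by (simp add: y_def[symmetric] A2x)
  then have "e \<bullet> z = x \<bullet> y" using comm[OF c(1,2)] by (simp add: smul e c)
  then have xy: "x \<bullet> y = 0" and ez: "e \<bullet> z = 0" using ez by simp_all
  have xz: "x \<bullet> z = 0"
    using dot1[OF c(1) c(2)] ey by (simp add: A1x z_def[symmetric] smul e c)
  \<comment> \<open>Anticommutation makes \<open>x . t\<close> equal to its own negative.\<close>
  have xt: "x \<bullet> t = 0"
  proof -
    have "A1 *\<^sub>v t = (- 1) \<cdot>\<^sub>v (A3 *\<^sub>v x)"
      unfolding t_def x_def by (rule anticommute_vec[OF Ac(1) Ac(3) e anti(2)])
    then have "e \<bullet> (A1 *\<^sub>v t) = - (e \<bullet> (A3 *\<^sub>v x))" using Ac e c by (simp add: smul)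
    moreover have "x \<bullet> t = - (e \<bullet> (A1 *\<^sub>v t))" using dot1[OF e c(4)] by (simp add: x_def)
    moreover have "t \<bullet> x = - (e \<bullet> (A3 *\<^sub>v x))" using dot3[OF e c(1)] by (simp add: t_def)
    ultimately show ?thesis using comm[OF c(1,4)] by simp
  qed
  have yt: "y \<bullet> t = 0"
  proof -
    have "A2 *\<^sub>v t = (- 1) \<cdot>\<^sub>v (A3 *\<^sub>v y)"
      unfolding t_def y_def by (rule anticommute_vec[OF Ac(2) Ac(3) e anti(3)])
    then have "e \<bullet> (A2 *\<^sub>v t) = - (e \<bullet> (A3 *\<^sub>v y))" using Ac e c by (simp add: smul)
    moreover have "y \<bullet> t = - (e \<bullet> (A2 *\<^sub>v t))" using dot2[OF e c(4)] by (simp add: y_def)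
    moreover have "t \<bullet> y = - (e \<bullet> (A3 *\<^sub>v y))" using dot3[OF e c(2)] by (simp add: t_def)
    ultimately show ?thesis using comm[OF c(2,4)] by simp
  qed
  \<comment> \<open>The signs are matched to \<open>D1\<close> and \<open>D2\<close>: they give
    \<open>A1 (f 0) = - L * f 1\<close>, \<open>A2 (f 0) = - L * f 2\<close> and
    \<open>A1 (f 2) = - L * f 3\<close>.\<close>
  define f where "f i = (if i = 0 then e else if i = 1 then (- 1 / L) \<cdot>\<^sub>v x
      else if i = 2 then (- 1 / L) \<cdot>\<^sub>v y else (1 / L\<^sup>2) \<cdot>\<^sub>v z)" for i :: nat
  have fs: "f 0 = e" "f 1 = (- 1 / L) \<cdot>\<^sub>v x" "f 2 = (- 1 / L) \<cdot>\<^sub>v y" "f 3 = (1 / L\<^sup>2) \<cdot>\<^sub>v z"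
    by (simp_all add: f_def)
  have fc: "f i \<in> carrier_vec n" for i using e c by (simp add: f_def)
  have Lr: "- 1 / L \<in> \<real>" "1 / L\<^sup>2 \<in> \<real>" by (simp_all add: L_def)
  have fr': "real_vec (f i)" for i
    using re r Lr by (simp add: f_def real_vec_smult)
  have ff: "f i \<bullet> f j = (if i = j then 1 else 0)" if "i < 4" "j < 4" for i j
    using less_4_cases[OF that(1)] less_4_cases[OF that(2)] L0
      comm[OF e c(1)] comm[OF e c(2)] comm[OF e c(3)] comm[OF c(1,2)] comm[OF c(1,3)] comm[OF c(2,3)]
    by (elim disjE; simp add: fs[simplified] smul e c ee ex ey ez xx yy zz xy xz yz power2_eq_square)
  define F where "F i s = (if s < n then f i $ s else 0)" for i s
  have "orthonormal n 4 F"
    unfolding orthonormal_def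
  proof (intro allI impI)
    fix i j :: nat assume ij: "i < 4" "j < 4"
    have "hdot n (F i) (F j) = hdot n (($) (f i)) (($) (f j))" by (intro hdot_cong) (auto simp: F_def)
    then show "hdot n (F i) (F j) = (if i = j then 1 else 0)"
      using hdot_real_vec[OF fc fc fr'] ff[OF ij] by simp
  qed
  moreover have "F i s \<in> \<real>" for i s
    using fr'[of i] fc[of i] by (auto simp: F_def real_vec_def)
  ultimately obtain g where g: "orthonormal n n g" "\<forall>i<4. g i = F i" "\<forall>i<n. \<forall>s. g i s \<in> \<real>"
    by - (rule orthonormal_extend[of \<real> n 4 F], use n in auto)
  define q where "q b = vec n (g b)" for b
  have qc: "q b \<in> carrier_vec n" for b by (simp add: q_def)
  have rq: "real_vec (q b)" if "b < n" for b using g(3) that by (simp add: q_def real_vec_def)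
  have qf: "q b = f b" if "b < 4" for b
    using g(2) that fc[of b] by (intro eq_vecI) (auto simp: q_def F_def)
  have hq: "hdot n v (g b) = vec n v \<bullet> q b" if "b < n" for v b
  proof -
    have "hdot n v (g b) = hdot n (($) (vec n v)) (($) (q b))" by (intro hdot_cong) (auto simp: q_def)
    then show ?thesis using hdot_real_vec[OF _ qc rq[OF that], of "vec n v"] by simp
  qed
  have qq: "q a \<bullet> q b = (if a = b then 1 else 0)" if "a < n" "b < n" for a b
    using hq[OF that(2), of "g a"] orthonormalD[OF g(1) that] by (simp add: q_def)
  define P where "P = mat n n (\<lambda>(a, i). g i a)"
  have P: "unitary n P" unfolding P_def by (rule unitary_orthonormal[OF g(1)])
  have Pc: "P \<in> carrier_mat n n" by (simp add: P_def)
  have rP: "mat_cnj P = P"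
    using g(3) by (intro eq_matI) (auto simp: P_def Reals_cnj_iff)
  have entry: "(mat_adjoint P * X * P) $$ (a, b) = q a \<bullet> (X *\<^sub>v q b)"
    if X: "X \<in> carrier_mat n n" and ab: "a < n" "b < n" for X a b
  proof -
    have XP: "(X * P) $$ (s, b) = (X *\<^sub>v q b) $ s" if "s < n" for s
    proof -
      have "col P b = q b" using ab by (intro eq_vecI) (auto simp: P_def q_def)
      then show ?thesis using that ab X Pc by (simp add: P_def[symmetric])
    qed
    have "(mat_adjoint P * X * P) $$ (a, b) = (mat_adjoint P * (X * P)) $$ (a, b)"
      using X Pc by (simp add: square_mult_assoc[of _ n])
    also have "\<dots> = (\<Sum>s<n. mat_adjoint P $$ (a, s) * (X * P) $$ (s, b))"
      using X Pc ab by (intro mat_mult_entry[of _ n n _ n]) auto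
    also have "\<dots> = (\<Sum>s<n. q a $ s * (X *\<^sub>v q b) $ s)"
    proof (intro sum.cong refl)
      fix s assume "s \<in> {..<n}"
      then have s: "s < n" by simp
      have "cnj (g a s) = g a s" using g(3) ab by (simp add: Reals_cnj_iff)
      then have "mat_adjoint P $$ (a, s) = q a $ s"
        using s ab Pc by (simp add: mat_adjoint_entry P_def q_def)
      then show "mat_adjoint P $$ (a, s) * (X * P) $$ (s, b) = q a $ s * (X *\<^sub>v q b) $ s"
        by (simp only: XP[OF s])
    qed
    also have "\<dots> = q a \<bullet> (X *\<^sub>v q b)"
      using X by (simp add: scalar_prod_def atLeast0LessThan)
    finally show ?thesis .
  qed
  have column: "(mat_adjoint P * X * P) $$ (a, b) = (if a = d then k else 0)"
    if "X \<in> carrier_mat n n" "a < n" "b < 4" "d < 4" "X *\<^sub>v f b = k \<cdot>\<^sub>v f d" for X a b d k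
  proof -
    have "b < n" "d < n" using that n by auto
    then show ?thesis
      using entry[OF that(1,2), of b] that qq[OF that(2), of d]
      by (simp add: qf[symmetric] smul qc)
  qed
  have four: "0 < (4::nat)" "1 < (4::nat)" "2 < (4::nat)" "3 < (4::nat)" by simp_all
  have mv: "X *\<^sub>v (k \<cdot>\<^sub>v v) = k \<cdot>\<^sub>v (X *\<^sub>v v)" if "X \<in> carrier_mat n n" "v \<in> carrier_vec n" for X v and k :: complex
    using that by (rule mult_mat_vec)
  have A1f: "A1 *\<^sub>v f 0 = (- L) \<cdot>\<^sub>v f 1" "A1 *\<^sub>v f 1 = L \<cdot>\<^sub>v f 0" "A1 *\<^sub>v f 2 = (- L) \<cdot>\<^sub>v f 3" "A1 *\<^sub>v f 3 = L \<cdot>\<^sub>v f 2"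
    unfolding fs mv[OF Ac(1) c(1)] mv[OF Ac(1) c(2)] mv[OF Ac(1) c(3)]
      x_def[symmetric] z_def[symmetric] A1x A1z smult_smult_assoc
    using L0 by (simp_all add: power2_eq_square)
  have A2f: "A2 *\<^sub>v f 0 = (- L) \<cdot>\<^sub>v f 2" "A2 *\<^sub>v f 1 = L \<cdot>\<^sub>v f 3" "A2 *\<^sub>v f 2 = L \<cdot>\<^sub>v f 0" "A2 *\<^sub>v f 3 = (- L) \<cdot>\<^sub>v f 1"
    unfolding fs mv[OF Ac(2) c(1)] mv[OF Ac(2) c(2)] mv[OF Ac(2) c(3)]
      y_def[symmetric] A2x A2y A2z smult_smult_assoc
    using L0 by (simp_all add: power2_eq_square)
  have nL: "4 * \<kappa>\<^sup>2 = 4 * (cmod L)\<^sup>2" by (simp add: L_def)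
  have M1: "mat_adjoint P * A1 * P = diag_zero n (D1 L)"
  proof (rule conjugation_block[OF Ac(1) P n])
    show "(\<Sum>a<4. \<Sum>b<4. (cmod (D1 L $$ (a, b)))\<^sup>2) = frob_sq A1"
      unfolding fr nL by (simp add: sum_less_4 D1_columns)
    show "(mat_adjoint P * A1 * P) $$ (a, b) = (if a < 4 then D1 L $$ (a, b) else 0)" if ab: "a < n" "b < 4" for a b
      using less_4_cases[OF ab(2)] column[OF Ac(1) ab(1) four(1,2) A1f(1)] column[OF Ac(1) ab(1) four(2,1) A1f(2)]
        column[OF Ac(1) ab(1) four(3,4) A1f(3)] column[OF Ac(1) ab(1) four(4,3) A1f(4)]
      by (elim disjE; simp add: D1_columns del: index_mult_mat(1))
  qed simp
  have M2: "mat_adjoint P * A2 * P = diag_zero n (D2 L)"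
  proof (rule conjugation_block[OF Ac(2) P n])
    show "(\<Sum>a<4. \<Sum>b<4. (cmod (D2 L $$ (a, b)))\<^sup>2) = frob_sq A2"
      unfolding fr nL by (simp add: sum_less_4 D2_columns)
    show "(mat_adjoint P * A2 * P) $$ (a, b) = (if a < 4 then D2 L $$ (a, b) else 0)" if ab: "a < n" "b < 4" for a b
      using less_4_cases[OF ab(2)] column[OF Ac(2) ab(1) four(1,3) A2f(1)] column[OF Ac(2) ab(1) four(2,4) A2f(2)]
        column[OF Ac(2) ab(1) four(3,1) A2f(3)] column[OF Ac(2) ab(1) four(4,2) A2f(4)]
      by (elim disjE; simp add: D2_columns del: index_mult_mat(1))
  qed simp
  \<comment> \<open>Beyond the frame the columns of the conjugated \<open>A1\<close> are zero, so
    \<open>A1\<close> annihilates these basis vectors.\<close>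
  have ker: "A1 *\<^sub>v q j = 0\<^sub>v n" if j: "4 \<le> j" "j < n" for j
  proof (rule eq_vecI)
    fix s assume "s < dim_vec (0\<^sub>v n :: complex vec)"
    then have s: "s < n" by simp
    let ?u = "\<lambda>s. (A1 *\<^sub>v q j) $ s"
    have v: "vec n ?u = A1 *\<^sub>v q j" using Ac(1) by (intro eq_vecI) auto
    have "hdot n ?u (g i) = 0" if i: "i < n" for i
    proof -
      have "hdot n ?u (g i) = q i \<bullet> (A1 *\<^sub>v q j)"
        unfolding hq[OF i] v using Ac(1) qc by (intro comm) auto
      also have "\<dots> = diag_zero n (D1 L) $$ (i, j)"
        unfolding M1[symmetric] by (rule entry[OF Ac(1) i j(2), symmetric])
      finally show ?thesis using j by (simp add: diag_zero_entry[OF D_carrier(1) n i j(2)])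
    qed
    then show "(A1 *\<^sub>v q j) $ s = 0\<^sub>v n $ s"
      using orthonormal_expand[OF g(1) s, of ?u] s by simp
  qed (use Ac in simp)
  define c3 where "c3 = t \<bullet> q 3"
  \<comment> \<open>For \<open>i >= 4\<close>, \<open>t\<close> is a multiple of
    \<open>A1 (A1 t)\<close>, and moving one \<open>A1\<close> over to \<open>q i\<close> gives
    0.\<close>
  have tq: "t \<bullet> q i = (if i = 3 then c3 else 0)" if i: "i < n" for i
  proof (cases "4 \<le> i")
    case True
    have A1A1t: "A1 *\<^sub>v (A1 *\<^sub>v t) = (- (L\<^sup>2)) \<cdot>\<^sub>v t"
      unfolding t_def by (rule square_vec[OF Ac(1) Ac(3) e sq(3)])
    have A1t: "A1 *\<^sub>v t \<in> carrier_vec n" using Ac c by simp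
    have "- (L\<^sup>2) * (t \<bullet> q i) = (A1 *\<^sub>v (A1 *\<^sub>v t)) \<bullet> q i" by (simp add: A1A1t smul c qc)
    also have "\<dots> = 0" unfolding dot1[OF A1t qc] ker[OF True i] using A1t by simp
    finally show ?thesis using True L0 by simp
  next
    case False
    then have "i < 4" by simp
    then show ?thesis
      using less_4_cases[of i] comm[OF e c(4)] comm[OF c(1,4)] comm[OF c(2,4)]
      by (auto simp: c3_def qf fs[simplified] smul e c et xt yt)
  qed
  have t_f: "t = c3 \<cdot>\<^sub>v f 3"
  proof (rule eq_vecI)
    fix s assume "s < dim_vec (c3 \<cdot>\<^sub>v f 3)"
    then have s: "s < n" using fc[of 3] by simp
    have vt: "vec n (($) t) = t" using c by (intro eq_vecI) auto
    have "t $ s = (\<Sum>i<n. hdot n (($) t) (g i) * g i s)" by (rule orthonormal_expand[OF g(1) s])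
    also have "\<dots> = (\<Sum>i<n. if i = 3 then c3 * g i s else 0)"
      by (intro sum.cong refl) (simp add: hq vt tq)
    also have "\<dots> = c3 * q 3 $ s" using n s by (simp add: q_def)
    finally show "t $ s = (c3 \<cdot>\<^sub>v f 3) $ s" using s qf[of 3] fc[of 3] by simp
  qed (use c fc[of 3] in simp)
  have "c3\<^sup>2 = L\<^sup>2"
    using tt ff[of 3 3] unfolding t_f by (simp add: smul fc power2_eq_square)
  then have "c3 = L \<or> c3 = - L" by (simp add: power2_eq_iff)
  \<comment> \<open>The length of \<open>t\<close> leaves the sign of \<open>c3\<close> open;
    \<open>s\<close> is chosen so that \<open>s * A3\<close> maps \<open>f 0\<close> to
    \<open>- L * f 3\<close>, as \<open>D3\<close> prescribes.\<close>
  then obtain s :: real where s: "s = 1 \<or> s = - 1" "complex_of_real s * c3 = - L"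
    by (metis mult_minus1 mult_1 of_real_1 of_real_minus minus_minus)
  let ?A3 = "complex_of_real s \<cdot>\<^sub>m A3"
  have A3c: "?A3 \<in> carrier_mat n n" using Ac by simp
  have sA3: "?A3 *\<^sub>v v = complex_of_real s \<cdot>\<^sub>v (A3 *\<^sub>v v)" if "v \<in> carrier_vec n" for v
    using that Ac(3) by (intro eq_vecI) auto
  \<comment> \<open>The other columns of \<open>A3\<close> follow from its anticommutation with
    \<open>A1\<close> and \<open>A2\<close>, since \<open>A3 e\<close> is known.\<close>
  have A3x: "A3 *\<^sub>v x = (- c3 * L) \<cdot>\<^sub>v f 2"
  proof -
    have "A1 *\<^sub>v t = (- 1) \<cdot>\<^sub>v (A3 *\<^sub>v x)"
      unfolding t_def x_def by (rule anticommute_vec[OF Ac(1) Ac(3) e anti(2)])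
    then have "(- 1) \<cdot>\<^sub>v (A1 *\<^sub>v t) = A3 *\<^sub>v x" by (simp add: smult_smult_assoc)
    then show ?thesis
      unfolding t_f mv[OF Ac(1) fc] A1f by (simp add: smult_smult_assoc)
  qed
  have A3y: "A3 *\<^sub>v y = (c3 * L) \<cdot>\<^sub>v f 1"
  proof -
    have "A2 *\<^sub>v t = (- 1) \<cdot>\<^sub>v (A3 *\<^sub>v y)"
      unfolding t_def y_def by (rule anticommute_vec[OF Ac(2) Ac(3) e anti(3)])
    then have "(- 1) \<cdot>\<^sub>v (A2 *\<^sub>v t) = A3 *\<^sub>v y" by (simp add: smult_smult_assoc)
    then show ?thesis
      unfolding t_f mv[OF Ac(2) fc] A2f by (simp add: smult_smult_assoc)
  qed
  have A3z: "A3 *\<^sub>v z = (- c3 * L\<^sup>2) \<cdot>\<^sub>v f 0"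
  proof -
    have "A1 *\<^sub>v (A3 *\<^sub>v y) = (- 1) \<cdot>\<^sub>v (A3 *\<^sub>v z)"
      unfolding z_def by (rule anticommute_vec[OF Ac(1) Ac(3) c(2) anti(2)])
    then have "(- 1) \<cdot>\<^sub>v (A1 *\<^sub>v (A3 *\<^sub>v y)) = A3 *\<^sub>v z" by (simp add: smult_smult_assoc)
    then show ?thesis
      unfolding A3y mv[OF Ac(1) fc] A1f by (simp add: smult_smult_assoc power2_eq_square mult.assoc)
  qed
  have "complex_of_real s * (c3 * k) = - L * k" "complex_of_real s * (- (c3 * k)) = L * k" for k
    using s(2) by (simp_all add: mult.assoc[symmetric])
  note sc = this
  have A3f: "?A3 *\<^sub>v f 0 = (- L) \<cdot>\<^sub>v f 3" "?A3 *\<^sub>v f 1 = (- L) \<cdot>\<^sub>v f 2" "?A3 *\<^sub>v f 2 = L \<cdot>\<^sub>v f 1" "?A3 *\<^sub>v f 3 = L \<cdot>\<^sub>v f 0"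
  proof -
    show "?A3 *\<^sub>v f 0 = (- L) \<cdot>\<^sub>v f 3"
      unfolding fs(1) sA3[OF e] t_def[symmetric] t_f smult_smult_assoc s(2) by (rule refl)
    have "?A3 *\<^sub>v f 1 = (complex_of_real s * (c3 * 1)) \<cdot>\<^sub>v f 2"
      unfolding fs(2) mv[OF A3c c(1)] sA3[OF c(1)] A3x smult_smult_assoc
      by (rule arg_cong[where f = "\<lambda>k. k \<cdot>\<^sub>v _"]) (use L0 in \<open>simp add: power2_eq_square\<close>)
    then show "?A3 *\<^sub>v f 1 = (- L) \<cdot>\<^sub>v f 2" unfolding sc by simp
    have "?A3 *\<^sub>v f 2 = (complex_of_real s * (- (c3 * 1))) \<cdot>\<^sub>v f 1"
      unfolding fs(3) mv[OF A3c c(2)] sA3[OF c(2)] A3y smult_smult_assoc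
      by (rule arg_cong[where f = "\<lambda>k. k \<cdot>\<^sub>v _"]) (use L0 in \<open>simp add: power2_eq_square\<close>)
    then show "?A3 *\<^sub>v f 2 = L \<cdot>\<^sub>v f 1" unfolding sc by simp
    have "?A3 *\<^sub>v f 3 = (complex_of_real s * (- (c3 * 1))) \<cdot>\<^sub>v f 0"
      unfolding fs(4) mv[OF A3c c(3)] sA3[OF c(3)] A3z smult_smult_assoc
      by (rule arg_cong[where f = "\<lambda>k. k \<cdot>\<^sub>v _"]) (use L0 in \<open>simp add: power2_eq_square\<close>)
    then show "?A3 *\<^sub>v f 3 = L \<cdot>\<^sub>v f 0" unfolding sc by simp
  qed
  have M3: "mat_adjoint P * ?A3 * P = diag_zero n (D3 L)"
  proof (rule conjugation_block[OF A3c P n])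
    have "frob_sq ?A3 = frob_sq A3"
      using s(1) by (subst frob_sq_smult[OF Ac(3)]) auto
    then show "(\<Sum>a<4. \<Sum>b<4. (cmod (D3 L $$ (a, b)))\<^sup>2) = frob_sq ?A3"
      unfolding fr nL by (simp add: sum_less_4 D3_columns)
    show "(mat_adjoint P * ?A3 * P) $$ (a, b) = (if a < 4 then D3 L $$ (a, b) else 0)" if ab: "a < n" "b < 4" for a b
      using less_4_cases[OF ab(2)] column[OF A3c ab(1) four(1,4) A3f(1)] column[OF A3c ab(1) four(2,3) A3f(2)]
        column[OF A3c ab(1) four(3,2) A3f(3)] column[OF A3c ab(1) four(4,1) A3f(4)]
      by (elim disjE; simp add: D3_columns del: index_mult_mat(1))
  qed simp
  show ?thesis
    using that[OF P rP s(1)] M1 M2 M3 unfolding L_def by blast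
qed

subsection \<open>The group action\<close>

lemma length_K_act [simp]: "length (K_act PR As) = length As"
  by (simp add: K_act_def split: prod.split)

lemma K_act_nth:
  assumes "P \<in> carrier_mat n n" "l < length As"
  shows "K_act (P, R) As ! l = comb n (length As) (\<lambda>j. R $$ (j, l)) (\<lambda>j. mat_adjoint P * As ! j * P)"
  using assms carrier_matD[OF assms(1)] by (simp add: K_act_def comb_def)

lemma conjugate_comb:
  assumes P: "P \<in> carrier_mat n n" and A: "\<And>j. j < k \<Longrightarrow> A j \<in> carrier_mat n n"
  shows "comb n k c (\<lambda>j. mat_adjoint P * A j * P) = mat_adjoint P * comb n k c A * P"
proof -
  have "mat_adjoint P * comb n k c A = comb n k c (\<lambda>j. mat_adjoint P * A j)"
    by (rule comb_mult_left[OF A]) (use P in auto)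
  then have "mat_adjoint P * comb n k c A * P = comb n k c (\<lambda>j. mat_adjoint P * A j) * P" by simp
  also have "\<dots> = comb n k c (\<lambda>j. mat_adjoint P * A j * P)"
    by (rule comb_mult_right) (use P A in auto)
  finally show ?thesis by simp
qed

lemma unitary_group_iff: "P \<in> unitary_group n \<longleftrightarrow> unitary n P"
  using mat_mult_left_right_inverse[of "mat_adjoint P" n P]
  by (auto simp: unitary_group_def unitary_def)

lemma orthogonal_group_columns:
  assumes "R \<in> orthogonal_group k"
  shows "real_orthonormal k k (\<lambda>l j. R $$ (j, l))"
  unfolding real_orthonormal_def
proof (intro allI impI)
  fix i j assume ij: "i < k" "j < k"
  have R: "R \<in> carrier_mat k k" "transpose_mat R * R = 1\<^sub>m k"
    using assms by (auto simp: orthogonal_group_def)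
  have "(transpose_mat R * R) $$ (i, j) = (\<Sum>t<k. R $$ (t, i) * R $$ (t, j))"
    using R(1) ij by (subst mat_mult_entry[of _ k k _ k]) auto
  then show "(\<Sum>t<k. R $$ (t, i) * R $$ (t, j)) = (if i = j then 1 else 0)"
    using R(2) ij by simp
qed

lemma orthogonal_groupI:
  assumes "real_orthonormal k k \<sigma>"
  shows "mat k k (\<lambda>(j, l). \<sigma> l j) \<in> orthogonal_group k"
proof -
  let ?R = "mat k k (\<lambda>(j, l). \<sigma> l j)"
  have "(transpose_mat ?R * ?R) $$ (i, j) = 1\<^sub>m k $$ (i, j)" if ij: "i < k" "j < k" for i j
  proof -
    have "(transpose_mat ?R * ?R) $$ (i, j) = (\<Sum>t<k. \<sigma> i t * \<sigma> j t)"
      using ij by (subst mat_mult_entry[of _ k k _ k]) auto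
    then show ?thesis using assms ij by (simp add: real_orthonormal_def)
  qed
  then have "transpose_mat ?R * ?R = 1\<^sub>m k" by (intro eq_matI) auto
  then show ?thesis by (simp add: orthogonal_group_def)
qed

lemma real_unitary_orthogonal:
  assumes P: "unitary n P" and real: "mat_cnj P = P"
  shows "P \<in> orthogonal_in_unitary n"
proof -
  have Pc: "P \<in> carrier_mat n n" and PP: "mat_adjoint P * P = 1\<^sub>m n" using P by (auto simp: unitary_def)
  note d = carrier_matD[OF Pc]
  have "cnj (P $$ (i, j)) = P $$ (i, j)" if "i < n" "j < n" for i j
    using mat_cnj_entry[of i P j] that d real by simp
  then have Re: "complex_of_real (Re (P $$ (i, j))) = P $$ (i, j)" if "i < n" "j < n" for i j
    using that by (simp add: complex_eq_iff)
  define Q where "Q = map_mat Re P"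
  have Qc: "Q \<in> carrier_mat n n" using Pc by (simp add: Q_def)
  have PQ: "P = map_mat complex_of_real Q"
    using d Re by (intro eq_matI) (auto simp: Q_def)
  have "(transpose_mat Q * Q) $$ (i, j) = 1\<^sub>m n $$ (i, j)" if ij: "i < n" "j < n" for i j
  proof -
    have "complex_of_real ((transpose_mat Q * Q) $$ (i, j)) = (\<Sum>t<n. complex_of_real (Q $$ (t, i)) * complex_of_real (Q $$ (t, j)))"
      using Qc ij by (subst mat_mult_entry[of _ n n _ n]) auto
    also have "\<dots> = (\<Sum>t<n. mat_adjoint P $$ (i, t) * P $$ (t, j))"
    proof (intro sum.cong refl)
      fix t assume "t \<in> {..<n}"
      then have "t < n" by simp
      then show "complex_of_real (Q $$ (t, i)) * complex_of_real (Q $$ (t, j)) = mat_adjoint P $$ (i, t) * P $$ (t, j)"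
        using ij d Qc by (simp add: mat_adjoint_entry PQ)
    qed
    also have "\<dots> = (mat_adjoint P * P) $$ (i, j)"
      using Pc ij by (intro mat_mult_entry[symmetric]) auto
    also have "\<dots> = complex_of_real (1\<^sub>m n $$ (i, j))" using PP ij by simp
    finally show ?thesis by (simp only: of_real_eq_iff)
  qed
  then have "transpose_mat Q * Q = 1\<^sub>m n" using Qc by (intro eq_matI) auto
  then have "Q \<in> orthogonal_group n" using Qc by (simp add: orthogonal_group_def)
  then show ?thesis unfolding orthogonal_in_unitary_def PQ by (rule imageI)
qed

lemma commutator_conjugate:
  assumes P: "unitary n P" and X: "X \<in> carrier_mat n n" and Y: "Y \<in> carrier_mat n n"
  shows "commutator (mat_adjoint P * X * P) (mat_adjoint P * Y * P) = mat_adjoint P * commutator X Y * P"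
proof -
  have c: "P \<in> carrier_mat n n" "mat_adjoint P \<in> carrier_mat n n" "P * mat_adjoint P = 1\<^sub>m n"
    using P by (auto simp: unitary_def)
  have m: "(mat_adjoint P * U * P) * (mat_adjoint P * V * P) = mat_adjoint P * (U * V) * P"
    if "U \<in> carrier_mat n n" "V \<in> carrier_mat n n" for U V
  proof -
    have "(mat_adjoint P * U * P) * (mat_adjoint P * V * P) = mat_adjoint P * U * (P * mat_adjoint P) * (V * P)"
      using c(1,2) that by (simp add: square_mult_assoc[of _ n])
    also have "\<dots> = mat_adjoint P * (U * V) * P"
      unfolding c(3) using c(1,2) that by (simp add: square_mult_assoc[of _ n])
    finally show ?thesis .
  qed
  have XY: "X * Y \<in> carrier_mat n n" "Y * X \<in> carrier_mat n n" "mat_adjoint P * (X * Y) \<in> carrier_mat n n"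
    "mat_adjoint P * (Y * X) \<in> carrier_mat n n" using X Y c by auto
  show ?thesis
    unfolding commutator_def m[OF X Y] m[OF Y X] mult_minus_distrib_mat[OF c(2) XY(1,2)]
    by (rule minus_mult_distrib_mat[OF XY(3,4) c(1), symmetric])
qed

lemma sum_first_three:
  fixes f :: "nat \<Rightarrow> 'a :: comm_monoid_add"
  assumes "3 \<le> k" "\<And>l. 3 \<le> l \<Longrightarrow> l < k \<Longrightarrow> f l = 0"
  shows "(\<Sum>l<k. f l) = (\<Sum>l<3. f l)"
  using assms by (intro sum.mono_neutral_right) auto

lemma sum_less_3: "(\<Sum>a<3. f a) = f 0 + f 1 + f (2 :: nat)"
  by (simp add: eval_nat_numeral add_ac)

text \<open>The action is a conjugation followed by an orthogonal change, both of which preserve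
  these sums, so they can be evaluated on the normal form. This serves the sufficiency direction of
  both equality statements.\<close>

lemma K_act_sums:
  assumes k: "3 \<le> length As" and As: "\<And>j. j < length As \<Longrightarrow> As ! j \<in> carrier_mat n n"
    and PR: "(P, R) \<in> K_group n (length As)"
    and eq: "K_act (P, R) As = [E 0, E 1, E 2] @ replicate (length As - 3) (0\<^sub>m n n)"
  shows "(\<Sum>i<length As. \<Sum>j<length As. frob_sq (commutator (As ! i) (As ! j))) =
      (\<Sum>i<3. \<Sum>j<3. frob_sq (commutator (E i) (E (j :: nat))))"
    and "(\<Sum>j<length As. frob_sq (As ! j)) = (\<Sum>i<3. frob_sq (E i))"
proof -
  let ?k = "length As"
  let ?X = "\<lambda>j. mat_adjoint P * As ! j * P"
  let ?F = "\<lambda>l. comb n ?k (\<lambda>j. R $$ (j, l)) ?X"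
  have P: "unitary n P" and R: "real_orthonormal ?k ?k (\<lambda>l j. R $$ (j, l))"
    using PR orthogonal_group_columns by (auto simp: K_group_def unitary_group_iff)
  have Pc: "P \<in> carrier_mat n n" using P by (simp add: unitary_def)
  have Xc: "?X j \<in> carrier_mat n n" if "j < ?k" for j using As[OF that] Pc by simp
  have F: "?F l = (if l < 3 then E l else 0\<^sub>m n n)" if l: "l < ?k" for l
  proof -
    have "?F l = ([E 0, E 1, E 2] @ replicate (?k - 3) (0\<^sub>m n n)) ! l"
      unfolding eq[symmetric] by (rule K_act_nth[OF Pc l, symmetric])
    moreover have "l = 0 \<or> l = 1 \<or> l = 2" if "l < 3" using that by linarith
    ultimately show ?thesis using l by (auto simp: nth_append)
  qed
  have E: "E l \<in> carrier_mat n n" if "l < 3" for l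
    using F[of l] that k comb_carrier[of n ?k "\<lambda>j. R $$ (j, l)" ?X] by simp
  have z: "frob_sq (commutator X (0\<^sub>m n n)) = 0" "frob_sq (commutator (0\<^sub>m n n) X) = 0"
    if "X \<in> carrier_mat n n" for X
  proof -
    have "commutator X (0\<^sub>m n n) = 0\<^sub>m n n" "commutator (0\<^sub>m n n) X = 0\<^sub>m n n"
      using that by (auto simp: commutator_def)
    then show "frob_sq (commutator X (0\<^sub>m n n)) = 0" "frob_sq (commutator (0\<^sub>m n n) X) = 0" by simp_all
  qed
  have zl: "frob_sq (commutator (?F l) (?F p)) = 0" "frob_sq (commutator (?F p) (?F l)) = 0"
    if "3 \<le> l" "l < ?k" for l p
    using F[OF that(2)] that z[OF comb_carrier] by simp_all
  have "(\<Sum>i<?k. \<Sum>j<?k. frob_sq (commutator (As ! i) (As ! j))) = (\<Sum>i<?k. \<Sum>j<?k. frob_sq (commutator (?X i) (?X j)))"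
  proof (intro sum.cong refl)
    fix i j assume "i \<in> {..<?k}" "j \<in> {..<?k}"
    then have c: "As ! i \<in> carrier_mat n n" "As ! j \<in> carrier_mat n n" using As by auto
    show "frob_sq (commutator (As ! i) (As ! j)) = frob_sq (commutator (?X i) (?X j))"
      unfolding commutator_conjugate[OF P c]
      by (rule frob_sq_unitary[OF unitary_adjoint[OF P] P, symmetric]) (use c in simp)
  qed
  also have "\<dots> = (\<Sum>l<?k. \<Sum>p<?k. frob_sq (commutator (?F l) (?F p)))"
    by (rule sum_commutator_comb[OF R Xc, symmetric])
  also have "\<dots> = (\<Sum>l<3. \<Sum>p<?k. frob_sq (commutator (?F l) (?F p)))"
    by (rule sum_first_three[OF k]) (simp add: zl)
  also have "\<dots> = (\<Sum>l<3. \<Sum>p<3. frob_sq (commutator (?F l) (?F p)))"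
    by (rule sum.cong[OF refl], rule sum_first_three[OF k]) (simp add: zl)
  also have "\<dots> = (\<Sum>i<3. \<Sum>j<3. frob_sq (commutator (E i) (E j)))"
    using k by (intro sum.cong refl) (simp add: F)
  finally show "(\<Sum>i<?k. \<Sum>j<?k. frob_sq (commutator (As ! i) (As ! j))) =
      (\<Sum>i<3. \<Sum>j<3. frob_sq (commutator (E i) (E j)))" .
  have "(\<Sum>j<?k. frob_sq (As ! j)) = (\<Sum>j<?k. frob_sq (?X j))"
    using As by (intro sum.cong refl frob_sq_unitary[OF unitary_adjoint[OF P] P, symmetric]) auto
  also have "\<dots> = (\<Sum>l<?k. frob_sq (?F l))"
    by (rule sum_frob_comb[OF R Xc, symmetric])
  also have "\<dots> = (\<Sum>l<3. frob_sq (?F l))"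
    by (rule sum_first_three[OF k]) (simp add: F)
  also have "\<dots> = (\<Sum>i<3. frob_sq (E i))"
    using k by (intro sum.cong refl) (simp add: F)
  finally show "(\<Sum>j<?k. frob_sq (As ! j)) = (\<Sum>i<3. frob_sq (E i))" .
qed

text \<open>Only the first three columns of \<open>R\<close> matter: any orthogonal completion kills the remaining
  entries, since the Frobenius norm is already exhausted.\<close>

lemma K_act_exists:
  assumes k: "3 \<le> length As" and As: "\<And>j. j < length As \<Longrightarrow> As ! j \<in> carrier_mat n n"
    and P: "unitary n P" "mat_cnj P = P"
    and \<sigma>: "real_orthonormal (length As) 3 \<sigma>"
    and E: "\<And>i. i < 3 \<Longrightarrow> mat_adjoint P * comb n (length As) (\<sigma> i) ((!) As) * P = E i"
    and total: "(\<Sum>i<3. frob_sq (E i)) = (\<Sum>j<length As. frob_sq (As ! j))"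
  shows "\<exists>R. (P, R) \<in> K_group n (length As) \<and> P \<in> orthogonal_in_unitary n \<and>
    K_act (P, R) As = [E 0, E 1, E (2 :: nat)] @ replicate (length As - 3) (0\<^sub>m n n)"
proof -
  let ?k = "length As"
  obtain \<tau> where \<tau>: "real_orthonormal ?k ?k \<tau>" "\<forall>i<3. \<tau> i = \<sigma> i"
    by (rule real_orthonormal_extend[OF \<sigma> k])
  define R where "R = mat ?k ?k (\<lambda>(j, l). \<tau> l j)"
  have Pc: "P \<in> carrier_mat n n" using P by (simp add: unitary_def)
  have act: "K_act (P, R) As ! l = mat_adjoint P * comb n ?k (\<tau> l) ((!) As) * P" if l: "l < ?k" for l
  proof -
    have "comb n ?k (\<lambda>j. R $$ (j, l)) ((!) As) = comb n ?k (\<tau> l) ((!) As)"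
      using l by (intro comb_cong) (auto simp: R_def)
    then show ?thesis
      unfolding K_act_nth[OF Pc l] using conjugate_comb[OF Pc, of ?k "(!) As"] As by simp
  qed
  have fr: "frob_sq (K_act (P, R) As ! l) = frob_sq (comb n ?k (\<tau> l) ((!) As))" if "l < ?k" for l
    unfolding act[OF that] by (rule frob_sq_unitary[OF unitary_adjoint[OF P(1)] P(1)]) simp
  have low: "K_act (P, R) As ! i = E i" if "i < 3" for i
    using act[of i] E[OF that] \<tau>(2) that k by simp
  have "(\<Sum>l<?k. frob_sq (K_act (P, R) As ! l)) = (\<Sum>j<?k. frob_sq (As ! j))"
    using sum_frob_comb[OF \<tau>(1), of "(!) As" n] As fr by simp
  also have "\<dots> = (\<Sum>l<3. frob_sq (K_act (P, R) As ! l))"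
    unfolding total[symmetric] by (simp add: low)
  also have "(\<Sum>l<?k. frob_sq (K_act (P, R) As ! l)) =
      (\<Sum>l<3. frob_sq (K_act (P, R) As ! l)) + (\<Sum>l\<in>{3..<?k}. frob_sq (K_act (P, R) As ! l))"
    using k by (subst sum.union_disjoint[symmetric]) (auto intro!: sum.cong)
  finally have "(\<Sum>l\<in>{3..<?k}. frob_sq (K_act (P, R) As ! l)) = 0" by simp
  then have "\<forall>l\<in>{3..<?k}. frob_sq (K_act (P, R) As ! l) = 0"
    by (subst (asm) sum_nonneg_eq_0_iff) (auto simp: frob_sq_nonneg)
  then have high: "K_act (P, R) As ! l = 0\<^sub>m n n" if "3 \<le> l" "l < ?k" for l
  proof -
    have "K_act (P, R) As ! l \<in> carrier_mat n n" unfolding K_act_nth[OF Pc that(2)] by simp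
    moreover have "frob_sq (K_act (P, R) As ! l) = 0"
      using \<open>\<forall>l\<in>{3..<?k}. frob_sq (K_act (P, R) As ! l) = 0\<close> that by simp
    ultimately show ?thesis using frob_sq_eq_0_iff by blast
  qed
  have "K_act (P, R) As = [E 0, E 1, E 2] @ replicate (?k - 3) (0\<^sub>m n n)"
  proof (rule nth_equalityI)
    show "length (K_act (P, R) As) = length ([E 0, E 1, E 2] @ replicate (?k - 3) (0\<^sub>m n n))" using k by simp
    fix l assume "l < length (K_act (P, R) As)"
    then have l: "l < ?k" by simp
    have "l = 0 \<or> l = 1 \<or> l = 2 \<or> 3 \<le> l" by linarith
    then show "K_act (P, R) As ! l = ([E 0, E 1, E 2] @ replicate (?k - 3) (0\<^sub>m n n)) ! l"
      using l low[of 0] low[of 1] low[of 2] high[of l] by (auto simp: nth_append)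
  qed
  moreover have "(P, R) \<in> K_group n ?k"
    using P orthogonal_groupI[OF \<tau>(1)] by (simp add: K_group_def unitary_group_iff R_def)
  ultimately show ?thesis using real_unitary_orthogonal[OF P] by blast
qed

subsection \<open>The extremal triples\<close>

lemma frob_sq_diag_zero:
  assumes C: "C \<in> carrier_mat d d" and d: "d \<le> n"
  shows "frob_sq (diag_zero n C) = frob_sq C"
proof -
  have "frob_sq (diag_zero n C) = (\<Sum>a<n. \<Sum>b<n. if a < d then if b < d then (cmod (C $$ (a, b)))\<^sup>2 else 0 else 0)"
    unfolding frob_sq_entries[OF diag_zero_carrier[OF C d]]
    by (intro sum.cong refl) (auto simp: diag_zero_entry[OF C d])
  also have "\<dots> = (\<Sum>a<n. if a < d then \<Sum>b<n. if b < d then (cmod (C $$ (a, b)))\<^sup>2 else 0 else 0)"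
    by (rule sum.cong[OF refl]) simp
  also have "\<dots> = frob_sq C"
    by (simp only: sum_truncate[OF d] frob_sq_entries[OF C])
  finally show ?thesis .
qed

lemma commutator_diag_zero:
  assumes C: "C \<in> carrier_mat d d" and D: "D \<in> carrier_mat d d" and d: "d \<le> n"
  shows "commutator (diag_zero n C) (diag_zero n D) = diag_zero n (commutator C D)"
proof -
  note z = diag_zero_carrier[OF C d] diag_zero_carrier[OF D d]
  have m: "(diag_zero n X * diag_zero n Y) $$ (a, b) = (if a < d \<and> b < d then (X * Y) $$ (a, b) else 0)"
    if X: "X \<in> carrier_mat d d" and Y: "Y \<in> carrier_mat d d" and ab: "a < n" "b < n" for X Y a b
  proof -
    have "(diag_zero n X * diag_zero n Y) $$ (a, b) = (\<Sum>t<n. diag_zero n X $$ (a, t) * diag_zero n Y $$ (t, b))"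
      by (rule mat_mult_entry[OF diag_zero_carrier[OF X d] diag_zero_carrier[OF Y d] ab])
    also have "\<dots> = (\<Sum>t<n. if t < d then (if a < d \<and> b < d then X $$ (a, t) * Y $$ (t, b) else 0) else 0)"
      using ab by (intro sum.cong refl) (auto simp: diag_zero_entry[OF X d] diag_zero_entry[OF Y d])
    also have "\<dots> = (\<Sum>t<d. if a < d \<and> b < d then X $$ (a, t) * Y $$ (t, b) else 0)"
      by (rule sum_truncate[OF d])
    also have "\<dots> = (if a < d \<and> b < d then (X * Y) $$ (a, b) else 0)"
      using mat_mult_entry[OF X Y] by (cases "a < d \<and> b < d") (auto simp del: index_mult_mat(1))
    finally show ?thesis .
  qed
  have CD: "commutator C D \<in> carrier_mat d d" using C D by simp
  show ?thesis
  proof (rule eq_matI)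
    fix a b assume "a < dim_row (diag_zero n (commutator C D))" "b < dim_col (diag_zero n (commutator C D))"
    then have ab: "a < n" "b < n" using carrier_matD[OF diag_zero_carrier[OF CD d]] by simp_all
    have "commutator (diag_zero n C) (diag_zero n D) $$ (a, b) =
        (diag_zero n C * diag_zero n D) $$ (a, b) - (diag_zero n D * diag_zero n C) $$ (a, b)"
      unfolding commutator_def using ab z by (intro index_minus_mat) auto
    also have "\<dots> = diag_zero n (commutator C D) $$ (a, b)"
      unfolding m[OF C D ab] m[OF D C ab] diag_zero_entry[OF CD d ab]
      using C D by (auto simp: commutator_def)
    finally show "commutator (diag_zero n C) (diag_zero n D) $$ (a, b) = diag_zero n (commutator C D) $$ (a, b)" .
  qed (use carrier_matD[OF diag_zero_carrier[OF CD d]] carrier_matD[OF z(1)] carrier_matD[OF z(2)] in \<open>auto simp: commutator_def\<close>)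
qed

lemma frob_commutator_entries:
  assumes "X \<in> carrier_mat d d" "Y \<in> carrier_mat d d"
  shows "frob_sq (commutator X Y) =
    (\<Sum>a<d. \<Sum>b<d. (cmod ((\<Sum>t<d. X $$ (a, t) * Y $$ (t, b)) - (\<Sum>t<d. Y $$ (a, t) * X $$ (t, b))))\<^sup>2)"
proof -
  have "commutator X Y $$ (a, b) = (\<Sum>t<d. X $$ (a, t) * Y $$ (t, b)) - (\<Sum>t<d. Y $$ (a, t) * X $$ (t, b))"
    if "a < d" "b < d" for a b
  proof -
    have "commutator X Y $$ (a, b) = (X * Y) $$ (a, b) - (Y * X) $$ (a, b)"
      unfolding commutator_def using that assms by (intro index_minus_mat) auto
    then show ?thesis
      by (simp only: mat_mult_entry[OF assms that] mat_mult_entry[OF assms(2,1) that])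
  qed
  then show ?thesis
    unfolding frob_sq_entries[OF commutator_carrier[OF assms]] by (intro sum.cong refl) simp
qed

lemma sum_commutators_three:
  assumes "\<And>i. i < 3 \<Longrightarrow> E i \<in> carrier_mat n n"
  shows "(\<Sum>i<3. \<Sum>j<3. frob_sq (commutator (E i) (E (j :: nat)))) =
    2 * (frob_sq (commutator (E 0) (E 1)) + frob_sq (commutator (E 0) (E 2)) + frob_sq (commutator (E 1) (E 2)))"
  using frob_commutator_sym[of "E 0" n "E 1"] frob_commutator_sym[of "E 0" n "E 2"]
    frob_commutator_sym[of "E 1" n "E 2"] assms[of 0] assms[of 1] assms[of 2]
  by (simp add: sum_less_3 frob_commutator_self)

text \<open>The three matrices are indexed by 0, 1, 2, the form in which \<open>K_act_sums\<close>
  and \<open>K_act_exists\<close> expect \<open>E\<close>.\<close>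

definition D_triple :: "nat \<Rightarrow> complex \<Rightarrow> nat \<Rightarrow> complex mat" where
  "D_triple n x i = diag_zero n (if i = 0 then D1 x else if i = 1 then D2 x else D3 x)"

lemma D_triple_simps: "D_triple n x 0 = diag_zero n (D1 x)" "D_triple n x 1 = diag_zero n (D2 x)"
  "D_triple n x 2 = diag_zero n (D3 x)"
  by (simp_all add: D_triple_def)

lemma frob_sq_D: "frob_sq (D1 x) = 4 * (cmod x)\<^sup>2" "frob_sq (D2 x) = 4 * (cmod x)\<^sup>2" "frob_sq (D3 x) = 4 * (cmod x)\<^sup>2"
  by (simp_all add: frob_sq_entries[of _ 4 4] sum_less_4 D1_columns D2_columns D3_columns)

lemma frob_commutator_D:
  "frob_sq (commutator (D1 x) (D2 x)) = 16 * (cmod x) ^ 4"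
  "frob_sq (commutator (D1 x) (D3 x)) = 16 * (cmod x) ^ 4"
  "frob_sq (commutator (D2 x) (D3 x)) = 16 * (cmod x) ^ 4"
proof -
  have x: "- (x * x) - x * x = - 2 * (x * x)" "x * x + x * x = 2 * (x * x)" by simp_all
  show "frob_sq (commutator (D1 x) (D2 x)) = 16 * (cmod x) ^ 4"
    "frob_sq (commutator (D1 x) (D3 x)) = 16 * (cmod x) ^ 4"
    "frob_sq (commutator (D2 x) (D3 x)) = 16 * (cmod x) ^ 4"
    by (simp_all add: frob_commutator_entries[of _ 4] sum_less_4 D1_columns D2_columns D3_columns x norm_mult power2_eq_square power4_eq_xxxx)
qed

text \<open>Six ordered pairs contribute \<open>16 * |x|^4\<close> each, and
  \<open>96 = 2/3 * 12^2\<close>: the triple attains the bound with constant 2/3.\<close>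

lemma D_triple_sums:
  assumes n: "4 \<le> n"
  shows "(\<Sum>i<3. \<Sum>j<3. frob_sq (commutator (D_triple n x i) (D_triple n x j))) = 96 * (cmod x) ^ 4"
    and "(\<Sum>i<3. frob_sq (D_triple n x i)) = 12 * (cmod x)\<^sup>2"
proof -
  have c: "D_triple n x i \<in> carrier_mat n n" for i
    using n by (auto simp: D_triple_def intro!: diag_zero_carrier[of _ 4])
  show "(\<Sum>i<3. \<Sum>j<3. frob_sq (commutator (D_triple n x i) (D_triple n x j))) = 96 * (cmod x) ^ 4"
    unfolding sum_commutators_three[OF c] D_triple_simps
    using n by (simp add: commutator_diag_zero[of _ 4] frob_sq_diag_zero[of _ 4] frob_commutator_D)
  show "(\<Sum>i<3. frob_sq (D_triple n x i)) = 12 * (cmod x)\<^sup>2"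
    unfolding sum_less_3 D_triple_simps using n by (simp add: frob_sq_diag_zero[of _ 4] frob_sq_D)
qed

definition C_triple :: "nat \<Rightarrow> complex \<Rightarrow> nat \<Rightarrow> complex mat" where
  "C_triple n x i = diag_zero n (if i = 0 then C1 x else if i = 1 then C2 x else C3 x)"

lemma C_triple_simps: "C_triple n x 0 = diag_zero n (C1 x)" "C_triple n x 1 = diag_zero n (C2 x)"
  "C_triple n x 2 = diag_zero n (C3 x)"
  by (simp_all add: C_triple_def)

lemma C_carrier [simp]: "C1 x \<in> carrier_mat 3 3" "C2 x \<in> carrier_mat 3 3" "C3 x \<in> carrier_mat 3 3"
  by (intro carrier_matI; simp add: C1_def C2_def C3_def mat_of_rows_list_def)+

lemma less_3_cases: "a < 3 \<Longrightarrow> a = 0 \<or> a = 1 \<or> a = (2 :: nat)"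
  by linarith

lemma C_entries:
  assumes "a < 3" "b < 3"
  shows "C1 x $$ (a, b) = (if a = 0 \<and> b = 1 then x else if a = 1 \<and> b = 0 then - x else 0)"
    "C2 x $$ (a, b) = (if a = 0 \<and> b = 2 then x else if a = 2 \<and> b = 0 then - x else 0)"
    "C3 x $$ (a, b) = (if a = 1 \<and> b = 2 then x else if a = 2 \<and> b = 1 then - x else 0)"
  using less_3_cases[OF assms(1)] less_3_cases[OF assms(2)]
  by (elim disjE; simp add: C1_def C2_def C3_def mat_of_rows_list_def)+

lemma frob_sq_C: "frob_sq (C1 x) = 2 * (cmod x)\<^sup>2" "frob_sq (C2 x) = 2 * (cmod x)\<^sup>2" "frob_sq (C3 x) = 2 * (cmod x)\<^sup>2"
  by (simp_all add: frob_sq_entries[of _ 3 3] sum_less_3 C_entries)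

lemma frob_commutator_C:
  "frob_sq (commutator (C1 x) (C2 x)) = 2 * (cmod x) ^ 4"
  "frob_sq (commutator (C1 x) (C3 x)) = 2 * (cmod x) ^ 4"
  "frob_sq (commutator (C2 x) (C3 x)) = 2 * (cmod x) ^ 4"
  by (simp_all add: frob_commutator_entries[of _ 3] sum_less_3 C_entries norm_mult power2_eq_square power4_eq_xxxx)

text \<open>Six ordered pairs contribute \<open>2 * |x|^4\<close> each, and
  \<open>12 = 1/3 * 6^2\<close>: the triple attains the bound with constant 1/3.\<close>

lemma C_triple_sums:
  assumes n: "3 \<le> n"
  shows "(\<Sum>i<3. \<Sum>j<3. frob_sq (commutator (C_triple n x i) (C_triple n x j))) = 12 * (cmod x) ^ 4"
    and "(\<Sum>i<3. frob_sq (C_triple n x i)) = 6 * (cmod x)\<^sup>2"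
proof -
  have c: "C_triple n x i \<in> carrier_mat n n" for i
    using n by (auto simp: C_triple_def intro!: diag_zero_carrier[of _ 3])
  show "(\<Sum>i<3. \<Sum>j<3. frob_sq (commutator (C_triple n x i) (C_triple n x j))) = 12 * (cmod x) ^ 4"
    unfolding sum_commutators_three[OF c] C_triple_simps
    using n by (simp add: commutator_diag_zero[of _ 3] frob_sq_diag_zero[of _ 3] frob_commutator_C)
  show "(\<Sum>i<3. frob_sq (C_triple n x i)) = 6 * (cmod x)\<^sup>2"
    unfolding sum_less_3 C_triple_simps using n by (simp add: frob_sq_diag_zero[of _ 3] frob_sq_C)
qed

subsection \<open>Reduction to real tuples\<close>

lemma mat_trace_diff:
  "X \<in> carrier_mat n n \<Longrightarrow> Y \<in> carrier_mat n n \<Longrightarrow> mat_trace (X - Y) = mat_trace X - mat_trace Y"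
  by (auto simp: mat_trace_def sum_subtractf[symmetric] intro!: sum.cong)

lemma real_skew_commutator:
  assumes X: "real_skew n X" and Y: "real_skew n Y"
  shows "real_skew n (commutator X Y)"
proof (rule real_skewI)
  note c = real_skewD(1)[OF X] real_skewD(1)[OF Y]
  fix i j assume ij: "i < n" "j < n"
  have e: "commutator X Y $$ (a, b) = (\<Sum>t<n. X $$ (a, t) * Y $$ (t, b)) - (\<Sum>t<n. Y $$ (a, t) * X $$ (t, b))"
    if "a < n" "b < n" for a b
  proof -
    have "commutator X Y $$ (a, b) = (X * Y) $$ (a, b) - (Y * X) $$ (a, b)"
      unfolding commutator_def using that c by (intro index_minus_mat) auto
    then show ?thesis
      by (simp only: mat_mult_entry[OF c that] mat_mult_entry[OF c(2,1) that])
  qed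
  have swap: "(\<Sum>t<n. U $$ (j, t) * V $$ (t, i)) = (\<Sum>t<n. V $$ (i, t) * U $$ (t, j))"
    if U: "real_skew n U" and V: "real_skew n V" for U V
  proof (intro sum.cong refl)
    fix t assume "t \<in> {..<n}"
    then have t: "t < n" by simp
    show "U $$ (j, t) * V $$ (t, i) = V $$ (i, t) * U $$ (t, j)"
      using real_skewD(2)[OF U t ij(2)] real_skewD(2)[OF V ij(1) t] by simp
  qed
  show "commutator X Y $$ (j, i) = - commutator X Y $$ (i, j)"
    unfolding e[OF ij] e[OF ij(2,1)] swap[OF X Y] swap[OF Y X] by simp
  show "cnj (commutator X Y $$ (i, j)) = commutator X Y $$ (i, j)"
    unfolding e[OF ij] using real_skewD(3)[OF X] real_skewD(3)[OF Y] ij by simp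
qed (use real_skewD(1)[OF X] real_skewD(1)[OF Y] in simp)

lemma fip_real_skew:
  assumes "X \<in> carrier_mat n n" "real_skew n Y"
  shows "fip X Y = - mat_trace (X * Y)"
proof -
  have "X * (- Y) = - (X * Y)" using assms(1) real_skewD(1)[OF assms(2)] by simp
  moreover have "mat_trace (- (X * Y)) = - mat_trace (X * Y)"
    using assms(1) real_skewD(1)[OF assms(2)] by (auto simp: mat_trace_def sum_negf[symmetric] intro!: sum.cong)
  ultimately show ?thesis by (simp add: fip_def real_skewD(4)[OF assms(2)])
qed

text \<open>By invariance of the trace form this is the Jacobi identity for \<open>a\<close>,
  \<open>b\<close>, \<open>c\<close> paired with \<open>d\<close>. The proof expands into words of
  length four and rotates each of them to begin with \<open>a\<close>.\<close>

lemma jacobi_fip: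
  assumes "real_skew n a" "real_skew n b" "real_skew n c" "real_skew n d"
  shows "fip (commutator a b) (commutator c d) + fip (commutator b c) (commutator a d)
    + fip (commutator c a) (commutator b d) = 0"
proof -
  define t where "t w x y z = mat_trace (w * (x * (y * z)))" for w x y z :: "complex mat"
  have cyc: "t w x y z = t x y z w"
    if "w \<in> carrier_mat n n" "x \<in> carrier_mat n n" "y \<in> carrier_mat n n" "z \<in> carrier_mat n n" for w x y z
    unfolding t_def using that mat_trace_mult_commute[of w n n "x * (y * z)"]
    by (simp add: square_mult_assoc[of _ n])
  have ex: "fip (commutator w x) (commutator y z) = - (t w x y z - t w x z y - (t x w y z - t x w z y))"
    if "real_skew n w" "real_skew n x" "real_skew n y" "real_skew n z" for w x y z
  proof -
    note k = that[THEN real_skewD(1)]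
    have m: "w * x \<in> carrier_mat n n" "x * w \<in> carrier_mat n n" "y * z \<in> carrier_mat n n" "z * y \<in> carrier_mat n n"
      using k by auto
    have "commutator w x * commutator y z =
        w * x * (y * z) - w * x * (z * y) - (x * w * (y * z) - x * w * (z * y))"
      unfolding commutator_def minus_mult_distrib_mat[OF m(1,2) minus_carrier_mat[OF m(4)]]
        mult_minus_distrib_mat[OF m(1) m(3,4)] mult_minus_distrib_mat[OF m(2) m(3,4)] ..
    also have "mat_trace \<dots> = t w x y z - t w x z y - (t x w y z - t x w z y)"
      using k by (simp add: mat_trace_diff[of _ n] minus_carrier_mat t_def square_mult_assoc[of _ n])
    finally show ?thesis
      using fip_real_skew[OF commutator_carrier[OF k(1,2)] real_skew_commutator[OF that(3,4)]] by simp
  qed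
  note k = assms[THEN real_skewD(1)]
  note k' = k(1) k(2) k(3) k(4)
  have "t b a c d = t a c d b" "t b a d c = t a d c b" "t b c a d = t a d b c" "t b c d a = t a b c d"
    "t c b a d = t a d c b" "t c b d a = t a c b d" "t c a b d = t a b d c" "t c a d b = t a d b c"
    using cyc[OF k(2) k(1) k(3) k(4)] cyc[OF k(2) k(1) k(4) k(3)] cyc[OF k(2) k(3) k(1) k(4)]
      cyc[OF k(3) k(1) k(4) k(2)] cyc[OF k(2) k(3) k(4) k(1)] cyc[OF k(3) k(4) k(1) k(2)]
      cyc[OF k(4) k(1) k(2) k(3)] cyc[OF k(3) k(2) k(1) k(4)] cyc[OF k(2) k(1) k(4) k(3)]
      cyc[OF k(3) k(2) k(4) k(1)] cyc[OF k(2) k(4) k(1) k(3)] cyc[OF k(4) k(1) k(3) k(2)] cyc[OF k(3) k(1) k(2) k(4)]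
    by simp_all
  then show ?thesis unfolding ex[OF assms] ex[OF assms(2,3,1,4)] ex[OF assms(3,1,2,4)] by simp
qed

lemma frob_sq_add_imaginary:
  assumes P: "real_skew n P" and Q: "real_skew n Q"
  shows "frob_sq (P + \<i> \<cdot>\<^sub>m Q) = frob_sq P + frob_sq Q"
proof -
  note c = real_skewD(1)[OF P] real_skewD(1)[OF Q]
  have "(cmod ((P + \<i> \<cdot>\<^sub>m Q) $$ (i, j)))\<^sup>2 = (cmod (P $$ (i, j)))\<^sup>2 + (cmod (Q $$ (i, j)))\<^sup>2"
    if "i < n" "j < n" for i j
  proof -
    have "Im (P $$ (i, j)) = 0" "Im (Q $$ (i, j)) = 0"
      using real_skewD(3)[OF P that] real_skewD(3)[OF Q that] by (simp_all add: complex_eq_iff)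
    then show ?thesis
      using add_smult_entry[OF c that, of \<i>] by (simp add: cmod_power2)
  qed
  then show ?thesis
    using c by (simp add: frob_sq_entries[of _ n n] sum.distrib)
qed

lemma frob_sq_add_smult:
  assumes "P \<in> carrier_mat n n" "Q \<in> carrier_mat n n"
  shows "frob_sq (P + complex_of_real s \<cdot>\<^sub>m Q) = frob_sq P + s\<^sup>2 * frob_sq Q + 2 * s * Re (fip P Q)"
proof -
  have e: "(cmod ((P + complex_of_real s \<cdot>\<^sub>m Q) $$ (i, j)))\<^sup>2 =
      (cmod (P $$ (i, j)))\<^sup>2 + s\<^sup>2 * (cmod (Q $$ (i, j)))\<^sup>2 + 2 * s * Re (P $$ (i, j) * cnj (Q $$ (i, j)))"
    if "i < n" "j < n" for i j
    unfolding add_smult_entry[OF assms that] cmod_power2 by (simp add: power2_eq_square algebra_simps)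
  have "P + complex_of_real s \<cdot>\<^sub>m Q \<in> carrier_mat n n" using assms by simp
  then have "frob_sq (P + complex_of_real s \<cdot>\<^sub>m Q) = (\<Sum>i<n. \<Sum>j<n. (cmod (P $$ (i, j)))\<^sup>2
      + s\<^sup>2 * (cmod (Q $$ (i, j)))\<^sup>2 + 2 * s * Re (P $$ (i, j) * cnj (Q $$ (i, j))))"
    by (simp only: frob_sq_entries) (intro sum.cong refl e, simp_all)
  then show ?thesis
    by (simp only: frob_sq_entries[OF assms(1)] frob_sq_entries[OF assms(2)] fip_entries[OF assms] Re_sum
        sum.distrib sum_distrib_left)
qed

context
  fixes n :: nat and B :: "complex mat"
  assumes B: "B \<in> carrier_mat n n" and skew: "transpose_mat B = - B"
begin

private lemma entry_skew: "i < n \<Longrightarrow> j < n \<Longrightarrow> B $$ (j, i) = - B $$ (i, j)"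
proof -
  assume ij: "i < n" "j < n"
  have "B $$ (j, i) = transpose_mat B $$ (i, j)" using ij carrier_matD[OF B] by simp
  also have "\<dots> = - B $$ (i, j)" unfolding skew using ij carrier_matD[OF B] by simp
  finally show "B $$ (j, i) = - B $$ (i, j)" .
qed

lemma re_part_entry: "i < n \<Longrightarrow> j < n \<Longrightarrow> re_part B $$ (i, j) = complex_of_real (Re (B $$ (i, j)))"
  using carrier_matD[OF B] by (simp add: re_part_def complex_eq_iff)

lemma im_part_entry: "i < n \<Longrightarrow> j < n \<Longrightarrow> im_part B $$ (i, j) = complex_of_real (Im (B $$ (i, j)))"
  using carrier_matD[OF B] by (simp add: im_part_def complex_eq_iff complex_diff_cnj)

lemma re_im_part_carrier: "re_part B \<in> carrier_mat n n" "im_part B \<in> carrier_mat n n"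
  using B by (auto simp: re_part_def im_part_def intro!: minus_carrier_mat)

lemma real_skew_re_part: "real_skew n (re_part B)"
proof (rule real_skewI[OF re_im_part_carrier(1)])
  fix i j assume ij: "i < n" "j < n"
  show "re_part B $$ (j, i) = - re_part B $$ (i, j)"
    using entry_skew[OF ij] by (simp add: re_part_entry[OF ij] re_part_entry[OF ij(2,1)])
  show "cnj (re_part B $$ (i, j)) = re_part B $$ (i, j)"
    by (simp add: re_part_entry[OF ij])
qed

lemma real_skew_im_part: "real_skew n (im_part B)"
proof (rule real_skewI[OF re_im_part_carrier(2)])
  fix i j assume ij: "i < n" "j < n"
  show "im_part B $$ (j, i) = - im_part B $$ (i, j)"
    using entry_skew[OF ij] by (simp add: im_part_entry[OF ij] im_part_entry[OF ij(2,1)])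
  show "cnj (im_part B $$ (i, j)) = im_part B $$ (i, j)"
    by (simp add: im_part_entry[OF ij])
qed

lemma re_im_decomposition: "B = re_part B + \<i> \<cdot>\<^sub>m im_part B" "mat_cnj B = re_part B + (- \<i>) \<cdot>\<^sub>m im_part B"
  using carrier_matD[OF B] carrier_matD[OF re_im_part_carrier(1)] carrier_matD[OF re_im_part_carrier(2)]
  by (auto intro!: eq_matI simp: re_part_entry im_part_entry complex_eq_iff)

end

lemma commutator_add_smult:
  assumes "X \<in> carrier_mat n n" "Y \<in> carrier_mat n n" "X' \<in> carrier_mat n n" "Y' \<in> carrier_mat n n"
    and "a < n" "b < n"
  shows "commutator (X + u \<cdot>\<^sub>m Y) (X' + v \<cdot>\<^sub>m Y') $$ (a, b) = commutator X X' $$ (a, b)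
    + v * commutator X Y' $$ (a, b) + u * commutator Y X' $$ (a, b) + u * v * commutator Y Y' $$ (a, b)"
proof -
  have e: "commutator P Q $$ (a, b) = (\<Sum>t<n. P $$ (a, t) * Q $$ (t, b) - Q $$ (a, t) * P $$ (t, b))"
    if P: "P \<in> carrier_mat n n" and Q: "Q \<in> carrier_mat n n" for P Q
  proof -
    have "commutator P Q $$ (a, b) = (P * Q) $$ (a, b) - (Q * P) $$ (a, b)"
      unfolding commutator_def using that assms(5,6) by (intro index_minus_mat) auto
    then show ?thesis
      by (simp only: mat_mult_entry[OF P Q assms(5,6)] mat_mult_entry[OF Q P assms(5,6)] sum_subtractf)
  qed
  have c: "X + u \<cdot>\<^sub>m Y \<in> carrier_mat n n" "X' + v \<cdot>\<^sub>m Y' \<in> carrier_mat n n" using assms by auto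
  show ?thesis
    unfolding e[OF c] e[OF assms(1,3)] e[OF assms(1,4)] e[OF assms(2,3)] e[OF assms(2,4)]
      sum_distrib_left sum.distrib[symmetric]
  proof (intro sum.cong refl)
    fix t assume "t \<in> {..<n}"
    then have t: "t < n" by simp
    show "(X + u \<cdot>\<^sub>m Y) $$ (a, t) * (X' + v \<cdot>\<^sub>m Y') $$ (t, b) - (X' + v \<cdot>\<^sub>m Y') $$ (a, t) * (X + u \<cdot>\<^sub>m Y) $$ (t, b) =
      X $$ (a, t) * X' $$ (t, b) - X' $$ (a, t) * X $$ (t, b) + v * (X $$ (a, t) * Y' $$ (t, b) - Y' $$ (a, t) * X $$ (t, b))
      + u * (Y $$ (a, t) * X' $$ (t, b) - X' $$ (a, t) * Y $$ (t, b))
      + u * v * (Y $$ (a, t) * Y' $$ (t, b) - Y' $$ (a, t) * Y $$ (t, b))"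
      unfolding add_smult_entry[OF assms(1,2) assms(5) t] add_smult_entry[OF assms(1,2) t assms(6)]
        add_smult_entry[OF assms(3,4) assms(5) t] add_smult_entry[OF assms(3,4) t assms(6)]
      by (simp add: algebra_simps)
  qed
qed

text \<open>The real part of the commutator is \<open>[X, X'] - [Y, Y']\<close>, the imaginary part
  \<open>[X, Y'] + [Y, X']\<close>. Jacobi merges the two cross terms into one that separates the
  unprimed from the primed matrices, so that its double sum factors.\<close>

lemma frob_commutator_complex:
  assumes X: "real_skew n X" and Y: "real_skew n Y" and X': "real_skew n X'" and Y': "real_skew n Y'"
  shows "frob_sq (commutator (X + \<i> \<cdot>\<^sub>m Y) (X' + \<i> \<cdot>\<^sub>m Y')) =
    frob_sq (commutator X X') + frob_sq (commutator Y Y') + frob_sq (commutator X Y') + frob_sq (commutator Y X')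
    - 2 * Re (fip (commutator X Y) (commutator X' Y'))"
proof -
  note c = X[THEN real_skewD(1)] Y[THEN real_skewD(1)] X'[THEN real_skewD(1)] Y'[THEN real_skewD(1)]
  note rs = real_skew_commutator
  note cc = commutator_carrier[OF c(1,3)] commutator_carrier[OF c(2,4)] commutator_carrier[OF c(1,4)] commutator_carrier[OF c(2,3)]
  let ?P = "commutator X X' + complex_of_real (- 1) \<cdot>\<^sub>m commutator Y Y'"
  let ?Q = "commutator X Y' + complex_of_real 1 \<cdot>\<^sub>m commutator Y X'"
  have Pc: "?P \<in> carrier_mat n n" "?Q \<in> carrier_mat n n" using cc by auto
  have rP: "real_skew n (U + complex_of_real s \<cdot>\<^sub>m V)" if U: "real_skew n U" and V: "real_skew n V" for U V s
  proof (rule real_skewI)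
    note k = U[THEN real_skewD(1)] V[THEN real_skewD(1)]
    show "U + complex_of_real s \<cdot>\<^sub>m V \<in> carrier_mat n n" using k by simp
    fix i j assume ij: "i < n" "j < n"
    show "(U + complex_of_real s \<cdot>\<^sub>m V) $$ (j, i) = - (U + complex_of_real s \<cdot>\<^sub>m V) $$ (i, j)"
      unfolding add_smult_entry[OF k ij] add_smult_entry[OF k ij(2,1)]
      using real_skewD(2)[OF U ij] real_skewD(2)[OF V ij] by simp
    show "cnj ((U + complex_of_real s \<cdot>\<^sub>m V) $$ (i, j)) = (U + complex_of_real s \<cdot>\<^sub>m V) $$ (i, j)"
      unfolding add_smult_entry[OF k ij]
      using real_skewD(3)[OF U ij] real_skewD(3)[OF V ij] by simp
  qed
  have sp: "X + \<i> \<cdot>\<^sub>m Y \<in> carrier_mat n n" "X' + \<i> \<cdot>\<^sub>m Y' \<in> carrier_mat n n" using c by auto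
  have "commutator (X + \<i> \<cdot>\<^sub>m Y) (X' + \<i> \<cdot>\<^sub>m Y') = ?P + \<i> \<cdot>\<^sub>m ?Q"
  proof (rule eq_matI)
    fix a b assume "a < dim_row (?P + \<i> \<cdot>\<^sub>m ?Q)" "b < dim_col (?P + \<i> \<cdot>\<^sub>m ?Q)"
    then have ab: "a < n" "b < n" using carrier_matD[OF cc(4)] by simp_all
    show "commutator (X + \<i> \<cdot>\<^sub>m Y) (X' + \<i> \<cdot>\<^sub>m Y') $$ (a, b) = (?P + \<i> \<cdot>\<^sub>m ?Q) $$ (a, b)"
      unfolding commutator_add_smult[OF c ab] add_smult_entry[OF Pc ab] add_smult_entry[OF cc(1,2) ab]
        add_smult_entry[OF cc(3,4) ab] by (simp add: algebra_simps)
  qed (use carrier_matD[OF commutator_carrier[OF sp]] carrier_matD[OF cc(4)] in auto)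
  then have "frob_sq (commutator (X + \<i> \<cdot>\<^sub>m Y) (X' + \<i> \<cdot>\<^sub>m Y')) = frob_sq ?P + frob_sq ?Q"
    by (simp only: frob_sq_add_imaginary[OF rP[OF rs[OF X X'] rs[OF Y Y']] rP[OF rs[OF X Y'] rs[OF Y X']]])
  moreover have "frob_sq ?P + frob_sq ?Q =
      frob_sq (commutator X X') + frob_sq (commutator Y Y') + frob_sq (commutator X Y') + frob_sq (commutator Y X')
      - 2 * Re (fip (commutator X X') (commutator Y Y')) + 2 * Re (fip (commutator X Y') (commutator Y X'))"
    unfolding frob_sq_add_smult[OF cc(1,2)] frob_sq_add_smult[OF cc(3,4)] by simp
  moreover have "Re (fip (commutator X X') (commutator Y Y')) - Re (fip (commutator X Y') (commutator Y X'))
      = Re (fip (commutator X Y) (commutator X' Y'))"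
  proof -
    have neg: "commutator V U = (- 1) \<cdot>\<^sub>m commutator U V" if "U \<in> carrier_mat n n" "V \<in> carrier_mat n n" for U V
      using that by (intro eq_matI) (auto simp: commutator_def)
    have ng: "fip ((- 1) \<cdot>\<^sub>m U) V = - fip U V" if "U \<in> carrier_mat n n" "V \<in> carrier_mat n n" for U V
      using that by (simp add: fip_entries[of _ n n] sum_negf)
    have "fip (commutator X' Y) (commutator X Y') = - fip (commutator Y X') (commutator X Y')"
      unfolding neg[OF c(2,3)] by (rule ng[OF cc(4,3)])
    moreover have "fip (commutator Y X) (commutator X' Y') = - fip (commutator X Y) (commutator X' Y')"
      unfolding neg[OF c(1,2)] by (rule ng[OF commutator_carrier[OF c(1,2)] commutator_carrier[OF c(3,4)]])
    moreover have "Re (fip (commutator Y X') (commutator X Y')) = Re (fip (commutator X Y') (commutator Y X'))"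
      using fip_commute[OF cc(4,3)] by simp
    ultimately show ?thesis
      using arg_cong[OF jacobi_fip[OF X X' Y Y'], of Re] by simp
  qed
  ultimately show ?thesis by argo
qed

lemma sum_lessThan_add:
  fixes f :: "nat \<Rightarrow> 'a :: comm_monoid_add"
  shows "(\<Sum>j<m + k. f j) = (\<Sum>j<m. f j) + (\<Sum>j<k. f (m + j))"
  by (induction k) (simp_all add: add.assoc)

context
  fixes n m :: nat and B :: "nat \<Rightarrow> complex mat"
  assumes B: "\<And>r. r < m \<Longrightarrow> B r \<in> carrier_mat n n"
    and skew: "\<And>r. r < m \<Longrightarrow> transpose_mat (B r) = - B r"
begin

private abbreviation (input) "X r \<equiv> re_part (B r)"
private abbreviation (input) "Y r \<equiv> im_part (B r)"
private abbreviation (input) "As \<equiv> map X [0..<m] @ map Y [0..<m]"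
private abbreviation (input) "Z \<equiv> comb n m (\<lambda>_. 1) (\<lambda>r. commutator (X r) (Y r))"

private lemma rX: "r < m \<Longrightarrow> real_skew n (X r)" and rY: "r < m \<Longrightarrow> real_skew n (Y r)"
  by (rule real_skew_re_part[OF B skew], assumption+) (rule real_skew_im_part[OF B skew], assumption+)

private lemma As_nth: "r < m \<Longrightarrow> As ! r = X r" "r < m \<Longrightarrow> As ! (m + r) = Y r"
  by (simp_all add: nth_append)

lemma real_skew_parts: "j < 2 * m \<Longrightarrow> real_skew n (As ! j)"
  by (cases "j < m") (auto simp: nth_append intro: rX rY)

lemma sum_frob_parts: "(\<Sum>r<m. frob_sq (B r)) = (\<Sum>j<2 * m. frob_sq (As ! j))"
proof -
  have "(\<Sum>r<m. frob_sq (B r)) = (\<Sum>r<m. frob_sq (X r) + frob_sq (Y r))"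
  proof (intro sum.cong refl)
    fix r assume "r \<in> {..<m}"
    then have r: "r < m" by simp
    show "frob_sq (B r) = frob_sq (X r) + frob_sq (Y r)"
      using frob_sq_add_imaginary[OF rX[OF r] rY[OF r]] re_im_decomposition(1)[OF B[OF r] skew[OF r]] by simp
  qed
  also have "\<dots> = (\<Sum>j<m + m. frob_sq (As ! j))"
    unfolding sum_lessThan_add sum.distrib by (simp add: As_nth)
  finally show ?thesis by (simp only: mult_2)
qed

text \<open>The separated cross terms sum to the squared norm of \<open>Z\<close>; the four other
  norms for each pair fill the double sum over the \<open>2 * m\<close> real matrices.\<close>

lemma sum_commutator_parts:
  "(\<Sum>r<m. \<Sum>s<m. frob_sq (commutator (B r) (B s))) =
    (\<Sum>i<2 * m. \<Sum>j<2 * m. frob_sq (commutator (As ! i) (As ! j))) - 2 * frob_sq Z"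
proof -
  let ?z = "\<lambda>r s. Re (fip (commutator (X r) (Y r)) (commutator (X s) (Y s)))"
  have "(\<Sum>r<m. \<Sum>s<m. frob_sq (commutator (B r) (B s))) =
      (\<Sum>r<m. \<Sum>s<m. (frob_sq (commutator (X r) (X s)) + frob_sq (commutator (X r) (Y s)))
        + (frob_sq (commutator (Y r) (X s)) + frob_sq (commutator (Y r) (Y s))) - 2 * ?z r s)"
  proof (intro sum.cong refl)
    fix r s assume "r \<in> {..<m}" "s \<in> {..<m}"
    then have r: "r < m" and s: "s < m" by simp_all
    have d: "B r = X r + \<i> \<cdot>\<^sub>m Y r" "B s = X s + \<i> \<cdot>\<^sub>m Y s"
      by (rule re_im_decomposition(1)[OF B[OF r] skew[OF r]] re_im_decomposition(1)[OF B[OF s] skew[OF s]])+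
    have "frob_sq (commutator (B r) (B s)) = frob_sq (commutator (X r + \<i> \<cdot>\<^sub>m Y r) (X s + \<i> \<cdot>\<^sub>m Y s))"
      using d by simp
    then show "frob_sq (commutator (B r) (B s)) =
        (frob_sq (commutator (X r) (X s)) + frob_sq (commutator (X r) (Y s)))
        + (frob_sq (commutator (Y r) (X s)) + frob_sq (commutator (Y r) (Y s))) - 2 * ?z r s"
      using frob_commutator_complex[OF rX[OF r] rY[OF r] rX[OF s] rY[OF s]] by simp
  qed
  also have "\<dots> = (\<Sum>r<m. \<Sum>s<m. frob_sq (commutator (X r) (X s)) + frob_sq (commutator (X r) (Y s)))
      + (\<Sum>r<m. \<Sum>s<m. frob_sq (commutator (Y r) (X s)) + frob_sq (commutator (Y r) (Y s)))
      - 2 * (\<Sum>r<m. \<Sum>s<m. ?z r s)"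
    by (simp only: sum.distrib sum_subtractf sum_distrib_left)
  also have "(\<Sum>r<m. \<Sum>s<m. ?z r s) = frob_sq Z"
  proof -
    have "complex_of_real (frob_sq Z) = (\<Sum>r<m. \<Sum>s<m. fip (commutator (X r) (Y r)) (commutator (X s) (Y s)))"
      by (subst frob_comb) (auto intro!: commutator_carrier real_skewD(1)[OF rX] real_skewD(1)[OF rY])
    then have "Re (complex_of_real (frob_sq Z)) = (\<Sum>r<m. \<Sum>s<m. ?z r s)" by (simp only: Re_sum)
    then show ?thesis by simp
  qed
  also have "(\<Sum>r<m. \<Sum>s<m. frob_sq (commutator (X r) (X s)) + frob_sq (commutator (X r) (Y s)))
      + (\<Sum>r<m. \<Sum>s<m. frob_sq (commutator (Y r) (X s)) + frob_sq (commutator (Y r) (Y s)))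
      = (\<Sum>i<m + m. \<Sum>j<m + m. frob_sq (commutator (As ! i) (As ! j)))"
    unfolding sum_lessThan_add by (simp add: As_nth sum.distrib)
  finally show ?thesis by (simp only: mult_2)
qed

text \<open>Expanding \<open>[X + \<i> Y, X - \<i> Y]\<close> leaves
  \<open>- 2 * \<i> * [X, Y]\<close>, so the sum is a nonzero multiple of \<open>Z\<close>.\<close>

lemma mat_sum_commutator_cnj_eq_0_iff:
  "mat_sum n (\<lambda>r. commutator (B r) (mat_cnj (B r))) {..<m} = 0\<^sub>m n n \<longleftrightarrow> frob_sq Z = 0"
proof -
  let ?S = "mat_sum n (\<lambda>r. commutator (B r) (mat_cnj (B r))) {..<m}"
  have Zc: "commutator (X r) (Y r) \<in> carrier_mat n n" if "r < m" for r
    using real_skewD(1)[OF rX[OF that]] real_skewD(1)[OF rY[OF that]] by simp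
  have "?S = (- 2 * \<i>) \<cdot>\<^sub>m Z"
  proof (rule eq_matI)
    fix a b assume "a < dim_row ((- 2 * \<i>) \<cdot>\<^sub>m Z)" "b < dim_col ((- 2 * \<i>) \<cdot>\<^sub>m Z)"
    then have ab: "a < n" "b < n" by simp_all
    have "commutator (B r) (mat_cnj (B r)) $$ (a, b) = - 2 * \<i> * commutator (X r) (Y r) $$ (a, b)" if r: "r < m" for r
    proof -
      note c = real_skewD(1)[OF rX[OF r]] real_skewD(1)[OF rY[OF r]]
      note d = re_im_decomposition[OF B[OF r] skew[OF r]]
      have "commutator (B r) (mat_cnj (B r)) $$ (a, b) =
          commutator (X r + \<i> \<cdot>\<^sub>m Y r) (X r + (- \<i>) \<cdot>\<^sub>m Y r) $$ (a, b)"
        using d by simp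
      moreover have "commutator (X r) (X r) $$ (a, b) = 0" "commutator (Y r) (Y r) $$ (a, b) = 0"
        "commutator (Y r) (X r) $$ (a, b) = - commutator (X r) (Y r) $$ (a, b)"
        using ab carrier_matD[OF c(1)] carrier_matD[OF c(2)] by (simp_all add: commutator_def)
      ultimately show ?thesis
        unfolding commutator_add_smult[OF c c ab] by simp
    qed
    then have "?S $$ (a, b) = (\<Sum>r<m. - 2 * \<i> * commutator (X r) (Y r) $$ (a, b))"
      using ab by (simp add: mat_sum_def)
    also have "\<dots> = - 2 * \<i> * Z $$ (a, b)"
      by (simp add: comb_entry[OF Zc ab] sum_distrib_left)
    finally show "?S $$ (a, b) = ((- 2 * \<i>) \<cdot>\<^sub>m Z) $$ (a, b)" using ab by simp
  qed (simp_all add: mat_sum_def)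
  moreover have "(- 2 * \<i>) \<cdot>\<^sub>m Z = 0\<^sub>m n n \<longleftrightarrow> frob_sq ((- 2 * \<i>) \<cdot>\<^sub>m Z) = 0"
    by (subst frob_sq_eq_0_iff[of _ n n]) simp_all
  ultimately show ?thesis
    by (simp add: frob_sq_smult[OF comb_carrier] norm_mult)
qed

end

subsection \<open>Equality for real tuples\<close>

lemma comb_scale:
  assumes "\<And>j. j < k \<Longrightarrow> A j \<in> carrier_mat n n"
  shows "comb n k (\<lambda>t. s * c t) A = complex_of_real s \<cdot>\<^sub>m comb n k c A"
  by (intro eq_matI) (simp_all add: comb_entry[OF assms] sum_distrib_left mult.assoc)

lemma comb_zero:
  assumes "\<And>j. j < k \<Longrightarrow> A j = 0\<^sub>m n n"
  shows "comb n k c A = 0\<^sub>m n n"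
proof (rule eq_matI)
  fix a b assume "a < dim_row (0\<^sub>m n n :: complex mat)" "b < dim_col (0\<^sub>m n n :: complex mat)"
  then have ab: "a < n" "b < n" by simp_all
  have "comb n k c A $$ (a, b) = (\<Sum>j<k. complex_of_real (c j) * A j $$ (a, b))"
    using assms by (intro comb_entry ab) auto
  also have "\<dots> = 0" using assms ab by (intro sum.neutral) auto
  finally show "comb n k c A $$ (a, b) = 0\<^sub>m n n $$ (a, b)" using ab by simp
qed simp_all

lemma unitary_one: "unitary n (1\<^sub>m n)" "mat_cnj (1\<^sub>m n) = 1\<^sub>m n"
proof -
  show c: "mat_cnj (1\<^sub>m n) = 1\<^sub>m n" by (intro eq_matI) auto
  then show "unitary n (1\<^sub>m n)" by (simp add: unitary_def mat_adjoint_eq)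
qed

text \<open>This is the case \<lambda> = 0 of the normal forms. The identity as \<open>P\<close> and
  coordinate vectors as the first columns of \<open>R\<close> suffice.\<close>

lemma K_act_exists_zero:
  assumes k: "3 \<le> length As" and As: "\<And>j. j < length As \<Longrightarrow> As ! j \<in> carrier_mat n n"
    and zero: "(\<Sum>j<length As. frob_sq (As ! j)) = 0"
  shows "\<exists>P R. (P, R) \<in> K_group n (length As) \<and> P \<in> orthogonal_in_unitary n \<and>
    K_act (P, R) As = [0\<^sub>m n n, 0\<^sub>m n n, 0\<^sub>m n n] @ replicate (length As - 3) (0\<^sub>m n n)"
proof -
  have "frob_sq (As ! j) = 0" if "j < length As" for j
    using zero that by (subst (asm) sum_nonneg_eq_0_iff) (auto simp: frob_sq_nonneg)
  then have "As ! j = 0\<^sub>m n n" if "j < length As" for j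
    using frob_sq_eq_0_iff[OF As] that by blast
  then have z: "comb n (length As) c ((!) As) = 0\<^sub>m n n" for c by (rule comb_zero)
  have "mat_adjoint (1\<^sub>m n) * 0\<^sub>m n n * 1\<^sub>m n = (0\<^sub>m n n :: complex mat)"
    using unitary_one(2) by (simp add: mat_adjoint_eq)
  moreover have "real_orthonormal (length As) 3 (\<lambda>i t. if t = i then 1 else 0)"
    unfolding real_orthonormal_def
  proof (intro allI impI)
    fix i j :: nat assume "i < 3" "j < 3"
    then have ij: "i < length As" "j < length As" using k by simp_all
    have "(\<Sum>t<length As. (if t = i then 1 else 0) * (if t = j then 1 else 0 :: real)) =
        (\<Sum>t<length As. if t = i then (if i = j then 1 else 0) else 0)"
      by (intro sum.cong refl) auto
    then show "(\<Sum>t<length As. (if t = i then 1 else 0) * (if t = j then 1 else 0 :: real)) = (if i = j then 1 else 0)"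
      using ij by simp
  qed
  ultimately show ?thesis
    using K_act_exists[OF k As unitary_one(1,2), of "\<lambda>i t. if t = i then 1 else 0" "\<lambda>_. 0\<^sub>m n n"] z zero by auto
qed

text \<open>Equality survives the orthogonalisation and leaves three matrices; the equality case of
  the pairwise estimate supplies the relations that \<open>quaternion_normal_form\<close>
  needs.\<close>

lemma real_skew_equality:
  assumes n: "4 \<le> n" and k: "3 \<le> length As" and As: "\<And>j. j < length As \<Longrightarrow> real_skew n (As ! j)"
  shows "(\<Sum>i<length As. \<Sum>j<length As. frob_sq (commutator (As ! i) (As ! j))) =
      2/3 * (\<Sum>j<length As. frob_sq (As ! j))\<^sup>2 \<longleftrightarrow>
    (\<exists>P R. (P, R) \<in> K_group n (length As) \<and> P \<in> orthogonal_in_unitary n \<and>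
      (\<exists>l::real. l \<ge> 0 \<and> K_act (P, R) As =
        [diag_zero n (D1 (complex_of_real l)), diag_zero n (D2 (complex_of_real l)),
         diag_zero n (D3 (complex_of_real l))] @ replicate (length As - 3) (0\<^sub>m n n)))"
    (is "?eq \<longleftrightarrow> ?normal")
proof
  let ?k = "length As" and ?A = "(!) As"
  let ?N = "\<Sum>j<length As. frob_sq (As ! j)"
  have Ac: "\<And>j. j < ?k \<Longrightarrow> ?A j \<in> carrier_mat n n" using As by (rule real_skewD)
  {
    assume ?normal
    then obtain P R l where PR: "(P, R) \<in> K_group n ?k" and K: "K_act (P, R) As =
        [D_triple n (complex_of_real l) 0, D_triple n (complex_of_real l) 1, D_triple n (complex_of_real l) 2]
        @ replicate (?k - 3) (0\<^sub>m n n)"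
      unfolding D_triple_simps by blast
    show ?eq
      using K_act_sums[OF k Ac PR K] D_triple_sums[OF n, of "complex_of_real l"]
      by (simp add: power2_eq_square power4_eq_xxxx)
  }
  assume eq: ?eq
  show ?normal
  proof (cases "?N = 0")
    case True
    have "diag_zero n (D1 0) = 0\<^sub>m n n" "diag_zero n (D2 0) = 0\<^sub>m n n" "diag_zero n (D3 0) = 0\<^sub>m n n"
      using n by (simp_all add: frob_sq_eq_0_iff[of _ n n, symmetric] diag_zero_carrier[of _ 4] frob_sq_diag_zero[of _ 4] frob_sq_D)
    then show ?thesis
      using K_act_exists_zero[OF k Ac True] by (metis of_real_0 order_refl)
  next
    case False
    then have Npos: "?N > 0" using sum_nonneg[of "{..<?k}" "\<lambda>j. frob_sq (As ! j)"] frob_sq_nonneg by simp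
    obtain \<rho> where \<rho>: "real_orthonormal ?k ?k \<rho>"
      "\<forall>l<?k. \<forall>p<?k. l \<noteq> p \<longrightarrow> fip (comb n ?k (\<rho> l) ?A) (comb n ?k (\<rho> p) ?A) = 0"
      by (rule orthogonal_comb[OF As])
    define A' where "A' l = comb n ?k (\<rho> l) ?A" for l
    have A': "real_skew n (A' l)" for l unfolding A'_def by (rule real_skew_comb[OF As])
    have N': "(\<Sum>j<?k. frob_sq (A' j)) = ?N"
      unfolding A'_def by (rule sum_frob_comb[OF \<rho>(1) Ac])
    have "(\<Sum>i<?k. \<Sum>j<?k. frob_sq (commutator (A' i) (A' j))) =
        (\<Sum>i<?k. \<Sum>j<?k. frob_sq (commutator (?A i) (?A j)))"
      unfolding A'_def by (rule sum_commutator_comb[OF \<rho>(1) Ac])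
    then have eq': "(\<Sum>i<?k. \<Sum>j<?k. frob_sq (commutator (A' i) (A' j))) = 2/3 * (\<Sum>j<?k. frob_sq (A' j))\<^sup>2"
      unfolding N' using eq by simp
    have orth: "fip (A' l) (A' p) = 0" if "l < ?k" "p < ?k" "l \<noteq> p" for l p
      using \<rho>(2) that unfolding A'_def by blast
    have ne: "(\<Sum>j<?k. frob_sq (A' j)) \<noteq> 0" using N' False by simp
    obtain \<alpha> \<beta> \<gamma> where abc: "\<alpha> < ?k" "\<beta> < ?k" "\<gamma> < ?k" "\<alpha> \<noteq> \<beta>" "\<alpha> \<noteq> \<gamma>" "\<beta> \<noteq> \<gamma>"
      "\<forall>i\<in>{\<alpha>, \<beta>, \<gamma>}. frob_sq (A' i) = (\<Sum>j<?k. frob_sq (A' j)) / 3"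
      "\<forall>i\<in>{\<alpha>, \<beta>, \<gamma>}. \<forall>j\<in>{\<alpha>, \<beta>, \<gamma>}. i \<noteq> j \<longrightarrow>
        frob_sq (commutator (A' i) (A' j)) = frob_sq (A' i) * frob_sq (A' j)"
      by (rule orthogonal_tuple_equality[of ?k n A', OF A' orth eq' ne])
    \<comment> \<open>Three matrices of squared norm \<open>4 * \<kappa>^2\<close> each make up
      \<open>?N\<close>.\<close>
    define \<kappa> where "\<kappa> = sqrt (?N / 12)"
    have \<kappa>: "\<kappa> > 0" "12 * \<kappa>\<^sup>2 = ?N" using Npos by (simp_all add: \<kappa>_def)
    have fr: "frob_sq (A' i) = 4 * \<kappa>\<^sup>2" if "i \<in> {\<alpha>, \<beta>, \<gamma>}" for i
      using abc(7) that \<kappa>(2) unfolding N' by auto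
    have anti: "A' i * A' j + A' j * A' i = 0\<^sub>m n n"
      and sq: "A' i * (A' i * A' j) + complex_of_real (\<kappa>\<^sup>2) \<cdot>\<^sub>m A' j = 0\<^sub>m n n"
      if "i \<in> {\<alpha>, \<beta>, \<gamma>}" "j \<in> {\<alpha>, \<beta>, \<gamma>}" "i \<noteq> j" for i j
    proof -
      have e: "frob_sq (commutator (A' i) (A' j)) = frob_sq (A' i) * frob_sq (A' j)"
        using abc(8) that by blast
      have "frob_sq (A' i) / 4 = \<kappa>\<^sup>2" using fr[OF that(1)] by simp
      then show "A' i * A' j + A' j * A' i = 0\<^sub>m n n" "A' i * (A' i * A' j) + complex_of_real (\<kappa>\<^sup>2) \<cdot>\<^sub>m A' j = 0\<^sub>m n n"
        using frob_commutator_equality[OF A' A' e] by simp_all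
    qed
    obtain P and s :: real where P: "unitary n P" "mat_cnj P = P" and s: "s = 1 \<or> s = - 1"
      and PD: "mat_adjoint P * A' \<alpha> * P = diag_zero n (D1 (complex_of_real \<kappa>))"
        "mat_adjoint P * A' \<beta> * P = diag_zero n (D2 (complex_of_real \<kappa>))"
        "mat_adjoint P * (complex_of_real s \<cdot>\<^sub>m A' \<gamma>) * P = diag_zero n (D3 (complex_of_real \<kappa>))"
      by (rule quaternion_normal_form[OF n \<kappa>(1) A'[of \<alpha>] A'[of \<beta>] A'[of \<gamma>] fr fr fr anti anti anti sq sq sq sq])
        (use abc(4-6) in auto)
    \<comment> \<open>The sign of the third matrix is absorbed into the third column of the
      orthogonal matrix.\<close>
    define \<sigma> where "\<sigma> i = (if i = 0 then \<rho> \<alpha> else if i = 1 then \<rho> \<beta> else (\<lambda>t. s * \<rho> \<gamma> t))" for i :: nat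
    have \<rho>\<rho>: "(\<Sum>t<?k. \<rho> i t * \<rho> j t) = (if i = j then 1 else 0)" if "i < ?k" "j < ?k" for i j
      using \<rho>(1) that by (simp add: real_orthonormal_def)
    have ss: "s * s = 1" using s by auto
    have pull: "(\<Sum>t<?k. u t * (s * v t)) = s * (\<Sum>t<?k. u t * v t)"
      "(\<Sum>t<?k. s * u t * v t) = s * (\<Sum>t<?k. u t * v t)" for u v :: "nat \<Rightarrow> real"
      unfolding sum_distrib_left by (intro sum.cong refl; simp)+
    have \<sigma>: "real_orthonormal ?k 3 \<sigma>"
      unfolding real_orthonormal_def
    proof (intro allI impI)
      fix i j :: nat assume ij: "i < 3" "j < 3"
      show "(\<Sum>t<?k. \<sigma> i t * \<sigma> j t) = (if i = j then 1 else 0)"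
        using less_3_cases[OF ij(1)] less_3_cases[OF ij(2)] abc(1-6)
        by (elim disjE; simp add: \<sigma>_def pull \<rho>\<rho> ss)
    qed
    have E: "mat_adjoint P * comb n ?k (\<sigma> i) ?A * P = D_triple n (complex_of_real \<kappa>) i" if "i < 3" for i
      using less_3_cases[OF that] PD comb_scale[of ?k ?A n s "\<rho> \<gamma>", OF Ac]
      by (auto simp: \<sigma>_def D_triple_def A'_def)
    have "(\<Sum>i<3. frob_sq (D_triple n (complex_of_real \<kappa>) i)) = ?N"
      unfolding D_triple_sums(2)[OF n] using \<kappa> by simp
    then show ?thesis
      using K_act_exists[OF k Ac P \<sigma> E] \<kappa>(1) unfolding D_triple_simps by (metis less_imp_le)
  qed
qed

section \<open>The case n = 3\<close>

lemma lagrange_identity: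
  fixes u v :: "nat \<Rightarrow> real"
  shows "(\<Sum>i<k. \<Sum>j<k. (u i * v j - v i * u j)\<^sup>2) =
    2 * ((\<Sum>i<k. (u i)\<^sup>2) * (\<Sum>i<k. (v i)\<^sup>2) - (\<Sum>i<k. u i * v i)\<^sup>2)"
proof -
  have "(\<Sum>i<k. \<Sum>j<k. (u i * v j - v i * u j)\<^sup>2) =
      (\<Sum>i<k. \<Sum>j<k. (u i)\<^sup>2 * (v j)\<^sup>2 + (v i)\<^sup>2 * (u j)\<^sup>2 - 2 * ((u i * v i) * (u j * v j)))"
    by (intro sum.cong refl) (simp add: power2_eq_square algebra_simps)
  also have "\<dots> = (\<Sum>i<k. (u i)\<^sup>2) * (\<Sum>i<k. (v i)\<^sup>2) + (\<Sum>i<k. (v i)\<^sup>2) * (\<Sum>i<k. (u i)\<^sup>2)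
      - 2 * ((\<Sum>i<k. u i * v i) * (\<Sum>i<k. u i * v i))"
    by (simp only: sum.distrib sum_subtractf sum_distrib_left[symmetric] sum_distrib_right[symmetric])
  finally show ?thesis by (simp add: power2_eq_square)
qed

lemma real_skew_3_entries:
  assumes "real_skew 3 A"
  shows "A $$ (0, 0) = 0" "A $$ (Suc 0, Suc 0) = 0" "A $$ (2, 2) = 0"
    "A $$ (0, Suc 0) = complex_of_real (Re (A $$ (0, 1)))" "A $$ (Suc 0, 0) = - complex_of_real (Re (A $$ (0, 1)))"
    "A $$ (0, 2) = complex_of_real (Re (A $$ (0, 2)))" "A $$ (2, 0) = - complex_of_real (Re (A $$ (0, 2)))"
    "A $$ (Suc 0, 2) = complex_of_real (Re (A $$ (1, 2)))" "A $$ (2, Suc 0) = - complex_of_real (Re (A $$ (1, 2)))"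
proof -
  have i: "0 < (3::nat)" "Suc 0 < 3" "2 < (3::nat)" by simp_all
  note s = real_skewD(2)[OF assms] and r = real_skewD(3)[OF assms]
  have e: "complex_of_real (Re (A $$ (p, q))) = A $$ (p, q)" if "p < 3" "q < 3" for p q
    using r[OF that] by (simp add: complex_eq_iff)
  show "A $$ (0, 0) = 0" "A $$ (Suc 0, Suc 0) = 0" "A $$ (2, 2) = 0"
    using s[OF i(1,1)] s[OF i(2,2)] s[OF i(3,3)] by simp_all
  show "A $$ (0, Suc 0) = complex_of_real (Re (A $$ (0, 1)))" "A $$ (Suc 0, 0) = - complex_of_real (Re (A $$ (0, 1)))"
    "A $$ (0, 2) = complex_of_real (Re (A $$ (0, 2)))" "A $$ (2, 0) = - complex_of_real (Re (A $$ (0, 2)))"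
    "A $$ (Suc 0, 2) = complex_of_real (Re (A $$ (1, 2)))" "A $$ (2, Suc 0) = - complex_of_real (Re (A $$ (1, 2)))"
    using e[OF i(1,2)] e[OF i(1,3)] e[OF i(2,3)] s[OF i(1,2)] s[OF i(1,3)] s[OF i(2,3)] by simp_all
qed

lemma frob_sq_3:
  assumes "real_skew 3 A"
  shows "frob_sq A = 2 * ((Re (A $$ (0, 1)))\<^sup>2 + (Re (A $$ (0, 2)))\<^sup>2 + (Re (A $$ (1, 2)))\<^sup>2)"
proof -
  note e = real_skew_3_entries[OF assms]
  define a b c where "a = Re (A $$ (0, 1))" and "b = Re (A $$ (0, 2))" and "c = Re (A $$ (1, 2))"
  show ?thesis
    unfolding frob_sq_entries[OF real_skewD(1)[OF assms]] sum_less_3 One_nat_def e[folded a_def b_def c_def]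
      a_def[symmetric, unfolded One_nat_def] b_def[symmetric] c_def[symmetric, unfolded One_nat_def]
    by simp
qed

text \<open>In the coordinates above the diagonal the commutator is the cross product up to order
  and signs, and each component occurs in two entries.\<close>

lemma frob_commutator_3:
  assumes A: "real_skew 3 A" and B: "real_skew 3 B"
  shows "frob_sq (commutator A B) =
    2 * ((Re (A $$ (0, 1)) * Re (B $$ (0, 2)) - Re (A $$ (0, 2)) * Re (B $$ (0, 1)))\<^sup>2
      + (Re (A $$ (0, 1)) * Re (B $$ (1, 2)) - Re (A $$ (1, 2)) * Re (B $$ (0, 1)))\<^sup>2
      + (Re (A $$ (0, 2)) * Re (B $$ (1, 2)) - Re (A $$ (1, 2)) * Re (B $$ (0, 2)))\<^sup>2)"
proof -
  define a b c where "a = Re (A $$ (0, 1))" and "b = Re (A $$ (0, 2))" and "c = Re (A $$ (1, 2))"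
  define a' b' c' where "a' = Re (B $$ (0, 1))" and "b' = Re (B $$ (0, 2))" and "c' = Re (B $$ (1, 2))"
  note e = real_skew_3_entries[OF A, folded a_def b_def c_def] real_skew_3_entries[OF B, folded a'_def b'_def c'_def]
  have "frob_sq (commutator A B) = 2 * ((a * b' - b * a')\<^sup>2 + (a * c' - c * a')\<^sup>2 + (b * c' - c * b')\<^sup>2)"
    unfolding frob_commutator_entries[OF real_skewD(1)[OF A] real_skewD(1)[OF B]] sum_less_3 One_nat_def e cmod_power2
    by (simp add: power2_eq_square algebra_simps)
  then show ?thesis by (simp add: a_def b_def c_def a'_def b'_def c'_def)
qed

lemma real_skew_3_eqI:
  assumes A: "real_skew 3 A" and B: "real_skew 3 B"
    and "A $$ (0, 1) = B $$ (0, 1)" "A $$ (0, 2) = B $$ (0, 2)" "A $$ (1, 2) = B $$ (1, 2)"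
  shows "A = B"
proof (rule eq_matI)
  note d = carrier_matD[OF real_skewD(1)[OF A]] carrier_matD[OF real_skewD(1)[OF B]]
  fix i j assume "i < dim_row B" "j < dim_col B"
  then have ij: "i < 3" "j < 3" using d by simp_all
  show "A $$ (i, j) = B $$ (i, j)"
    using less_3_cases[OF ij(1)] less_3_cases[OF ij(2)] assms(3-5)
      real_skew_3_entries(1-3)[OF A] real_skew_3_entries(1-3)[OF B]
      real_skewD(2)[OF A, of 0 1] real_skewD(2)[OF A, of 0 2] real_skewD(2)[OF A, of 1 2]
      real_skewD(2)[OF B, of 0 1] real_skewD(2)[OF B, of 0 2] real_skewD(2)[OF B, of 1 2]
    by (elim disjE) simp_all
qed (use carrier_matD[OF real_skewD(1)[OF A]] carrier_matD[OF real_skewD(1)[OF B]] in simp_all)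

lemma C_triple_entry:
  assumes "i < 3" "p < 3" "q < 3"
  shows "C_triple 3 x i $$ (p, q) = (if i = 0 then C1 x else if i = 1 then C2 x else C3 x) $$ (p, q)"
  unfolding C_triple_def using assms by (subst diag_zero_entry[of _ 3]) auto

lemma real_skew_C_triple:
  assumes "i < 3" shows "real_skew 3 (C_triple 3 (complex_of_real x) i)"
proof (rule real_skewI)
  show "C_triple 3 (complex_of_real x) i \<in> carrier_mat 3 3"
    by (auto simp: C_triple_def intro!: diag_zero_carrier[of _ 3])
  fix p q :: nat assume pq: "p < 3" "q < 3"
  show "C_triple 3 (complex_of_real x) i $$ (q, p) = - C_triple 3 (complex_of_real x) i $$ (p, q)"
    "cnj (C_triple 3 (complex_of_real x) i $$ (p, q)) = C_triple 3 (complex_of_real x) i $$ (p, q)"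
    unfolding C_triple_entry[OF assms pq] C_triple_entry[OF assms pq(2,1)]
    using pq by (auto simp: C_entries)
qed

context
  fixes As :: "complex mat list"
  assumes As: "\<And>j. j < length As \<Longrightarrow> real_skew 3 (As ! j)"
begin

text \<open>The coordinates are read across the tuple: \<open>x1\<close>, \<open>x2\<close>,
  \<open>x3\<close> are vectors with one component per matrix, and the argument runs on their 3 x 3
  Gram matrix.\<close>

private definition "x1 j = Re (As ! j $$ (0, 1))"
private definition "x2 j = Re (As ! j $$ (0, 2))"
private definition "x3 j = Re (As ! j $$ (1, 2))"
private abbreviation (input) "dot u v \<equiv> (\<Sum>j<length As. u j * v j :: real)"

private lemma total_3: "(\<Sum>j<length As. frob_sq (As ! j)) = 2 * (dot x1 x1 + dot x2 x2 + dot x3 x3)"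
proof -
  have "(\<Sum>j<length As. frob_sq (As ! j)) = (\<Sum>j<length As. 2 * (x1 j * x1 j + x2 j * x2 j + x3 j * x3 j))"
    by (intro sum.cong refl) (simp add: frob_sq_3[OF As] x1_def x2_def x3_def power2_eq_square)
  then show ?thesis by (simp only: sum_distrib_left[symmetric] sum.distrib)
qed

text \<open>By Lagrange's identity the double sum yields the principal 2 x 2 minors of the Gram
  matrix of \<open>x1\<close>, \<open>x2\<close>, \<open>x3\<close>.\<close>

private lemma commutators_3:
  "(\<Sum>i<length As. \<Sum>j<length As. frob_sq (commutator (As ! i) (As ! j))) =
    4 * (dot x1 x1 * dot x2 x2 + dot x1 x1 * dot x3 x3 + dot x2 x2 * dot x3 x3 - (dot x1 x2)\<^sup>2 - (dot x1 x3)\<^sup>2 - (dot x2 x3)\<^sup>2)"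
proof -
  have "(\<Sum>i<length As. \<Sum>j<length As. frob_sq (commutator (As ! i) (As ! j))) =
      (\<Sum>i<length As. \<Sum>j<length As. 2 * ((x1 i * x2 j - x2 i * x1 j)\<^sup>2 + (x1 i * x3 j - x3 i * x1 j)\<^sup>2 + (x2 i * x3 j - x3 i * x2 j)\<^sup>2))"
    by (intro sum.cong refl) (simp add: frob_commutator_3[OF As As] x1_def x2_def x3_def)
  also have "\<dots> = 2 * ((\<Sum>i<length As. \<Sum>j<length As. (x1 i * x2 j - x2 i * x1 j)\<^sup>2)
      + (\<Sum>i<length As. \<Sum>j<length As. (x1 i * x3 j - x3 i * x1 j)\<^sup>2) + (\<Sum>i<length As. \<Sum>j<length As. (x2 i * x3 j - x3 i * x2 j)\<^sup>2))"
    by (simp only: sum_distrib_left[symmetric] sum.distrib)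
  finally show ?thesis
    unfolding lagrange_identity by (simp add: power2_eq_square)
qed

text \<open>As an exact sum of squares it yields both the inequality and its equality case: the Gram
  matrix must be a multiple of the identity.\<close>

private lemma deficit_3:
  "1/3 * (\<Sum>j<length As. frob_sq (As ! j))\<^sup>2 - (\<Sum>i<length As. \<Sum>j<length As. frob_sq (commutator (As ! i) (As ! j))) =
    2/3 * ((dot x1 x1 - dot x2 x2)\<^sup>2 + (dot x1 x1 - dot x3 x3)\<^sup>2 + (dot x2 x2 - dot x3 x3)\<^sup>2)
    + 4 * ((dot x1 x2)\<^sup>2 + (dot x1 x3)\<^sup>2 + (dot x2 x3)\<^sup>2)"
proof -
  have "1/3 * (2 * (p + q + r))\<^sup>2 - 4 * (p * q + p * r + q * r - x\<^sup>2 - y\<^sup>2 - z\<^sup>2) =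
      2/3 * ((p - q)\<^sup>2 + (p - r)\<^sup>2 + (q - r)\<^sup>2) + 4 * (x\<^sup>2 + y\<^sup>2 + z\<^sup>2)" for p q r x y z :: real
    by (simp add: power2_eq_square algebra_simps)
  then show ?thesis unfolding total_3 commutators_3 .
qed

lemma real_skew_bound_3:
  "(\<Sum>i<length As. \<Sum>j<length As. frob_sq (commutator (As ! i) (As ! j))) \<le> 1/3 * (\<Sum>j<length As. frob_sq (As ! j))\<^sup>2"
proof -
  have "0 \<le> 2/3 * ((dot x1 x1 - dot x2 x2)\<^sup>2 + (dot x1 x1 - dot x3 x3)\<^sup>2 + (dot x2 x2 - dot x3 x3)\<^sup>2)
    + 4 * ((dot x1 x2)\<^sup>2 + (dot x1 x3)\<^sup>2 + (dot x2 x3)\<^sup>2)" by simp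
  then show ?thesis unfolding deficit_3[symmetric] by simp
qed

lemma real_skew_equality_3:
  assumes k: "3 \<le> length As"
  shows "(\<Sum>i<length As. \<Sum>j<length As. frob_sq (commutator (As ! i) (As ! j))) =
      1/3 * (\<Sum>j<length As. frob_sq (As ! j))\<^sup>2 \<longleftrightarrow>
    (\<exists>P R. (P, R) \<in> K_group 3 (length As) \<and> P \<in> orthogonal_in_unitary 3 \<and>
      (\<exists>l::real. l \<ge> 0 \<and> K_act (P, R) As =
        [diag_zero 3 (C1 (complex_of_real l)), diag_zero 3 (C2 (complex_of_real l)),
         diag_zero 3 (C3 (complex_of_real l))] @ replicate (length As - 3) (0\<^sub>m 3 3)))"
    (is "?eq \<longleftrightarrow> ?normal")
proof
  let ?k = "length As" and ?A = "(!) As"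
  let ?N = "\<Sum>j<length As. frob_sq (As ! j)"
  have Ac: "\<And>j. j < ?k \<Longrightarrow> ?A j \<in> carrier_mat 3 3" using As by (rule real_skewD)
  {
    assume ?normal
    then obtain P R l where PR: "(P, R) \<in> K_group 3 ?k" and K: "K_act (P, R) As =
        [C_triple 3 (complex_of_real l) 0, C_triple 3 (complex_of_real l) 1, C_triple 3 (complex_of_real l) 2]
        @ replicate (?k - 3) (0\<^sub>m 3 3)"
      unfolding C_triple_simps by blast
    show ?eq
      using K_act_sums[OF k Ac PR K] C_triple_sums[of 3 "complex_of_real l"]
      by (simp add: power2_eq_square power4_eq_xxxx)
  }
  assume ?eq
  then have d0: "2/3 * ((dot x1 x1 - dot x2 x2)\<^sup>2 + (dot x1 x1 - dot x3 x3)\<^sup>2 + (dot x2 x2 - dot x3 x3)\<^sup>2)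
    + 4 * ((dot x1 x2)\<^sup>2 + (dot x1 x3)\<^sup>2 + (dot x2 x3)\<^sup>2) = 0" using deficit_3 by simp
  have "p = q \<and> p = r \<and> x = 0 \<and> y = 0 \<and> z = 0"
    if "2/3 * ((p - q)\<^sup>2 + (p - r)\<^sup>2 + (q - r)\<^sup>2) + 4 * (x\<^sup>2 + y\<^sup>2 + z\<^sup>2) = 0" for p q r x y z :: real
  proof -
    have nn: "(p - q)\<^sup>2 \<ge> 0" "(p - r)\<^sup>2 \<ge> 0" "(q - r)\<^sup>2 \<ge> 0" "x\<^sup>2 \<ge> 0" "y\<^sup>2 \<ge> 0" "z\<^sup>2 \<ge> 0" by simp_all
    have "(p - q)\<^sup>2 = 0" "(p - r)\<^sup>2 = 0" "x\<^sup>2 = 0" "y\<^sup>2 = 0" "z\<^sup>2 = 0"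
      using nn that by argo+
    then show ?thesis by simp
  qed
  from this[OF d0] have dots: "dot x2 x2 = dot x1 x1" "dot x3 x3 = dot x1 x1" "dot x1 x2 = 0" "dot x1 x3 = 0" "dot x2 x3 = 0"
    by simp_all
  show ?normal
  proof (cases "?N = 0")
    case True
    have "diag_zero 3 (C1 0) = 0\<^sub>m 3 3" "diag_zero 3 (C2 0) = 0\<^sub>m 3 3" "diag_zero 3 (C3 0) = 0\<^sub>m 3 3"
      by (simp_all add: frob_sq_eq_0_iff[of _ 3 3, symmetric] diag_zero_carrier[of _ 3] frob_sq_diag_zero[of _ 3] frob_sq_C)
    then show ?thesis
      using K_act_exists_zero[OF k Ac True] by (metis of_real_0 order_refl)
  next
    case False
    then have "dot x1 x1 \<noteq> 0" unfolding total_3 dots by simp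
    moreover have "dot x1 x1 \<ge> 0" by (intro sum_nonneg) simp
    ultimately have pos: "dot x1 x1 > 0" by simp
    define \<kappa> where "\<kappa> = sqrt (dot x1 x1)"
    have \<kappa>: "\<kappa> > 0" "dot x1 x1 = \<kappa>\<^sup>2" using pos by (simp_all add: \<kappa>_def)
    define v where "v i = (if i = 0 then x1 else if i = 1 then x2 else x3)" for i :: nat
    have vv: "dot (v i) (v j) = (if i = j then \<kappa>\<^sup>2 else 0)" if "i < 3" "j < 3" for i j
      using less_3_cases[OF that(1)] less_3_cases[OF that(2)] dots \<kappa>(2)
      by (elim disjE) (simp_all add: v_def mult.commute[of "x2 _" "x1 _"] mult.commute[of "x3 _" "x1 _"] mult.commute[of "x3 _" "x2 _"])
    \<comment> \<open>The Gram matrix is \<open>\<kappa>^2\<close> times the identity, so the scaled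
      coordinate vectors are orthonormal. As columns of \<open>R\<close> they produce the normal
      form with \<open>P\<close> the identity.\<close>
    define \<sigma> where "\<sigma> i t = v i t / \<kappa>" for i t
    have \<sigma>v: "dot (\<sigma> i) (v j) = (if i = j then \<kappa> else 0)" if "i < 3" "j < 3" for i j
    proof -
      have "dot (\<sigma> i) (v j) = dot (v i) (v j) / \<kappa>" by (simp add: \<sigma>_def sum_divide_distrib)
      then show ?thesis using vv[OF that] \<kappa>(1) by (simp add: power2_eq_square)
    qed
    have \<sigma>: "real_orthonormal ?k 3 \<sigma>"
      unfolding real_orthonormal_def
    proof (intro allI impI)
      fix i j :: nat assume ij: "i < 3" "j < 3"
      have "dot (\<sigma> i) (\<sigma> j) = dot (\<sigma> i) (v j) / \<kappa>" by (simp add: \<sigma>_def sum_divide_distrib)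
      then show "dot (\<sigma> i) (\<sigma> j) = (if i = j then 1 else 0)" using \<sigma>v[OF ij] \<kappa>(1) by simp
    qed
    have E: "mat_adjoint (1\<^sub>m 3) * comb 3 ?k (\<sigma> i) ?A * 1\<^sub>m 3 = C_triple 3 (complex_of_real \<kappa>) i" if i: "i < 3" for i
    proof -
      have co: "comb 3 ?k (\<sigma> i) ?A $$ (p, q) = complex_of_real (if i = d then \<kappa> else 0)"
        if "p < 3" "q < 3" "d < 3" "\<And>j. j < ?k \<Longrightarrow> As ! j $$ (p, q) = complex_of_real (v d j)" for p q d
        unfolding \<sigma>v[OF i that(3), symmetric]
        by (subst comb_entry[OF Ac that(1,2)]) (simp_all add: that(4))
      have e: "As ! j $$ (0, 1) = complex_of_real (v 0 j)" "As ! j $$ (0, 2) = complex_of_real (v 1 j)"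
        "As ! j $$ (1, 2) = complex_of_real (v 2 j)" if "j < ?k" for j
        using real_skew_3_entries(4,6,8)[OF As[OF that]] by (simp_all add: v_def x1_def x2_def x3_def)
      have "comb 3 ?k (\<sigma> i) ?A = C_triple 3 (complex_of_real \<kappa>) i"
      proof (rule real_skew_3_eqI[OF real_skew_comb[OF As] real_skew_C_triple[OF i]])
        show "comb 3 ?k (\<sigma> i) ?A $$ (0, 1) = C_triple 3 (complex_of_real \<kappa>) i $$ (0, 1)"
          using less_3_cases[OF i] by (subst co[OF _ _ _ e(1)]) (auto simp: C_triple_entry C_entries)
        show "comb 3 ?k (\<sigma> i) ?A $$ (0, 2) = C_triple 3 (complex_of_real \<kappa>) i $$ (0, 2)"
          using less_3_cases[OF i] by (subst co[OF _ _ _ e(2)]) (auto simp: C_triple_entry C_entries)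
        show "comb 3 ?k (\<sigma> i) ?A $$ (1, 2) = C_triple 3 (complex_of_real \<kappa>) i $$ (1, 2)"
          using less_3_cases[OF i] by (subst co[OF _ _ _ e(3)]) (auto simp: C_triple_entry C_entries)
      qed
      moreover have "mat_adjoint (1\<^sub>m 3) = (1\<^sub>m 3 :: complex mat)"
        using unitary_one(2)[of 3] by (simp add: mat_adjoint_eq)
      moreover have "C_triple 3 (complex_of_real \<kappa>) i \<in> carrier_mat 3 3"
        by (rule real_skewD(1)[OF real_skew_C_triple[OF i]])
      ultimately show ?thesis by simp
    qed
    have "(\<Sum>i<3. frob_sq (C_triple 3 (complex_of_real \<kappa>) i)) = ?N"
      unfolding total_3 dots using C_triple_sums(2)[of 3 "complex_of_real \<kappa>"] \<kappa> by simp
    then show ?thesis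
      using K_act_exists[OF k Ac unitary_one \<sigma> E] \<kappa>(1) unfolding C_triple_simps by (metis less_imp_le)
  qed
qed

end

text \<open>\<open>T\<close> stands for the sum over the real tuple and \<open>z\<close> for the
  squared norm split off by the Jacobi identity; equality needs both estimates to be sharp.\<close>

lemma equality_with_defect:
  fixes S T z b :: real
  assumes "S = T - 2 * z" "0 \<le> z" "T \<le> b"
  shows "S \<le> b" "S = b \<longleftrightarrow> z = 0 \<and> T = b"
  using assms by auto

theorem corollary2p6:
  fixes n m :: nat and B :: "nat \<Rightarrow> complex mat"
  assumes "m \<ge> 3"
    and "\<And>r. r < m \<Longrightarrow> B r \<in> carrier_mat n n"
    and "\<And>r. r < m \<Longrightarrow> transpose_mat (B r) = - B r"
  shows
    "(n = 3 \<longrightarrow>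
        (\<Sum>r<m. \<Sum>s<m. frob_sq (commutator (B r) (B s))) \<le> 1 / 3 * (\<Sum>r<m. frob_sq (B r))\<^sup>2 \<and>
        ((\<Sum>r<m. \<Sum>s<m. frob_sq (commutator (B r) (B s))) = 1 / 3 * (\<Sum>r<m. frob_sq (B r))\<^sup>2 \<longleftrightarrow>
          mat_sum n (\<lambda>r. commutator (B r) (mat_cnj (B r))) {..<m} = 0\<^sub>m n n \<and>
          (\<exists>P R. (P, R) \<in> K_group n (2 * m) \<and> P \<in> orthogonal_in_unitary n \<and>
            (\<exists>l::real. l \<ge> 0 \<and>
              K_act (P, R) (map (\<lambda>r. re_part (B r)) [0..<m] @ map (\<lambda>r. im_part (B r)) [0..<m]) =
              [diag_zero n (C1 (complex_of_real l)), diag_zero n (C2 (complex_of_real l)),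
               diag_zero n (C3 (complex_of_real l))] @ replicate (2 * m - 3) (0\<^sub>m n n))))) \<and>
     (n \<ge> 4 \<longrightarrow>
        (\<Sum>r<m. \<Sum>s<m. frob_sq (commutator (B r) (B s))) \<le> 2 / 3 * (\<Sum>r<m. frob_sq (B r))\<^sup>2 \<and>
        ((\<Sum>r<m. \<Sum>s<m. frob_sq (commutator (B r) (B s))) = 2 / 3 * (\<Sum>r<m. frob_sq (B r))\<^sup>2 \<longleftrightarrow>
          mat_sum n (\<lambda>r. commutator (B r) (mat_cnj (B r))) {..<m} = 0\<^sub>m n n \<and>
          (\<exists>P R. (P, R) \<in> K_group n (2 * m) \<and> P \<in> orthogonal_in_unitary n \<and>
            (\<exists>l::real. l \<ge> 0 \<and>
              K_act (P, R) (map (\<lambda>r. re_part (B r)) [0..<m] @ map (\<lambda>r. im_part (B r)) [0..<m]) =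
              [diag_zero n (D1 (complex_of_real l)), diag_zero n (D2 (complex_of_real l)),
               diag_zero n (D3 (complex_of_real l))] @ replicate (2 * m - 3) (0\<^sub>m n n)))))"
proof -
  let ?As = "map (\<lambda>r. re_part (B r)) [0..<m] @ map (\<lambda>r. im_part (B r)) [0..<m]"
  let ?Z = "comb n m (\<lambda>_. 1) (\<lambda>r. commutator (re_part (B r)) (im_part (B r)))"
  let ?T = "\<Sum>i<length ?As. \<Sum>j<length ?As. frob_sq (commutator (?As ! i) (?As ! j))"
  let ?N = "\<Sum>j<length ?As. frob_sq (?As ! j)"
  have len: "length ?As = 2 * m" by simp
  have k: "3 \<le> length ?As" using assms(1) by simp
  have skew: "real_skew n (?As ! j)" if "j < length ?As" for j
    by (rule real_skew_parts[OF assms(2,3)]) (use that in simp_all)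
  have S: "(\<Sum>r<m. \<Sum>s<m. frob_sq (commutator (B r) (B s))) = ?T - 2 * frob_sq ?Z"
    unfolding len by (rule sum_commutator_parts[OF assms(2,3)])
  have N: "(\<Sum>r<m. frob_sq (B r)) = ?N"
    unfolding len by (rule sum_frob_parts[OF assms(2,3)])
  have Z: "mat_sum n (\<lambda>r. commutator (B r) (mat_cnj (B r))) {..<m} = 0\<^sub>m n n \<longleftrightarrow> frob_sq ?Z = 0"
    by (rule mat_sum_commutator_cnj_eq_0_iff[OF assms(2,3)])
  note defect = equality_with_defect[OF S frob_sq_nonneg]
  show ?thesis
  proof (intro conjI impI)
    assume n3: "n = 3"
    have skew3: "\<And>j. j < length ?As \<Longrightarrow> real_skew 3 (?As ! j)" using skew n3 by blast
    have T: "?T \<le> 1/3 * ?N\<^sup>2" by (rule real_skew_bound_3[OF skew3])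
    show "(\<Sum>r<m. \<Sum>s<m. frob_sq (commutator (B r) (B s))) \<le> 1/3 * (\<Sum>r<m. frob_sq (B r))\<^sup>2"
      unfolding N by (rule defect(1)[OF T])
    show "(\<Sum>r<m. \<Sum>s<m. frob_sq (commutator (B r) (B s))) = 1/3 * (\<Sum>r<m. frob_sq (B r))\<^sup>2 \<longleftrightarrow>
      mat_sum n (\<lambda>r. commutator (B r) (mat_cnj (B r))) {..<m} = 0\<^sub>m n n \<and>
      (\<exists>P R. (P, R) \<in> K_group n (2 * m) \<and> P \<in> orthogonal_in_unitary n \<and>
        (\<exists>l::real. l \<ge> 0 \<and> K_act (P, R) ?As =
          [diag_zero n (C1 (complex_of_real l)), diag_zero n (C2 (complex_of_real l)),
           diag_zero n (C3 (complex_of_real l))] @ replicate (2 * m - 3) (0\<^sub>m n n)))"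
      unfolding N Z defect(2)[OF T] unfolding len n3
      by (rule conj_cong[OF refl]) (rule real_skew_equality_3[OF skew3 k, unfolded len])
  next
    assume n4: "4 \<le> n"
    have T: "?T \<le> 2/3 * ?N\<^sup>2" by (rule skew_tuple_bound[OF skew])
    show "(\<Sum>r<m. \<Sum>s<m. frob_sq (commutator (B r) (B s))) \<le> 2/3 * (\<Sum>r<m. frob_sq (B r))\<^sup>2"
      unfolding N by (rule defect(1)[OF T])
    show "(\<Sum>r<m. \<Sum>s<m. frob_sq (commutator (B r) (B s))) = 2/3 * (\<Sum>r<m. frob_sq (B r))\<^sup>2 \<longleftrightarrow>
      mat_sum n (\<lambda>r. commutator (B r) (mat_cnj (B r))) {..<m} = 0\<^sub>m n n \<and>
      (\<exists>P R. (P, R) \<in> K_group n (2 * m) \<and> P \<in> orthogonal_in_unitary n \<and>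
        (\<exists>l::real. l \<ge> 0 \<and> K_act (P, R) ?As =
          [diag_zero n (D1 (complex_of_real l)), diag_zero n (D2 (complex_of_real l)),
           diag_zero n (D3 (complex_of_real l))] @ replicate (2 * m - 3) (0\<^sub>m n n)))"
      unfolding N Z defect(2)[OF T] unfolding len
      by (rule conj_cong[OF refl]) (rule real_skew_equality[OF n4 k skew, unfolded len])
  qed
qed

end
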